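(* Let $(M,\mathfrak g)$ be a smooth connected Riemannian manifold of dimension $d\ge 1$, let $X$ be a smooth vector field on $M$ and $L=\Delta_{\mathfrak g}+X$. Let $\rho\in\mathbb R$ and $n\in\mathbb R\setminus\{d\}$. Assume that either $L$ satisfies the $TCD(\rho,n)$ condition with $n\in\mathbb R\setminus(0,d]$, or $L$ is a quasi-model $QM(\rho,n)$. Let $I\subset\mathbb R$ be an open interval and let $\Phi:I\times[0,\infty)\to\mathbb R$, $(y,z)\mapsto\Phi(y,z)$, be a smooth function; denote by $\Phi_i$ and $\Phi_{ij}$, $i,j\in\{1,2\}$, its first and second partial derivatives. Assume that at every point $(y,z)\in I\times[0,\infty)$ at least one of the following three sets of conditions holds (all derivatives of $\Phi$ being evaluated at $(y,z)$): (i) $\Phi_2>0$; $\ \Phi_2\frac{n+1-d}{n-d}+2z\Phi_{22}>0$; $\ (n-d)\big(n\Phi_2+2(n-1)z\Phi_{22}\big)>0$; and $$2\rho\,\Phi_2+\Phi_{11}-2(n-1)\frac{z\,\Phi_{12}^2}{n\Phi_2+2(n-1)z\Phi_{22}}\ge 0;$$ (ii) $\Phi_2=0$; $\ z\Phi_{22}=0$; $\ z\Phi_{12}=0$; $\ z\Phi_{11}\ge0$; (iii) $\Phi_2=0$; $\ z\Phi_{22}>0$; $\ \Phi_{11}\Phi_{22}-\Phi_{12}^2\ge0$. Then for every smooth $F:M\to I$ with $L(F)=0$, one has $L\big[\Phi(F,\Gamma(F))\big]\ge0$ on $M$.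
   Context: $\Delta_{\mathfrak g}$ is the Laplace-Beltrami operator of $(M,\mathfrak g)$ and $\mathrm{Ric}_{\mathfrak g}$ its Ricci tensor. The carré du champ operator of $L$ is $\Gamma(f,g)=\frac12[L(fg)-fLg-gLf]$, with $\Gamma(f)=\Gamma(f,f)$ (here $\Gamma(f)=|\nabla f|^2_{\mathfrak g}$). Set $\mathrm{Ric}(L)=\mathrm{Ric}_{\mathfrak g}-\nabla_S X$, where $\nabla_S X$ is the symmetrized tensor of $\nabla X$; $X\otimes X$ is the symmetric tensor $v\mapsto \mathfrak g(X,v)^2$, and inequalities between tensors are inequalities of quadratic forms. For $\rho\in\mathbb R$, $n\in\mathbb R\setminus\{d\}$: $L$ satisfies $TCD(\rho,n)$ if $\frac{n-d}{n}\big(\mathrm{Ric}(L)-\rho\,\mathfrak g\big)\ge\frac{X\otimes X}{n}$ when $n\ne0$, and $-d\,(\mathrm{Ric}(L)-\rho\,\mathfrak g)\le X\otimes X$ when $n=0$. $L$ is a quasi-model $QM(\rho,n)$ if $(n-d)\big(\mathrm{Ric}(L)-\rho\,\mathfrak g\big)=X\otimes X$. *)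

theory Defs
  imports "HOL-Analysis.Analysis"
begin

text \<open>
  Derivatives are taken within \<open>S\<close>. If \<open>S\<close> is open these are ordinary derivatives; if \<open>S\<close> is
  convex with nonempty interior (such as \<open>I \<times> {0..}\<close>) the derivative within \<open>S\<close> is still unique
  and is one-sided at the boundary. These are the only two kinds of \<open>S\<close> used.
\<close>

primrec Ck_on ::
  "nat \<Rightarrow> 'a::euclidean_space set \<Rightarrow> ('a \<Rightarrow> 'b::real_normed_vector) \<Rightarrow> bool" where
  "Ck_on 0 S f \<longleftrightarrow> continuous_on S f"
| "Ck_on (Suc k) S f \<longleftrightarrow> f differentiable_on S \<and>
     (\<forall>v. Ck_on k S (\<lambda>x. frechet_derivative f (at x within S) v))"

definition smooth_on :: "'a::euclidean_space set \<Rightarrow> ('a \<Rightarrow> 'b::real_normed_vector) \<Rightarrow> bool" where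
  "smooth_on S f \<longleftrightarrow> (\<forall>k. Ck_on k S f)"

definition partial1 :: "(real \<times> real) set \<Rightarrow> (real \<times> real \<Rightarrow> real) \<Rightarrow> real \<times> real \<Rightarrow> real" where
  "partial1 S \<Phi> u = frechet_derivative \<Phi> (at u within S) (1, 0)"

definition partial2 :: "(real \<times> real) set \<Rightarrow> (real \<times> real \<Rightarrow> real) \<Rightarrow> real \<times> real \<Rightarrow> real" where
  "partial2 S \<Phi> u = frechet_derivative \<Phi> (at u within S) (0, 1)"

definition pderivative :: "'n \<Rightarrow> (real^'n \<Rightarrow> real) \<Rightarrow> real^'n::finite \<Rightarrow> real" where
  "pderivative i f x = frechet_derivative f (at x) (axis i 1)"


text \<open>
  A chart is a pair \<open>(U, \<phi>)\<close>; only the values of \<open>\<phi>\<close> on \<open>U\<close> are meaningful.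
  The dimension of the manifold is \<open>CARD('n)\<close>.
\<close>

type_synonym ('m, 'n) chart = "'m set \<times> ('m \<Rightarrow> real^'n)"

definition chart_image :: "('m, 'n::finite) chart \<Rightarrow> (real^'n) set" where
  "chart_image c = snd c ` fst c"

definition chart_inv :: "('m, 'n::finite) chart \<Rightarrow> real^'n \<Rightarrow> 'm" where
  "chart_inv c = inv_into (fst c) (snd c)"

definition smooth_manifold :: "'m topology \<Rightarrow> ('m, 'n::finite) chart set \<Rightarrow> bool" where
  "smooth_manifold M A \<longleftrightarrow>
     Hausdorff_space M \<and> second_countable M \<and> topspace M = (\<Union>c\<in>A. fst c) \<and>
     (\<forall>c\<in>A. openin M (fst c) \<and> open (chart_image c) \<and>
        homeomorphic_map (subtopology M (fst c)) (top_of_set (chart_image c)) (snd c)) \<and>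
     (\<forall>c\<in>A. \<forall>c'\<in>A. smooth_on (snd c ` (fst c \<inter> fst c')) (snd c' \<circ> chart_inv c))"

definition smooth_fun :: "('m, 'n::finite) chart set \<Rightarrow> ('m \<Rightarrow> real) \<Rightarrow> bool" where
  "smooth_fun A f \<longleftrightarrow> (\<forall>c\<in>A. smooth_on (chart_image c) (f \<circ> chart_inv c))"


text \<open>
  Tangent vectors at \<open>p\<close> are the directional derivative operators at \<open>p\<close>. They act on all
  functions differentiable at \<open>p\<close>, in particular on local coordinates, and are set to \<open>0\<close> on
  other functions so that equality of tangent vectors does not depend on the chart.
\<close>

type_synonym 'm tangent_vector = "('m \<Rightarrow> real) \<Rightarrow> real"

definition coord_vector :: "('m, 'n::finite) chart \<Rightarrow> 'm \<Rightarrow> real^'n \<Rightarrow> 'm tangent_vector" where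
  "coord_vector c p w = (\<lambda>f.
     if (f \<circ> chart_inv c) differentiable (at (snd c p))
     then frechet_derivative (f \<circ> chart_inv c) (at (snd c p)) w else 0)"

definition tangent_space :: "('m, 'n::finite) chart set \<Rightarrow> 'm \<Rightarrow> 'm tangent_vector set" where
  "tangent_space A p = {coord_vector c p w | c w. c \<in> A \<and> p \<in> fst c}"

text \<open>The components of a tangent vector are its values on the coordinate functions.\<close>

definition components :: "('m, 'n::finite) chart \<Rightarrow> 'm tangent_vector \<Rightarrow> real^'n" where
  "components c v = (\<chi> k. v (\<lambda>q. snd c q $ k))"

definition smooth_vector_field ::
  "'m topology \<Rightarrow> ('m, 'n::finite) chart set \<Rightarrow> ('m \<Rightarrow> 'm tangent_vector) \<Rightarrow> bool" where
  "smooth_vector_field M A X \<longleftrightarrow>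
     (\<forall>p\<in>topspace M. X p \<in> tangent_space A p) \<and>
     (\<forall>c\<in>A. smooth_on (chart_image c) (\<lambda>x. components c (X (chart_inv c x))))"


type_synonym 'm metric = "'m \<Rightarrow> 'm tangent_vector \<Rightarrow> 'm tangent_vector \<Rightarrow> real"

text \<open>
  As \<open>coord_vector c p\<close> identifies \<open>real^'n\<close> with the tangent space at \<open>p\<close>, the clauses below
  say that \<open>g p\<close> is an inner product on the tangent space and that the \<open>g\<^sub>i\<^sub>j\<close> are smooth.
\<close>

definition riemannian_metric ::
  "'m topology \<Rightarrow> ('m, 'n::finite) chart set \<Rightarrow> 'm metric \<Rightarrow> bool" where
  "riemannian_metric M A g \<longleftrightarrow>
     (\<forall>c\<in>A. \<forall>p\<in>fst c. bilinear (\<lambda>v w. g p (coord_vector c p v) (coord_vector c p w))) \<and>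
     (\<forall>p\<in>topspace M. \<forall>v\<in>tangent_space A p. \<forall>w\<in>tangent_space A p. g p v w = g p w v) \<and>
     (\<forall>c\<in>A. \<forall>p\<in>fst c. \<forall>w. w \<noteq> 0 \<longrightarrow> g p (coord_vector c p w) (coord_vector c p w) > 0) \<and>
     (\<forall>c\<in>A. \<forall>v w. smooth_on (chart_image c) (\<lambda>x. g (chart_inv c x)
        (coord_vector c (chart_inv c x) v) (coord_vector c (chart_inv c x) w)))"

definition riemannian_manifold ::
  "'m topology \<Rightarrow> ('m, 'n::finite) chart set \<Rightarrow> 'm metric \<Rightarrow> bool" where
  "riemannian_manifold M A g \<longleftrightarrow> smooth_manifold M A \<and> riemannian_metric M A g"

definition metric_matrix :: "('m, 'n::finite) chart \<Rightarrow> 'm metric \<Rightarrow> real^'n \<Rightarrow> real^'n^'n" where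
  "metric_matrix c g x = (\<chi> i j. g (chart_inv c x)
     (coord_vector c (chart_inv c x) (axis i 1)) (coord_vector c (chart_inv c x) (axis j 1)))"

definition christoffel ::
  "('m, 'n::finite) chart \<Rightarrow> 'm metric \<Rightarrow> 'n \<Rightarrow> 'n \<Rightarrow> 'n \<Rightarrow> real^'n \<Rightarrow> real" where
  "christoffel c g k i j x =
     (\<Sum>l\<in>UNIV. matrix_inv (metric_matrix c g x) $ k $ l *
        (pderivative i (\<lambda>y. metric_matrix c g y $ j $ l) x
         + pderivative j (\<lambda>y. metric_matrix c g y $ i $ l) x
         - pderivative l (\<lambda>y. metric_matrix c g y $ i $ j) x)) / 2"

text \<open>
  \<open>riemann_curvature c g l k i j\<close> is the \<open>l\<close>-th component of \<open>R(\<partial>\<^sub>i, \<partial>\<^sub>j) \<partial>\<^sub>k\<close>, where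
  \<open>R(X, Y) Z = \<nabla>\<^sub>X \<nabla>\<^sub>Y Z - \<nabla>\<^sub>Y \<nabla>\<^sub>X Z - \<nabla>\<^bsub>[X, Y]\<^esub> Z\<close>; then
  \<open>Ric(Y, Z)\<close> is the trace of \<open>W \<mapsto> R(W, Y) Z\<close>, which is positive on round spheres.
\<close>

definition riemann_curvature ::
  "('m, 'n::finite) chart \<Rightarrow> 'm metric \<Rightarrow> 'n \<Rightarrow> 'n \<Rightarrow> 'n \<Rightarrow> 'n \<Rightarrow> real^'n \<Rightarrow> real" where
  "riemann_curvature c g l k i j x =
     pderivative i (christoffel c g l j k) x - pderivative j (christoffel c g l i k) x
     + (\<Sum>m\<in>UNIV. christoffel c g l i m x * christoffel c g m j k x)
     - (\<Sum>m\<in>UNIV. christoffel c g l j m x * christoffel c g m i k x)"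

text \<open>
  The following objects do not depend on the choice of a chart around \<open>p\<close>; they are computed in
  an arbitrary chart of the atlas.
\<close>

definition chart_at :: "('m, 'n::finite) chart set \<Rightarrow> 'm \<Rightarrow> ('m, 'n) chart" where
  "chart_at A p = (SOME c. c \<in> A \<and> p \<in> fst c)"

definition ricci :: "('m, 'n::finite) chart set \<Rightarrow> 'm metric \<Rightarrow> 'm metric" where
  "ricci A g p v w = (let c = chart_at A p in
     \<Sum>j\<in>UNIV. \<Sum>k\<in>UNIV. (\<Sum>i\<in>UNIV. riemann_curvature c g i k i j (snd c p)) *
       components c v $ j * components c w $ k)"

definition covariant_derivative ::
  "('m, 'n::finite) chart set \<Rightarrow> 'm metric \<Rightarrow> ('m \<Rightarrow> 'm tangent_vector) \<Rightarrow> 'm \<Rightarrow>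
    'm tangent_vector \<Rightarrow> 'm tangent_vector" where
  "covariant_derivative A g X p v = (let c = chart_at A p in coord_vector c p
     (\<chi> k. \<Sum>i\<in>UNIV. components c v $ i *
        (pderivative i (\<lambda>x. components c (X (chart_inv c x)) $ k) (snd c p)
         + (\<Sum>j\<in>UNIV. christoffel c g k i j (snd c p) * components c (X p) $ j))))"

definition sym_nabla ::
  "('m, 'n::finite) chart set \<Rightarrow> 'm metric \<Rightarrow> ('m \<Rightarrow> 'm tangent_vector) \<Rightarrow> 'm metric" where
  "sym_nabla A g X p v w =
     (g p (covariant_derivative A g X p v) w + g p v (covariant_derivative A g X p w)) / 2"

text \<open>The Laplace-Beltrami operator, as the trace of the covariant Hessian.\<close>

definition laplace_beltrami ::
  "('m, 'n::finite) chart set \<Rightarrow> 'm metric \<Rightarrow> ('m \<Rightarrow> real) \<Rightarrow> 'm \<Rightarrow> real" where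
  "laplace_beltrami A g f p = (let c = chart_at A p; x = snd c p; h = f \<circ> chart_inv c in
     \<Sum>i\<in>UNIV. \<Sum>j\<in>UNIV. matrix_inv (metric_matrix c g x) $ i $ j *
       (pderivative i (pderivative j h) x
        - (\<Sum>k\<in>UNIV. christoffel c g k i j x * pderivative k h x)))"


definition diffusion_operator ::
  "('m, 'n::finite) chart set \<Rightarrow> 'm metric \<Rightarrow> ('m \<Rightarrow> 'm tangent_vector) \<Rightarrow>
    ('m \<Rightarrow> real) \<Rightarrow> 'm \<Rightarrow> real" where
  "diffusion_operator A g X f p = laplace_beltrami A g f p + X p f"

definition carre_du_champ ::
  "(('m \<Rightarrow> real) \<Rightarrow> 'm \<Rightarrow> real) \<Rightarrow> ('m \<Rightarrow> real) \<Rightarrow> ('m \<Rightarrow> real) \<Rightarrow> 'm \<Rightarrow> real" where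
  "carre_du_champ L f h p = (L (\<lambda>q. f q * h q) p - f p * L h p - h p * L f p) / 2"

definition ricci_diffusion ::
  "('m, 'n::finite) chart set \<Rightarrow> 'm metric \<Rightarrow> ('m \<Rightarrow> 'm tangent_vector) \<Rightarrow> 'm metric" where
  "ricci_diffusion A g X p v w = ricci A g p v w - sym_nabla A g X p v w"

definition TCD ::
  "'m topology \<Rightarrow> ('m, 'n::finite) chart set \<Rightarrow> 'm metric \<Rightarrow> ('m \<Rightarrow> 'm tangent_vector) \<Rightarrow>
    real \<Rightarrow> real \<Rightarrow> bool" where
  "TCD M A g X \<rho> n \<longleftrightarrow> (let d = real CARD('n) in
     \<forall>p\<in>topspace M. \<forall>v\<in>tangent_space A p.
       if n \<noteq> 0
       then (n - d) / n * (ricci_diffusion A g X p v v - \<rho> * g p v v) \<ge> (g p (X p) v)\<^sup>2 / n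
       else - d * (ricci_diffusion A g X p v v - \<rho> * g p v v) \<le> (g p (X p) v)\<^sup>2)"

definition quasi_model ::
  "'m topology \<Rightarrow> ('m, 'n::finite) chart set \<Rightarrow> 'm metric \<Rightarrow> ('m \<Rightarrow> 'm tangent_vector) \<Rightarrow>
    real \<Rightarrow> real \<Rightarrow> bool" where
  "quasi_model M A g X \<rho> n \<longleftrightarrow> (let d = real CARD('n) in
     \<forall>p\<in>topspace M. \<forall>v\<in>tangent_space A p.
       (n - d) * (ricci_diffusion A g X p v v - \<rho> * g p v v) = (g p (X p) v)\<^sup>2)"

end

theory Submission
  imports Defs
begin

text \<open>
  Put \<open>V = \<nabla>F\<close>, \<open>z = \<Gamma>(F) = |V|\<^sup>2\<close>, and let \<open>H = \<nabla>V\<close> be the Hessian endomorphism. As \<open>L F = 0\<close>, Bochner's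
  formula reads \<open>L \<Gamma>(F) = 2 (tr H\<^sup>2 + Ric(L)(V, V))\<close>; it is the trace of the Ricci identity for
  \<open>\<nabla>\<Gamma>(F) = 2 \<nabla>\<^sub>V V\<close>. By the chain rule
  \<open>L \<Phi>(F, \<Gamma>(F)) = 2 \<Phi>\<^sub>2 (tr H\<^sup>2 + Ric(L)(V, V)) + \<Phi>\<^sub>1\<^sub>1 z + 4 \<Phi>\<^sub>1\<^sub>2 \<langle>H V, V\<rangle> + 4 \<Phi>\<^sub>2\<^sub>2 |H V|\<^sup>2\<close>.
  The curvature hypothesis gives \<open>Ric(L)(V, V) \<ge> \<rho> z + (tr H)\<^sup>2 / (n - d)\<close>, because \<open>\<langle>X, V\<rangle> = - tr H\<close>.
  In the splitting of \<open>H\<close> along \<open>V\<close> and its orthogonal complement, the Cauchy-Schwarz inequality for the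
  complementary block bounds \<open>tr H\<^sup>2\<close> from below, and what is left is the discriminant of a
  quadratic polynomial in \<open>\<langle>H V, V\<rangle> / z\<close>.
\<close>

subsection \<open>Smooth functions on open sets\<close>

text \<open>Three obstacles shape the argument. The operators are defined through a chart chosen
  separately at each point. Ricci curvature and the covariant derivative of \<open>X\<close> are
  evaluated at one point \<open>p\<close> only, in its chosen chart; but \<open>\<Gamma>(F)\<close>
  and the equation \<open>L F = 0\<close> are differentiated at \<open>p\<close>, so they are used
  at nearby points whose chosen charts may differ. Hence the Laplacian is shown to be independent of
  the chart, through the transformation law of the Hessian. Next, the domain of
  \<open>\<Phi>\<close> has the boundary z = 0, reached at every critical point of \<open>F\<close>.
  The chain rule is used for derivatives within the domain, and equality of the mixed derivatives
  only for z > 0; at z = 0 the factor \<open>\<langle>H V, V\<rangle>\<close> vanishes. Finally, in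
  dimension one the complement of \<open>V\<close> is zero. The bound for
  \<open>tr H\<^sup>2\<close> is therefore kept linearised, with a free parameter
  \<open>\<beta>\<close> and no division by d - 1: the best \<open>\<beta>\<close> gives
  Cauchy-Schwarz for d >= 2, and for d = 1 validity for all \<open>\<beta>\<close> forces tr H to be
  the entry of \<open>H\<close> along \<open>V\<close>.\<close>

lemma Ck_on_SucD: "Ck_on (Suc k) S f \<Longrightarrow> Ck_on k S f"
proof (induction k arbitrary: f)
  case 0
  then show ?case by (simp add: differentiable_imp_continuous_on)
next
  case (Suc k)
  show ?case
    unfolding Ck_on.simps(2)[of k]
    using Suc.prems Suc.IH[of "\<lambda>x. frechet_derivative f (at x within S) v" for v]
    by (subst (asm) Ck_on.simps(2)) blast
qed

lemma Ck_on_cong: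
  assumes "open S" "\<And>x. x \<in> S \<Longrightarrow> f x = g x" "Ck_on k S f"
  shows "Ck_on k S g"
  using assms(2,3)
proof (induction k arbitrary: f g)
  case 0
  then show ?case by (metis Ck_on.simps(1) continuous_on_cong)
next
  case (Suc k)
  have f: "f differentiable (at x)" if "x \<in> S" for x
    using Suc.prems(2) that assms(1) by (metis Ck_on.simps(2) at_within_open differentiable_on_def)
  have d: "frechet_derivative f (at x) = frechet_derivative g (at x)" if "x \<in> S" for x
    using frechet_derivative_transform_within_open[OF f assms(1) _ Suc.prems(1)] that by blast
  have gd: "g differentiable_on S"
    unfolding differentiable_on_def
  proof
    fix x assume x: "x \<in> S"
    then have "(f has_derivative frechet_derivative f (at x)) (at x within S)"
      using f frechet_derivative_works has_derivative_at_withinI by blast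
    then show "g differentiable (at x within S)"
      unfolding differentiable_def using has_derivative_transform[OF x] Suc.prems(1) by metis
  qed
  have "Ck_on k S (\<lambda>x. frechet_derivative g (at x within S) v)" for v
  proof (rule Suc.IH)
    show "Ck_on k S (\<lambda>x. frechet_derivative f (at x within S) v)"
      using Suc.prems(2) by simp
    show "frechet_derivative f (at x within S) v = frechet_derivative g (at x within S) v"
      if "x \<in> S" for x
      using d[OF that] by (simp only: at_within_open[OF that assms(1)])
  qed
  then show ?case using gd by simp
qed

text \<open>On an open set the derivative is unique, so the value chosen by
  \<open>frechet_derivative\<close> may be replaced by an explicit \<open>D\<close>. Each
  differentiation rule then becomes a closure property of \<open>Ck_on\<close> by induction on
  \<open>k\<close>.\<close>

lemma Ck_on_SucI:
  assumes "open S" "\<And>x. x \<in> S \<Longrightarrow> (f has_derivative D x) (at x)" "\<And>v. Ck_on k S (\<lambda>x. D x v)"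
  shows "Ck_on (Suc k) S f"
proof -
  have "frechet_derivative f (at x within S) = D x" if "x \<in> S" for x
    using assms(1,2) that by (metis at_within_open frechet_derivative_at)
  then have "Ck_on k S (\<lambda>x. frechet_derivative f (at x within S) v)" for v
    by (intro Ck_on_cong[OF assms(1) _ assms(3)[of v]]) auto
  moreover have "f differentiable_on S"
    using assms(2) has_derivative_at_withinI
    by (fastforce simp: differentiable_on_def differentiable_def)
  ultimately show ?thesis by simp
qed

lemma Ck_on_SucE:
  assumes "open S" "Ck_on (Suc k) S f"
  shows "\<And>x. x \<in> S \<Longrightarrow> (f has_derivative frechet_derivative f (at x)) (at x)"
    and "Ck_on k S (\<lambda>x. frechet_derivative f (at x) v)"
proof -
  show "(f has_derivative frechet_derivative f (at x)) (at x)" if "x \<in> S" for x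
    unfolding frechet_derivative_works[symmetric]
    using assms(2) that at_within_open[OF that assms(1)] by (simp add: differentiable_on_def) metis
  show "Ck_on k S (\<lambda>x. frechet_derivative f (at x) v)"
  proof (rule Ck_on_cong[OF assms(1)])
    show "Ck_on k S (\<lambda>x. frechet_derivative f (at x within S) v)"
      using assms(2) by simp
    show "frechet_derivative f (at x within S) v = frechet_derivative f (at x) v" if "x \<in> S" for x
      by (simp only: at_within_open[OF that assms(1)])
  qed
qed

lemma Ck_on_const: "open S \<Longrightarrow> Ck_on k S (\<lambda>x. c)"
proof (induction k arbitrary: c)
  case (Suc k)
  show ?case
    by (rule Ck_on_SucI[where D="\<lambda>_ _. 0"]) (use Suc in auto)
qed simp

lemma Ck_on_add: "open S \<Longrightarrow> Ck_on k S f \<Longrightarrow> Ck_on k S g \<Longrightarrow> Ck_on k S (\<lambda>x. f x + g x)"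
proof (induction k arbitrary: f g)
  case (Suc k)
  show ?case
    using Suc.prems(1) Ck_on_SucE[OF Suc.prems(1,2)] Ck_on_SucE[OF Suc.prems(1,3)]
    by (intro Ck_on_SucI[OF Suc.prems(1) has_derivative_add] Suc.IH)
qed (auto intro: continuous_on_add)

lemma Ck_on_mult:
  fixes f g :: "'a::euclidean_space \<Rightarrow> real"
  shows "open S \<Longrightarrow> Ck_on k S f \<Longrightarrow> Ck_on k S g \<Longrightarrow> Ck_on k S (\<lambda>x. f x * g x)"
proof (induction k arbitrary: f g)
  case (Suc k)
  show ?case
    using Suc.prems(1) Ck_on_SucE[OF Suc.prems(1,2)] Ck_on_SucE[OF Suc.prems(1,3)]
      Ck_on_SucD[OF Suc.prems(2)] Ck_on_SucD[OF Suc.prems(3)]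
    by (intro Ck_on_SucI[OF Suc.prems(1) has_derivative_mult] Ck_on_add Suc.IH)
qed (auto intro: continuous_on_mult)

lemma Ck_on_inverse:
  fixes f :: "'a::euclidean_space \<Rightarrow> real"
  shows "open S \<Longrightarrow> (\<And>x. x \<in> S \<Longrightarrow> f x \<noteq> 0) \<Longrightarrow> Ck_on k S f \<Longrightarrow> Ck_on k S (\<lambda>x. inverse (f x))"
proof (induction k)
  case (Suc k)
  \<comment> \<open>The derivative of the inverse contains the inverse again; the induction
    hypothesis supplies it one order lower.\<close>
  have inv: "Ck_on k S (\<lambda>x. inverse (f x))"
    using Suc Ck_on_SucD by blast
  have "Ck_on k S (\<lambda>x. (- 1) * (inverse (f x) * frechet_derivative f (at x) v * inverse (f x)))" for v
    using Suc.prems(1) inv Ck_on_SucE(2)[OF Suc.prems(1,3)] by (intro Ck_on_mult Ck_on_const)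
  then show ?case
    by (intro Ck_on_SucI[OF Suc.prems(1) Deriv.has_derivative_inverse])
      (use Ck_on_SucE[OF Suc.prems(1,3)] Suc.prems in auto)
qed (auto intro: continuous_on_inverse)

lemma Ck_on_bounded_linear:
  assumes "bounded_linear L"
  shows "open S \<Longrightarrow> Ck_on k S f \<Longrightarrow> Ck_on k S (\<lambda>x. L (f x))"
proof (induction k arbitrary: f)
  case 0
  then show ?case
    using bounded_linear.continuous_on[OF assms] by simp
next
  case (Suc k)
  show ?case
    using Suc.prems(1) Ck_on_SucE[OF Suc.prems(1,2)]
    by (intro Ck_on_SucI[OF Suc.prems(1) bounded_linear.has_derivative[OF assms]] Suc.IH)
qed

lemma smooth_on_cong:
  "open S \<Longrightarrow> (\<And>x. x \<in> S \<Longrightarrow> f x = g x) \<Longrightarrow> smooth_on S f \<Longrightarrow> smooth_on S g"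
  unfolding smooth_on_def using Ck_on_cong by blast

lemma smooth_on_const: "open S \<Longrightarrow> smooth_on S (\<lambda>x. c)"
  by (simp add: smooth_on_def Ck_on_const)

lemma smooth_on_add: "open S \<Longrightarrow> smooth_on S f \<Longrightarrow> smooth_on S g \<Longrightarrow> smooth_on S (\<lambda>x. f x + g x)"
  by (simp add: smooth_on_def Ck_on_add)

lemma smooth_on_mult:
  fixes f g :: "'a::euclidean_space \<Rightarrow> real"
  shows "open S \<Longrightarrow> smooth_on S f \<Longrightarrow> smooth_on S g \<Longrightarrow> smooth_on S (\<lambda>x. f x * g x)"
  by (simp add: smooth_on_def Ck_on_mult)

lemma smooth_on_diff:
  fixes f g :: "'a::euclidean_space \<Rightarrow> real"
  assumes "open S" "smooth_on S f" "smooth_on S g"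
  shows "smooth_on S (\<lambda>x. f x - g x)"
  using smooth_on_add[OF assms(1,2) smooth_on_mult[OF assms(1) smooth_on_const[OF assms(1), of "- 1"] assms(3)]]
  by simp

lemma smooth_on_inverse:
  fixes f :: "'a::euclidean_space \<Rightarrow> real"
  shows "open S \<Longrightarrow> smooth_on S f \<Longrightarrow> (\<And>x. x \<in> S \<Longrightarrow> f x \<noteq> 0) \<Longrightarrow> smooth_on S (\<lambda>x. inverse (f x))"
  by (simp add: smooth_on_def Ck_on_inverse)

lemma smooth_on_divide:
  fixes f g :: "'a::euclidean_space \<Rightarrow> real"
  assumes "open S" "smooth_on S f" "smooth_on S g" "\<And>x. x \<in> S \<Longrightarrow> g x \<noteq> 0"
  shows "smooth_on S (\<lambda>x. f x / g x)"
  using smooth_on_mult[OF assms(1,2) smooth_on_inverse[OF assms(1,3,4)]] by (simp add: divide_inverse)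

lemma smooth_on_sum:
  assumes "open S" "\<And>i. i \<in> K \<Longrightarrow> smooth_on S (f i)"
  shows "smooth_on S (\<lambda>x. \<Sum>i\<in>K. f i x)"
  using assms(2) by (induction K rule: infinite_finite_induct)
    (auto intro: smooth_on_const smooth_on_add assms(1))

lemma smooth_on_prod:
  fixes f :: "'i \<Rightarrow> 'a::euclidean_space \<Rightarrow> real"
  assumes "open S" "\<And>i. i \<in> K \<Longrightarrow> smooth_on S (f i)"
  shows "smooth_on S (\<lambda>x. \<Prod>i\<in>K. f i x)"
  using assms(2) by (induction K rule: infinite_finite_induct)
    (auto intro: smooth_on_const smooth_on_mult assms(1))

section \<open>Smoothness of the inverse of a matrix function\<close>

lemma smooth_on_det:
  assumes "open S" "\<And>i j. smooth_on S (\<lambda>x. A x $ i $ j)"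
  shows "smooth_on S (\<lambda>x. det (A x :: real^'n^'n))"
  unfolding det_def using assms
  by (intro smooth_on_sum smooth_on_mult smooth_on_const smooth_on_prod) auto

lemma matrix_inv_right_left:
  fixes A :: "real^'n^'n"
  assumes "invertible A"
  shows "A ** matrix_inv A = mat 1" "matrix_inv A ** A = mat 1"
  using someI_ex[OF assms[unfolded invertible_def]] unfolding matrix_inv_def by auto

text \<open>Column \<open>l\<close> of the inverse solves \<open>A *v y = axis l 1\<close>, and
  Cramer's rule writes its entries as quotients of determinants. \<open>matrix_inv\<close> is
  defined by a choice; this rational form is what makes the inverse metric smooth.\<close>

lemma matrix_inv_cramer:
  fixes A :: "real^'n^'n"
  assumes "invertible A"
  shows "matrix_inv A $ k $ l = det (\<chi> i j. if j = k then (axis l 1 :: real^'n) $ i else A $ i $ j) / det A"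
proof -
  have "A *v column l (matrix_inv A) = axis l 1"
    unfolding matrix_vector_mult_basis[symmetric]
    by (simp add: matrix_vector_mul_assoc matrix_inv_right_left[OF assms])
  moreover have "det A \<noteq> 0" using assms invertible_det_nz by blast
  ultimately have "column l (matrix_inv A) =
      (\<chi> k. det (\<chi> i j. if j = k then (axis l 1 :: real^'n) $ i else A $ i $ j) / det A)"
    using cramer by blast
  then have "column l (matrix_inv A) $ k =
      det (\<chi> i j. if j = k then (axis l 1 :: real^'n) $ i else A $ i $ j) / det A"
    by simp
  then show ?thesis by (simp add: column_def)
qed

lemma smooth_on_matrix_inv:
  assumes "open S" "\<And>i j. smooth_on S (\<lambda>x. A x $ i $ j)" "\<And>x. x \<in> S \<Longrightarrow> invertible (A x :: real^'n^'n)"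
  shows "smooth_on S (\<lambda>x. matrix_inv (A x) $ k $ l)"
proof (rule smooth_on_cong[OF assms(1)])
  show "det (\<chi> i j. if j = k then (axis l 1 :: real^'n) $ i else A x $ i $ j) / det (A x)
      = matrix_inv (A x) $ k $ l" if "x \<in> S" for x
    using matrix_inv_cramer[OF assms(3)[OF that]] by simp
  have e: "smooth_on S (\<lambda>x. (\<chi> i j. if j = k then (axis l 1 :: real^'n) $ i else A x $ i $ j) $ i $ j)"
    for i j using assms(1,2) smooth_on_const[OF assms(1)] by (cases "j = k") auto
  show "smooth_on S (\<lambda>x. det (\<chi> i j. if j = k then (axis l 1 :: real^'n) $ i else A x $ i $ j) / det (A x))"
    using assms invertible_det_nz
    by (intro smooth_on_divide smooth_on_det e assms) blast
qed

lemma smooth_on_component: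
  "open S \<Longrightarrow> smooth_on S f \<Longrightarrow> smooth_on S (\<lambda>x. f x $ i :: real)"
  unfolding smooth_on_def using Ck_on_bounded_linear[OF bounded_linear_vec_nth] by blast

lemma smooth_on_has_derivative:
  "open S \<Longrightarrow> smooth_on S f \<Longrightarrow> x \<in> S \<Longrightarrow> (f has_derivative frechet_derivative f (at x)) (at x)"
  using Ck_on_SucE(1) unfolding smooth_on_def by blast

lemma smooth_on_differentiable:
  "open S \<Longrightarrow> smooth_on S f \<Longrightarrow> x \<in> S \<Longrightarrow> f differentiable (at x)"
  using smooth_on_has_derivative differentiable_def by blast

lemma smooth_on_frechet_derivative:
  "open S \<Longrightarrow> smooth_on S f \<Longrightarrow> smooth_on S (\<lambda>x. frechet_derivative f (at x) v)"
  using Ck_on_SucE(2) by (metis smooth_on_def)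

text \<open>\<open>S\<close> may contain boundary points. At points of the open set \<open>T\<close>
  the derivative within \<open>S\<close> is the ordinary one, which allows the passage from
  \<open>I \<times> {0..}\<close> to its interior.\<close>

lemma smooth_on_subset:
  assumes "open T" "T \<subseteq> S" "smooth_on S f"
  shows "smooth_on T f"
proof -
  have "Ck_on k S f \<Longrightarrow> Ck_on k T f" for k
  proof (induction k arbitrary: f)
    case 0
    then show ?case using assms(2) continuous_on_subset by auto
  next
    case (Suc k)
    have at: "at x within S = at x" if "x \<in> T" for x
      using that assms(1,2) by (rule at_within_open_subset)
    have d: "(f has_derivative frechet_derivative f (at x within S)) (at x)" if "x \<in> T" for x
    proof -
      have "f differentiable (at x within S)"
        using Suc.prems that assms(2) by (auto simp: differentiable_on_def)
      then have "(f has_derivative frechet_derivative f (at x within S)) (at x within S)"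
        by (simp only: frechet_derivative_works)
      then show ?thesis by (simp only: at[OF that])
    qed
    have "Ck_on k T (\<lambda>x. frechet_derivative f (at x within S) v)" for v
      using Suc by simp
    then show ?case by (intro Ck_on_SucI[OF assms(1) d])
  qed
  then show ?thesis using assms(3) by (simp add: smooth_on_def)
qed

text \<open>Both mixed derivatives are limits of the same second difference quotient.\<close>

lemma second_difference:
  fixes f :: "'a::euclidean_space \<Rightarrow> real"
  assumes "open S" "x \<in> S" "smooth_on S f" "e > 0"
  shows "\<exists>r>0. \<forall>t. 0 < t \<and> t < r \<longrightarrow>
    \<bar>(f (x + t *\<^sub>R u + t *\<^sub>R v) - f (x + t *\<^sub>R u) - f (x + t *\<^sub>R v) + f x) / t\<^sup>2
      - frechet_derivative (\<lambda>y. frechet_derivative f (at y) u) (at x) v\<bar> < e"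
proof -
  define D where "D = (\<lambda>y. frechet_derivative f (at y) u)"
  define E where "E = (\<lambda>y. frechet_derivative D (at y) v)"
  have D: "smooth_on S D" and E: "smooth_on S E"
    unfolding D_def E_def using assms(1,3) smooth_on_frechet_derivative by blast+
  have "continuous_on S E"
    using E unfolding smooth_on_def by (metis Ck_on.simps(1))
  then obtain r1 where r1: "r1 > 0" "\<And>y. y \<in> S \<Longrightarrow> dist y x < r1 \<Longrightarrow> \<bar>E y - E x\<bar> < e"
    using assms(2,4) unfolding continuous_on_iff dist_real_def by blast
  obtain r2 where r2: "r2 > 0" "ball x r2 \<subseteq> S"
    using assms(1,2) open_contains_ball by blast
  define N where "N = norm u + norm v + 1"
  have N: "N > 0" unfolding N_def by (simp add: add_nonneg_pos)
  define r where "r = min r1 r2 / N"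
  have r: "r > 0" using r1 r2 N by (simp add: r_def)
  have near: "dist (x + a *\<^sub>R u + b *\<^sub>R v) x < min r1 r2"
    if "0 \<le> a" "a \<le> t" "0 \<le> b" "b \<le> t" "0 < t" "t < r" for a b t
  proof -
    have "dist (x + a *\<^sub>R u + b *\<^sub>R v) x = norm (a *\<^sub>R u + b *\<^sub>R v)"
      by (simp add: dist_norm add.assoc)
    also have "\<dots> \<le> a * norm u + b * norm v"
      using norm_triangle_ineq[of "a *\<^sub>R u" "b *\<^sub>R v"] that by simp
    also have "\<dots> \<le> t * norm u + t * norm v"
      using that by (intro add_mono mult_right_mono) auto
    also have "\<dots> < t * N"
      unfolding N_def using that by (simp add: algebra_simps)
    also have "\<dots> \<le> min r1 r2"
      using that N by (simp add: r_def pos_less_divide_eq)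
    finally show ?thesis .
  qed
  have inS: "x + a *\<^sub>R u + b *\<^sub>R v \<in> S"
    if "0 \<le> a" "a \<le> t" "0 \<le> b" "b \<le> t" "0 < t" "t < r" for a b t
    using near[OF that] r2 by (auto simp: dist_commute)
  have fd: "(f has_derivative frechet_derivative f (at y)) (at y)" if "y \<in> S" for y
    using smooth_on_has_derivative assms that by blast
  have Dd: "(D has_derivative frechet_derivative D (at y)) (at y)" if "y \<in> S" for y
    using smooth_on_has_derivative assms D that by blast
  show ?thesis
  proof (intro exI conjI allI impI)
    show "r > 0" by fact
    fix t assume t: "0 < t \<and> t < r"
    have d1: "((\<lambda>s. f (x + s *\<^sub>R u + b *\<^sub>R v)) has_real_derivative D (x + s *\<^sub>R u + b *\<^sub>R v)) (at s)"
      if "0 \<le> s" "s \<le> t" "0 \<le> b" "b \<le> t" for s b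
    proof -
      have y: "x + s *\<^sub>R u + b *\<^sub>R v \<in> S" using inS[OF that] t by blast
      have "((\<lambda>s. f (x + s *\<^sub>R u + b *\<^sub>R v)) has_derivative
         (\<lambda>h. frechet_derivative f (at (x + s *\<^sub>R u + b *\<^sub>R v)) (h *\<^sub>R u))) (at s)"
        by (rule has_derivative_compose[where f="\<lambda>s. x + s *\<^sub>R u + b *\<^sub>R v" and g=f])
          (auto intro!: derivative_eq_intros fd[OF y])
      moreover have "frechet_derivative f (at (x + s *\<^sub>R u + b *\<^sub>R v)) (h *\<^sub>R u)
          = D (x + s *\<^sub>R u + b *\<^sub>R v) * h" for h
        unfolding D_def using linear_cmul[OF has_derivative_linear[OF fd[OF y]]] by simp
      ultimately show ?thesis
        by (simp add: has_field_derivative_def)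
    qed
    have d2: "((\<lambda>b. D (x + s *\<^sub>R u + b *\<^sub>R v)) has_real_derivative E (x + s *\<^sub>R u + b *\<^sub>R v)) (at b)"
      if "0 \<le> s" "s \<le> t" "0 \<le> b" "b \<le> t" for s b
    proof -
      have y: "x + s *\<^sub>R u + b *\<^sub>R v \<in> S" using inS[OF that] t by blast
      have "((\<lambda>b. D (x + s *\<^sub>R u + b *\<^sub>R v)) has_derivative
         (\<lambda>h. frechet_derivative D (at (x + s *\<^sub>R u + b *\<^sub>R v)) (h *\<^sub>R v))) (at b)"
        by (rule has_derivative_compose[where f="\<lambda>b. x + s *\<^sub>R u + b *\<^sub>R v" and g=D])
          (auto intro!: derivative_eq_intros Dd[OF y])
      moreover have "frechet_derivative D (at (x + s *\<^sub>R u + b *\<^sub>R v)) (h *\<^sub>R v)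
          = E (x + s *\<^sub>R u + b *\<^sub>R v) * h" for h
        unfolding E_def using linear_cmul[OF has_derivative_linear[OF Dd[OF y]]] by simp
      ultimately show ?thesis
        by (simp add: has_field_derivative_def)
    qed
    \<comment> \<open>The mean value theorem in direction \<open>u\<close>, applied to a difference
      in direction \<open>v\<close>, and then in direction \<open>v\<close>, applied to
      \<open>D\<close>, makes the quotient equal to \<open>E\<close> at a single point of the
      parallelogram.\<close>
    have "\<exists>a. 0 < a \<and> a < t \<and>
        (f (x + t *\<^sub>R u + t *\<^sub>R v) - f (x + t *\<^sub>R u + 0 *\<^sub>R v))
        - (f (x + 0 *\<^sub>R u + t *\<^sub>R v) - f (x + 0 *\<^sub>R u + 0 *\<^sub>R v))
        = (t - 0) * (D (x + a *\<^sub>R u + t *\<^sub>R v) - D (x + a *\<^sub>R u + 0 *\<^sub>R v))"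
      by (rule MVT2[where f="\<lambda>s. f (x + s *\<^sub>R u + t *\<^sub>R v) - f (x + s *\<^sub>R u + 0 *\<^sub>R v)"])
        (use t in \<open>auto simp del: scaleR_zero_left intro!: DERIV_diff d1\<close>)
    then obtain a where a: "0 < a" "a < t" and
      1: "f (x + t *\<^sub>R u + t *\<^sub>R v) - f (x + t *\<^sub>R u) - f (x + t *\<^sub>R v) + f x
        = t * (D (x + a *\<^sub>R u + t *\<^sub>R v) - D (x + a *\<^sub>R u + 0 *\<^sub>R v))"
      by auto
    have "\<exists>b. 0 < b \<and> b < t \<and> D (x + a *\<^sub>R u + t *\<^sub>R v) - D (x + a *\<^sub>R u + 0 *\<^sub>R v)
        = (t - 0) * E (x + a *\<^sub>R u + b *\<^sub>R v)"
      by (rule MVT2[where f="\<lambda>b. D (x + a *\<^sub>R u + b *\<^sub>R v)"]) (use t a in \<open>auto intro!: d2\<close>)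
    then obtain b where b: "0 < b" "b < t" and
      2: "D (x + a *\<^sub>R u + t *\<^sub>R v) - D (x + a *\<^sub>R u + 0 *\<^sub>R v) = t * E (x + a *\<^sub>R u + b *\<^sub>R v)"
      by auto
    have "(f (x + t *\<^sub>R u + t *\<^sub>R v) - f (x + t *\<^sub>R u) - f (x + t *\<^sub>R v) + f x) / t\<^sup>2
        = E (x + a *\<^sub>R u + b *\<^sub>R v)"
      unfolding 1 2 using t by (simp add: power2_eq_square)
    moreover have "\<bar>E (x + a *\<^sub>R u + b *\<^sub>R v) - E x\<bar> < e"
      using r1(2) inS[of a t b] near[of a t b] a b t by simp
    ultimately show "\<bar>(f (x + t *\<^sub>R u + t *\<^sub>R v) - f (x + t *\<^sub>R u) - f (x + t *\<^sub>R v) + f x) / t\<^sup>2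
      - frechet_derivative (\<lambda>y. frechet_derivative f (at y) u) (at x) v\<bar> < e"
      by (simp add: E_def D_def)
  qed
qed

lemma frechet_derivative_commute:
  fixes f :: "'a::euclidean_space \<Rightarrow> real"
  assumes "open S" "x \<in> S" "smooth_on S f"
  shows "frechet_derivative (\<lambda>y. frechet_derivative f (at y) u) (at x) v
    = frechet_derivative (\<lambda>y. frechet_derivative f (at y) v) (at x) u" (is "?a = ?b")
proof (rule ccontr)
  assume "?a \<noteq> ?b"
  then have e: "\<bar>?a - ?b\<bar> / 2 > 0" by simp
  obtain r where r: "r > 0" "\<forall>t. 0 < t \<and> t < r \<longrightarrow>
    \<bar>(f (x + t *\<^sub>R u + t *\<^sub>R v) - f (x + t *\<^sub>R u) - f (x + t *\<^sub>R v) + f x) / t\<^sup>2 - ?a\<bar> < \<bar>?a - ?b\<bar> / 2"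
    using second_difference[OF assms e, of u v] by blast
  obtain q where q: "q > 0" "\<forall>t. 0 < t \<and> t < q \<longrightarrow>
    \<bar>(f (x + t *\<^sub>R v + t *\<^sub>R u) - f (x + t *\<^sub>R v) - f (x + t *\<^sub>R u) + f x) / t\<^sup>2 - ?b\<bar> < \<bar>?a - ?b\<bar> / 2"
    using second_difference[OF assms e, of v u] by blast
  define t where "t = min r q / 2"
  have t: "0 < t" "t < r" "t < q" using r q by (auto simp: t_def)
  have eq: "f (x + t *\<^sub>R v + t *\<^sub>R u) - f (x + t *\<^sub>R v) - f (x + t *\<^sub>R u) + f x
      = f (x + t *\<^sub>R u + t *\<^sub>R v) - f (x + t *\<^sub>R u) - f (x + t *\<^sub>R v) + f x"
    by (simp add: add.commute add.left_commute)
  have "\<bar>D - a\<bar> < \<bar>a - b\<bar> / 2 \<Longrightarrow> \<bar>D - b\<bar> < \<bar>a - b\<bar> / 2 \<Longrightarrow> False" for D a b :: real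
    by (smt (verit) field_sum_of_halves)
  then show False
    using r(2)[rule_format, of t] q(2)[rule_format, of t, unfolded eq] t by blast
qed

section \<open>Partial derivatives in coordinates\<close>

lemma smooth_on_pderivative: "open S \<Longrightarrow> smooth_on S f \<Longrightarrow> smooth_on S (pderivative i f)"
  unfolding pderivative_def by (rule smooth_on_frechet_derivative)

lemma pderivative_commute:
  assumes "open S" "x \<in> S" "smooth_on S f"
  shows "pderivative i (pderivative j f) x = pderivative j (pderivative i f) x"
  using frechet_derivative_commute[OF assms] unfolding pderivative_def .

text \<open>Both functions have the same derivatives at \<open>x\<close>, so the choice in
  \<open>frechet_derivative\<close> falls on the same map. This also covers functions whose
  differentiability is not yet known, such as \<open>pderivative j N\<close> in
  \<open>lap_compose\<close>.\<close>

lemma frechet_derivative_local: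
  assumes "open S" "x \<in> S" "\<And>y. y \<in> S \<Longrightarrow> f y = g y"
  shows "frechet_derivative f (at x) = frechet_derivative g (at x)"
proof -
  have "(f has_derivative D) (at x) \<longleftrightarrow> (g has_derivative D) (at x)" for D
    using has_derivative_transform_within_open[of f D x UNIV S g]
      has_derivative_transform_within_open[of g D x UNIV S f] assms by auto
  then show ?thesis unfolding frechet_derivative_def by simp
qed

lemma pderivative_cong:
  assumes "open S" "x \<in> S" "\<And>y. y \<in> S \<Longrightarrow> f y = g y"
  shows "pderivative i f x = pderivative i g x"
  unfolding pderivative_def using frechet_derivative_local[OF assms] by simp

lemma pderivative_eqI:
  "(f has_derivative D) (at x) \<Longrightarrow> pderivative i f x = D (axis i 1)"
  unfolding pderivative_def using frechet_derivative_at by fastforce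

lemma differentiable_has_derivative:
  "f differentiable (at x) \<Longrightarrow> (f has_derivative frechet_derivative f (at x)) (at x)"
  by (simp add: frechet_derivative_works)

lemma pderivative_const: "pderivative i (\<lambda>x. c) x = 0"
  unfolding pderivative_def by simp

lemma pderivative_add:
  assumes "f differentiable (at x)" "g differentiable (at x)"
  shows "pderivative i (\<lambda>x. f x + g x) x = pderivative i f x + pderivative i g x"
  using pderivative_eqI[OF has_derivative_add[OF assms[THEN differentiable_has_derivative]]]
  by (simp add: pderivative_def)

lemma pderivative_mult:
  assumes "f differentiable (at x)" "g differentiable (at x)"
  shows "pderivative i (\<lambda>x. f x * g x) x = f x * pderivative i g x + pderivative i f x * g x"
  using pderivative_eqI[OF has_derivative_mult[OF assms[THEN differentiable_has_derivative]]]
  by (simp add: pderivative_def)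

lemma pderivative_minus:
  assumes "f differentiable (at x)"
  shows "pderivative i (\<lambda>x. - f x) x = - pderivative i f x"
  using pderivative_eqI[OF has_derivative_minus[OF assms[THEN differentiable_has_derivative]]]
  by (simp add: pderivative_def)

lemma pderivative_sum:
  assumes "\<And>k. k \<in> K \<Longrightarrow> f k differentiable (at x)"
  shows "pderivative i (\<lambda>x. \<Sum>k\<in>K. f k x) x = (\<Sum>k\<in>K. pderivative i (f k) x)"
  using pderivative_eqI[OF has_derivative_sum[OF assms[THEN differentiable_has_derivative]]]
  by (simp add: pderivative_def)

lemma linear_sum_axis:
  fixes L :: "real^'n \<Rightarrow> real"
  assumes "linear L"
  shows "L w = (\<Sum>i\<in>UNIV. w $ i * L (axis i 1))"
proof -
  have "L w = L (\<Sum>i\<in>UNIV. w $ i *\<^sub>R axis i 1)"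
    using basis_expansion[of w] by (simp add: scalar_mult_eq_scaleR)
  also have "\<dots> = (\<Sum>i\<in>UNIV. w $ i * L (axis i 1))"
    by (simp add: linear_sum[OF assms] linear_cmul[OF assms])
  finally show ?thesis .
qed

lemma frechet_derivative_pderivative:
  assumes "f differentiable (at x)"
  shows "frechet_derivative f (at x) w = (\<Sum>i\<in>UNIV. w $ i * pderivative i f x)"
  unfolding pderivative_def by (rule linear_sum_axis[OF linear_frechet_derivative[OF assms]])

subsection \<open>Symmetric matrices relative to an inner product\<close>

text \<open>Gram-Schmidt for the inner product \<open>u \<bullet> (G *v v)\<close>, one vector at a
  time: a family with fewer than \<open>CARD('n)\<close> elements does not span, and a vector
  outside its span, minus its \<open>G\<close>-projection, can be normalised.\<close>

lemma posdef_orthonormal_family: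
  fixes G :: "real^'n^'n"
  assumes sym: "transpose G = G" and pos: "\<And>v. v \<noteq> 0 \<Longrightarrow> v \<bullet> (G *v v) > 0"
  shows "k \<le> CARD('n) \<Longrightarrow> \<exists>E. finite E \<and> card E = k \<and>
    (\<forall>u\<in>E. \<forall>v\<in>E. u \<bullet> (G *v v) = (if u = v then 1 else 0))"
proof (induction k)
  case 0
  then show ?case by (intro exI[of _ "{}"]) auto
next
  case (Suc k)
  then obtain E where E: "finite E" "card E = k"
    "\<And>u v. u \<in> E \<Longrightarrow> v \<in> E \<Longrightarrow> u \<bullet> (G *v v) = (if u = v then 1 else 0)"
    by auto
  have Gsym: "u \<bullet> (G *v v) = v \<bullet> (G *v u)" for u v
    by (metis dot_lmul_matrix inner_commute sym transpose_matrix_vector)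
  have "span E \<noteq> UNIV"
  proof
    assume "span E = UNIV"
    then have "dim (UNIV :: (real^'n) set) \<le> card E"
      by (metis E(1) dim_le_card span_UNIV subset_UNIV)
    then show False using Suc.prems E(2) by (simp add: dim_UNIV)
  qed
  then obtain v where v: "v \<notin> span E" by blast
  define v' where "v' = v - (\<Sum>e\<in>E. (e \<bullet> (G *v v)) *\<^sub>R e)"
  have "v' \<noteq> 0"
  proof
    assume "v' = 0"
    then have "v = (\<Sum>e\<in>E. (e \<bullet> (G *v v)) *\<^sub>R e)" by (simp add: v'_def)
    also have "\<dots> \<in> span E" by (intro span_sum span_scale span_base)
    finally show False using v by blast
  qed
  then have p: "v' \<bullet> (G *v v') > 0" by (rule pos)
  have lin: "linear ((*v) G)" by simp
  have orth: "e \<bullet> (G *v v') = 0" if e: "e \<in> E" for e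
  proof -
    have "e \<bullet> (G *v v') = e \<bullet> (G *v v) - (\<Sum>a\<in>E. (a \<bullet> (G *v v)) * (e \<bullet> (G *v a)))"
      unfolding v'_def by (simp add: linear_diff[OF lin] linear_sum[OF lin] linear_cmul[OF lin]
          inner_diff_right inner_sum_right)
    also have "(\<Sum>a\<in>E. (a \<bullet> (G *v v)) * (e \<bullet> (G *v a))) = (\<Sum>a\<in>E. if a = e then e \<bullet> (G *v v) else 0)"
      by (intro sum.cong) (use E(3) e in auto)
    also have "\<dots> = e \<bullet> (G *v v)" using e E(1) by simp
    finally show ?thesis by simp
  qed
  define u where "u = (1 / sqrt (v' \<bullet> (G *v v'))) *\<^sub>R v'"
  have uu: "u \<bullet> (G *v u) = 1"
    unfolding u_def using p by (simp add: linear_cmul[OF lin])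
  have ue: "e \<bullet> (G *v u) = 0" "u \<bullet> (G *v e) = 0" if "e \<in> E" for e
    using orth[OF that] Gsym unfolding u_def by (simp_all add: linear_cmul[OF lin])
  have "u \<notin> E" using uu ue by force
  then show ?case
    using E uu ue by (intro exI[of _ "insert u E"]) auto
qed

lemma posdef_invertible:
  fixes G :: "real^'n^'n"
  assumes "\<And>v. v \<noteq> 0 \<Longrightarrow> v \<bullet> (G *v v) > 0"
  shows "invertible G"
proof -
  have "v = 0" if "G *v v = 0" for v
    using assms[of v] that by fastforce
  then show ?thesis
    by (simp add: invertible_left_inverse matrix_left_invertible_ker)
qed

lemma matrix_inv_unique:
  fixes G :: "real^'n^'n"
  assumes "B ** G = mat 1"
  shows "matrix_inv G = B"
proof -
  have "invertible G" using assms invertible_left_inverse by blast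
  then have "matrix_inv G = (B ** G) ** matrix_inv G" by (simp add: assms)
  also have "\<dots> = B" by (simp add: matrix_mul_assoc[symmetric] matrix_inv_right_left \<open>invertible G\<close>)
  finally show ?thesis .
qed

text \<open>The columns of \<open>R\<close> form an orthonormal basis for \<open>G\<close>, so
  \<open>transpose R ** G ** R = mat 1\<close>; a one-sided inverse is two-sided, which gives
  \<open>R ** transpose R ** G = mat 1\<close>. \<open>R\<close> plays the part of a square root of
  the inverse metric and turns computations relative to \<open>G\<close> into Euclidean
  ones.\<close>

lemma posdef_inverse_factor:
  fixes G :: "real^'n^'n"
  assumes sym: "transpose G = G" and pos: "\<And>v. v \<noteq> 0 \<Longrightarrow> v \<bullet> (G *v v) > 0"
  obtains R :: "real^'n^'n" where "matrix_inv G = R ** transpose R"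
proof -
  obtain E where E: "finite E" "card E = CARD('n)"
    "\<And>u v. u \<in> E \<Longrightarrow> v \<in> E \<Longrightarrow> u \<bullet> (G *v v) = (if u = v then 1 else 0)"
    using posdef_orthonormal_family[OF assms order_refl] by auto
  obtain b where b: "bij_betw b (UNIV :: 'n set) E"
    using finite_same_card_bij[of "UNIV :: 'n set" E] E by auto
  define R :: "real^'n^'n" where "R = (\<chi> i j. b j $ i)"
  have "(transpose R ** (G ** R)) $ i $ j = b i \<bullet> (G *v b j)" for i j
    by (simp add: matrix_matrix_mult_def R_def transpose_def matrix_vector_mult_def inner_vec_def)
  moreover have "b i \<bullet> (G *v b j) = (if i = j then 1 else 0)" for i j
    using E(3) b by (metis UNIV_I bij_betw_imp_surj_on bij_betw_inv_into_left imageI)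
  ultimately have "transpose R ** (G ** R) = mat 1"
    by (simp add: vec_eq_iff mat_def)
  then have "(R ** transpose R) ** G = mat 1"
    by (metis matrix_left_right_inverse matrix_mul_assoc)
  then show ?thesis by (rule that[OF matrix_inv_unique])
qed

lemma matrix_inv_sym:
  fixes G :: "real^'n^'n"
  assumes "invertible G" "transpose G = G"
  shows "transpose (matrix_inv G) = matrix_inv G"
proof -
  have "transpose (matrix_inv G) ** G = mat 1"
    by (metis assms matrix_inv_right_left(1) matrix_transpose_mul transpose_mat)
  then show ?thesis using matrix_inv_unique by metis
qed

text \<open>
  The right-hand side is the squared Frobenius norm of
  \<open>M - (a f\<^sup>T + f a\<^sup>T) / z + (t + \<beta>) f f\<^sup>T / z - \<beta> 1\<close> with \<open>a = M f\<close>, \<open>z = |f|\<^sup>2\<close> and \<open>t = (f \<bullet> a) / z\<close>,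
  that is, of \<open>M - \<beta> 1\<close> compressed to the orthogonal complement of \<open>f\<close>.
\<close>

lemma frobenius_compression:
  fixes M :: "real^'n^'n" and f :: "real^'n" and \<beta> :: real
  assumes sym: "\<And>i j. M $ i $ j = M $ j $ i" and f: "f \<bullet> f > 0"
  defines "a \<equiv> M *v f"
  shows "0 \<le> (\<Sum>i\<in>UNIV. \<Sum>j\<in>UNIV. (M $ i $ j)\<^sup>2) - 2 * (a \<bullet> a) / (f \<bullet> f) + ((f \<bullet> a) / (f \<bullet> f))\<^sup>2
    + \<beta>\<^sup>2 * (real CARD('n) - 1) - 2 * \<beta> * (trace M - (f \<bullet> a) / (f \<bullet> f))"
proof -
  define z P Q m where "z = f \<bullet> f" and "P = f \<bullet> a" and "Q = a \<bullet> a"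
    and "m = (\<Sum>i\<in>UNIV. \<Sum>j\<in>UNIV. (M $ i $ j)\<^sup>2)"
  \<comment> \<open>With \<open>\<pi>\<close> the orthogonal projection onto the line of
    \<open>f\<close>, \<open>\<mu> * c\<close> is the coefficient of \<open>f f\<^sup>T\<close> in
    \<open>(1 - \<pi>) (M - \<beta> 1) (1 - \<pi>)\<close>: \<open>P / z\<close> comes from
    \<open>\<pi> M \<pi>\<close>, and \<open>\<beta>\<close> from
    \<open>\<beta> \<pi>\<close>.\<close>
  define c \<mu> where "c = 1 / z" and "\<mu> = P / z + \<beta>"
  have z: "z > 0" using f z_def by simp
  let ?\<delta> = "\<lambda>i j :: 'n. if i = j then 1 else (0::real)"
  have aj: "a $ i = (\<Sum>j\<in>UNIV. M $ i $ j * f $ j)" for i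
    unfolding a_def by (simp add: matrix_vector_mult_def)
  have zs: "z = (\<Sum>i\<in>UNIV. f $ i * f $ i)" and Ps: "P = (\<Sum>i\<in>UNIV. a $ i * f $ i)"
    and Qs: "Q = (\<Sum>i\<in>UNIV. a $ i * a $ i)"
    unfolding z_def P_def Q_def by (simp_all add: inner_vec_def mult.commute)
  have pr: "(\<Sum>i\<in>UNIV. \<Sum>j\<in>UNIV. p i * q j) = (\<Sum>i\<in>UNIV. p i) * (\<Sum>j\<in>UNIV. q j)"
    for p q :: "'n \<Rightarrow> real" by (simp add: sum_product)
  have s1: "(\<Sum>i\<in>UNIV. \<Sum>j\<in>UNIV. (a $ i * a $ i) * (f $ j * f $ j)) = Q * z"
    and s2: "(\<Sum>i\<in>UNIV. \<Sum>j\<in>UNIV. (f $ i * f $ i) * (a $ j * a $ j)) = z * Q"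
    and s3: "(\<Sum>i\<in>UNIV. \<Sum>j\<in>UNIV. (f $ i * f $ i) * (f $ j * f $ j)) = z * z"
    and s4: "(\<Sum>i\<in>UNIV. \<Sum>j\<in>UNIV. (a $ i * f $ i) * (a $ j * f $ j)) = P * P"
    and s5: "(\<Sum>i\<in>UNIV. \<Sum>j\<in>UNIV. (a $ i * f $ i) * (f $ j * f $ j)) = P * z"
    and s6: "(\<Sum>i\<in>UNIV. \<Sum>j\<in>UNIV. (f $ i * f $ i) * (a $ j * f $ j)) = z * P"
    unfolding pr zs Ps Qs by simp_all
  have t1: "(\<Sum>i\<in>UNIV. \<Sum>j\<in>UNIV. a $ i * (M $ i $ j * f $ j)) = Q"
    unfolding Qs by (simp add: aj sum_distrib_left)
  have t2: "(\<Sum>i\<in>UNIV. \<Sum>j\<in>UNIV. a $ j * (M $ j $ i * f $ i)) = Q"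
    unfolding t1[symmetric] by (rule sum.swap)
  have t3: "(\<Sum>i\<in>UNIV. \<Sum>j\<in>UNIV. f $ i * (M $ i $ j * f $ j)) = P"
    unfolding Ps by (simp add: aj sum_distrib_left mult.commute)
  have d: "(\<Sum>i\<in>UNIV. \<Sum>j\<in>UNIV. p i j * ?\<delta> i j) = (\<Sum>i\<in>UNIV. p i i)" for p :: "'n \<Rightarrow> 'n \<Rightarrow> real"
  proof (rule sum.cong[OF refl])
    fix i
    have "(\<Sum>j\<in>UNIV. p i j * ?\<delta> i j) = (\<Sum>j\<in>UNIV. if i = j then p i j else 0)"
      by (intro sum.cong) auto
    then show "(\<Sum>j\<in>UNIV. p i j * ?\<delta> i j) = p i i" by simp
  qed
  have pull: "(\<Sum>i\<in>UNIV. \<Sum>j\<in>UNIV. k * p i j) = k * (\<Sum>i\<in>UNIV. \<Sum>j\<in>UNIV. p i j)"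
    for k and p :: "'n \<Rightarrow> 'n \<Rightarrow> real" by (simp add: sum_distrib_left)
  \<comment> \<open>Apart from the squared entries of \<open>M\<close>, the summands are arranged so
    that every double sum is a product of two single sums (\<open>s1\<close> to \<open>s6\<close>),
    a contraction with \<open>M\<close> (\<open>t1\<close> to \<open>t3\<close>) or a diagonal sum
    (\<open>d\<close>).\<close>
  have pt: "(M $ i $ j - c * (a $ i * f $ j) - c * (f $ i * a $ j) + \<mu> * c * (f $ i * f $ j) - \<beta> * ?\<delta> i j)\<^sup>2
    = (M $ i $ j)\<^sup>2 + c\<^sup>2 * ((a $ i * a $ i) * (f $ j * f $ j)) + c\<^sup>2 * ((f $ i * f $ i) * (a $ j * a $ j))
      + \<mu>\<^sup>2 * c\<^sup>2 * ((f $ i * f $ i) * (f $ j * f $ j)) + \<beta>\<^sup>2 * (1 * ?\<delta> i j)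
      + (- 2 * c) * (a $ i * (M $ i $ j * f $ j)) + (- 2 * c) * (a $ j * (M $ j $ i * f $ i))
      + 2 * \<mu> * c * (f $ i * (M $ i $ j * f $ j)) + (- 2 * \<beta>) * (M $ i $ j * ?\<delta> i j)
      + 2 * c\<^sup>2 * ((a $ i * f $ i) * (a $ j * f $ j))
      + (- 2 * \<mu> * c\<^sup>2) * ((a $ i * f $ i) * (f $ j * f $ j))
      + (- 2 * \<mu> * c\<^sup>2) * ((f $ i * f $ i) * (a $ j * f $ j))
      + 2 * \<beta> * c * ((a $ i * f $ j) * ?\<delta> i j) + 2 * \<beta> * c * ((f $ i * a $ j) * ?\<delta> i j)
      + (- 2 * \<mu> * \<beta> * c) * ((f $ i * f $ j) * ?\<delta> i j)" for i j
    unfolding sym[of j i] by (cases "i = j") (simp_all add: power2_eq_square algebra_simps)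
  have "(\<Sum>i\<in>UNIV. \<Sum>j\<in>UNIV. (M $ i $ j - c * (a $ i * f $ j) - c * (f $ i * a $ j)
      + \<mu> * c * (f $ i * f $ j) - \<beta> * ?\<delta> i j)\<^sup>2)
    = m + c\<^sup>2 * (Q * z) + c\<^sup>2 * (z * Q) + \<mu>\<^sup>2 * c\<^sup>2 * (z * z) + \<beta>\<^sup>2 * (\<Sum>i\<in>(UNIV::'n set). 1)
      + (- 2 * c) * Q + (- 2 * c) * Q + 2 * \<mu> * c * P + (- 2 * \<beta>) * (\<Sum>i\<in>UNIV. M $ i $ i)
      + 2 * c\<^sup>2 * (P * P) + (- 2 * \<mu> * c\<^sup>2) * (P * z) + (- 2 * \<mu> * c\<^sup>2) * (z * P)
      + 2 * \<beta> * c * P + 2 * \<beta> * c * (\<Sum>i\<in>UNIV. f $ i * a $ i) + (- 2 * \<mu> * \<beta> * c) * (\<Sum>i\<in>UNIV. f $ i * f $ i)"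
    unfolding pt sum.distrib pull s1 s2 s3 s4 s5 s6 t1 t2 t3 d
    unfolding m_def Ps by simp
  also have "\<dots> = m - 2 * Q / z + (P / z)\<^sup>2 + \<beta>\<^sup>2 * (real CARD('n) - 1) - 2 * \<beta> * (trace M - P / z)"
  proof -
    have fa: "(\<Sum>i\<in>UNIV. f $ i * a $ i) = P" unfolding Ps by (simp add: mult.commute)
    have cz: "c * z = 1" using z by (simp add: c_def)
    define t q where "t = c * P" and "q = c * Q"
    have c2: "c\<^sup>2 * (y * z) = c * y" "c\<^sup>2 * (z * y) = c * y" for y
    proof -
      have "c\<^sup>2 * (y * z) = (c * z) * (c * y)" by (simp add: power2_eq_square ac_simps)
      then show "c\<^sup>2 * (y * z) = c * y" unfolding cz by simp
      then show "c\<^sup>2 * (z * y) = c * y" by (simp add: mult.commute)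
    qed
    have e: "c\<^sup>2 * (Q * z) = q" "c\<^sup>2 * (z * Q) = q" "\<mu>\<^sup>2 * c\<^sup>2 * (z * z) = \<mu>\<^sup>2"
      "(- 2 * c) * Q = - 2 * q" "2 * \<mu> * c * P = 2 * \<mu> * t" "2 * c\<^sup>2 * (P * P) = 2 * t\<^sup>2"
      "(- 2 * \<mu> * c\<^sup>2) * (P * z) = - 2 * \<mu> * t" "(- 2 * \<mu> * c\<^sup>2) * (z * P) = - 2 * \<mu> * t"
      "2 * \<beta> * c * P = 2 * \<beta> * t" "(- 2 * \<mu> * \<beta> * c) * z = - 2 * \<mu> * \<beta>"
      unfolding mult.assoc c2 cz t_def q_def by (simp_all add: power2_eq_square)
    have \<mu>: "\<mu> = t + \<beta>" and tz: "P / z = t" "2 * Q / z = 2 * q"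
      by (simp_all add: \<mu>_def t_def q_def c_def)
    show ?thesis
      unfolding fa zs[symmetric] e tz trace_def unfolding \<mu> by (simp add: power2_eq_square algebra_simps)
  qed
  finally show ?thesis
    unfolding z_def[symmetric] P_def[symmetric] Q_def[symmetric] m_def[symmetric]
    using sum_nonneg by (metis (no_types, lifting) zero_le_power2)
qed

lemma trace_square_sym:
  fixes M :: "real^'n^'n"
  assumes "\<And>i j. M $ i $ j = M $ j $ i"
  shows "trace (M ** M) = (\<Sum>i\<in>UNIV. \<Sum>j\<in>UNIV. (M $ i $ j)\<^sup>2)"
  unfolding trace_def matrix_matrix_mult_def using assms
  by (auto simp: power2_eq_square intro!: sum.cong)

text \<open>With \<open>B = R ** transpose R\<close>, the matrix
  \<open>M = transpose R ** S ** R\<close> is symmetric, and by cyclicity of the trace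
  \<open>M\<close> and \<open>M ** M\<close> have the traces of \<open>H\<close> and
  \<open>H ** H\<close>. The vector \<open>f = transpose R *v \<phi>\<close> turns \<open>z\<close>,
  \<open>P\<close>, \<open>Q\<close> into \<open>f \<bullet> f\<close>,
  \<open>f \<bullet> (M *v f)\<close> and the squared length of \<open>M *v f\<close>. All claims
  thus become Euclidean; in dimension one Cauchy-Schwarz is an equality.\<close>

lemma trace_compression:
  fixes G S :: "real^'n^'n" and \<phi> :: "real^'n"
  assumes G: "transpose G = G" "\<forall>v. v \<noteq> 0 \<longrightarrow> v \<bullet> (G *v v) > 0" and S: "transpose S = S"
  defines "B \<equiv> matrix_inv G"
  defines "V \<equiv> B *v \<phi>"
  defines "z \<equiv> \<phi> \<bullet> V" and "P \<equiv> V \<bullet> (S *v V)" and "Q \<equiv> (S *v V) \<bullet> (B *v (S *v V))"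
    and "H \<equiv> S ** B"
  shows "z \<ge> 0" and "z = 0 \<Longrightarrow> V = 0" and "trace (H ** H) \<ge> 0" and "P\<^sup>2 \<le> z * Q"
    and "CARD('n) = 1 \<Longrightarrow> P\<^sup>2 = z * Q"
    and "z > 0 \<Longrightarrow> 0 \<le> trace (H ** H) - 2 * Q / z + (P / z)\<^sup>2
      + \<beta>\<^sup>2 * (real CARD('n) - 1) - 2 * \<beta> * (trace H - P / z)"
proof -
  obtain R :: "real^'n^'n" where R: "B = R ** transpose R"
    unfolding B_def using posdef_inverse_factor[OF G(1) G(2)[rule_format]] by blast
  define f where "f = transpose R *v \<phi>"
  define M where "M = transpose R ** S ** R"
  have M: "transpose M = M"
    unfolding M_def by (simp add: matrix_transpose_mul S matrix_mul_assoc)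
  have Mij: "M $ i $ j = M $ j $ i" for i j
    by (metis M transpose_def vec_lambda_beta)
  have adj: "x \<bullet> (transpose A *v y) = (A *v x) \<bullet> y" for x y :: "real^'n" and A :: "real^'n^'n"
    by (metis dot_lmul_matrix inner_commute transpose_matrix_vector transpose_transpose)
  have adj': "x \<bullet> (A *v y) = (transpose A *v x) \<bullet> y" for x y :: "real^'n" and A :: "real^'n^'n"
    using adj[of x "transpose A" y] by simp
  have V: "V = R *v f"
    unfolding V_def R f_def by (simp only: matrix_vector_mul_assoc)
  have z: "z = f \<bullet> f"
    using adj'[of \<phi> R f] by (simp only: z_def V f_def)
  have Mf: "M *v f = transpose R *v (S *v V)"
    unfolding M_def V by (simp add: matrix_vector_mul_assoc matrix_mul_assoc)
  have P: "P = f \<bullet> (M *v f)"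
    by (simp only: P_def Mf adj V[symmetric])
  have Q: "Q = (M *v f) \<bullet> (M *v f)"
    using adj'[of "S *v V" R "transpose R *v (S *v V)"]
    by (simp only: Q_def Mf R matrix_vector_mul_assoc[symmetric])
  have tr: "trace H = trace M"
    unfolding H_def R M_def by (metis matrix_mul_assoc trace_mul_sym)
  have trH: "trace (H ** H) = trace (M ** M)"
  proof -
    have "trace (H ** H) = trace ((S ** R ** transpose R ** S ** R) ** transpose R)"
      unfolding H_def R by (simp add: matrix_mul_assoc)
    also have "\<dots> = trace (transpose R ** (S ** R ** transpose R ** S ** R))" by (rule trace_mul_sym)
    finally show ?thesis unfolding M_def by (simp add: matrix_mul_assoc)
  qed
  show "z \<ge> 0" using z by simp
  show "z = 0 \<Longrightarrow> V = 0" using z V by simp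
  show "trace (H ** H) \<ge> 0"
    unfolding trH trace_square_sym[OF Mij] by (intro sum_nonneg) auto
  show "P\<^sup>2 \<le> z * Q" unfolding P z Q by (rule Cauchy_Schwarz_ineq)
  show "P\<^sup>2 = z * Q" if d1: "CARD('n) = 1"
  proof -
    obtain k :: 'n where k: "UNIV = {k}" by (rule card_1_singletonE[OF d1])
    show ?thesis unfolding P z Q inner_vec_def k by (simp add: power2_eq_square)
  qed
  show "0 \<le> trace (H ** H) - 2 * Q / z + (P / z)\<^sup>2
      + \<beta>\<^sup>2 * (real CARD('n) - 1) - 2 * \<beta> * (trace H - P / z)" if "z > 0"
    using frobenius_compression[of M f \<beta>, OF Mij] that
    unfolding trH trace_square_sym[OF Mij] tr z P Q by blast
qed


subsection \<open>The pointwise inequality\<close>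

lemma quadratic_nonneg:
  fixes a b c t :: real
  assumes "a > 0" "b\<^sup>2 \<le> a * c"
  shows "0 \<le> a * t\<^sup>2 + 2 * b * t + c"
proof -
  have "a * (a * t\<^sup>2 + 2 * b * t + c) = (a * t + b)\<^sup>2 + (a * c - b\<^sup>2)"
    by (simp add: power2_eq_square algebra_simps)
  then have "0 \<le> a * (a * t\<^sup>2 + 2 * b * t + c)" using assms(2) by simp
  then show ?thesis using assms(1) by (simp add: zero_le_mult_iff)
qed

text \<open>
  Here \<open>m\<close>, \<open>\<tau>\<close>, \<open>P\<close>, \<open>Q\<close> stand for \<open>|Hess F|\<^sup>2\<close>, \<open>\<Delta> F\<close>, \<open>Hess F(\<nabla>F, \<nabla>F)\<close>, \<open>|Hess F(\<nabla>F)|\<^sup>2\<close> and \<open>r\<close> for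
  \<open>Ric(L)(\<nabla>F, \<nabla>F)\<close>. For \<open>d \<ge> 2\<close> the hypotheses exclude \<open>1 \<le> n \<le> d\<close>, and otherwise minimising
  over \<open>\<tau>\<close> leaves a quadratic polynomial in \<open>P / z\<close>.
\<close>

lemma pointwise_inequality:
  fixes d n \<rho> z P Q m \<tau> r \<Phi>2 \<Phi>11 \<Phi>12 \<Phi>22 :: real
  assumes z: "z \<ge> 0" and z0: "z = 0 \<Longrightarrow> P = 0 \<and> Q = 0 \<and> r = 0" and m: "m \<ge> 0"
    and CS: "P\<^sup>2 \<le> z * Q" and CS1: "d = 1 \<Longrightarrow> P\<^sup>2 = z * Q"
    and comp: "\<And>b. z > 0 \<Longrightarrow> 0 \<le> m - 2 * Q / z + (P / z)\<^sup>2 + b\<^sup>2 * (d - 1) - 2 * b * (\<tau> - P / z)"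
    and r: "r \<ge> \<rho> * z + \<tau>\<^sup>2 / (n - d)" and d: "d = 1 \<or> d \<ge> 2" and nd: "n \<noteq> d"
    and cond: "(\<Phi>2 > 0
          \<and> \<Phi>2 * ((n + 1 - d) / (n - d)) + 2 * z * \<Phi>22 > 0
          \<and> (n - d) * (n * \<Phi>2 + 2 * (n - 1) * z * \<Phi>22) > 0
          \<and> 2 * \<rho> * \<Phi>2 + \<Phi>11
              - 2 * (n - 1) * (z * \<Phi>12\<^sup>2 / (n * \<Phi>2 + 2 * (n - 1) * z * \<Phi>22)) \<ge> 0)
       \<or> (\<Phi>2 = 0 \<and> z * \<Phi>22 = 0 \<and> z * \<Phi>12 = 0 \<and> z * \<Phi>11 \<ge> 0)
       \<or> (\<Phi>2 = 0 \<and> z * \<Phi>22 > 0 \<and> \<Phi>11 * \<Phi>22 - \<Phi>12\<^sup>2 \<ge> 0)" (is "?i \<or> ?ii \<or> ?iii")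
  shows "0 \<le> 2 * \<Phi>2 * (m + r) + \<Phi>11 * z + 4 * \<Phi>12 * P + 4 * \<Phi>22 * Q"
proof (cases "z = 0")
  \<comment> \<open>At a critical point only \<open>2 * \<Phi>2 * m\<close> is left, and every
    alternative gives \<open>\<Phi>2 \<ge> 0\<close>.\<close>
  case True
  then show ?thesis using z0 m cond by auto
next
  case False
  with z have z: "z > 0" by simp
  \<comment> \<open>For the unit vector e along the gradient, \<open>t\<close> is the entry <H e, e>
    and \<open>q\<close> is the squared length of the part of H e orthogonal to e.\<close>
  define t q where "t = P / z" and "q = Q / z - t\<^sup>2"
  have P: "P = z * t" and Q: "Q = z * (q + t\<^sup>2)" using z by (auto simp: t_def q_def)
  have zq: "z * Q - P\<^sup>2 = z\<^sup>2 * q" unfolding P Q by (simp add: power2_eq_square algebra_simps)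
  then have q: "q \<ge> 0" using CS z by (metis diff_ge_0_iff_ge zero_le_mult_iff zero_less_power not_less)
  have q1: "q = 0" if "d = 1" using CS1[OF that] zq z by simp
  have comp: "m \<ge> 2 * q + t\<^sup>2 - b\<^sup>2 * (d - 1) + 2 * b * (\<tau> - t)" for b
  proof -
    have "2 * (z * (q + t\<^sup>2)) / z = 2 * (q + t\<^sup>2)" using z by simp
    then show ?thesis
      using comp[OF z, of b] unfolding t_def[symmetric] Q by (simp add: algebra_simps)
  qed
  from cond consider ?i | ?ii | ?iii by blast
  then show ?thesis
  proof cases
    case 1
    define Y where "Y = n * \<Phi>2 + 2 * (n - 1) * z * \<Phi>22"
    have \<Phi>2: "\<Phi>2 > 0" and c2: "\<Phi>2 * ((n + 1 - d) / (n - d)) + 2 * z * \<Phi>22 > 0"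
      and Y: "(n - d) * Y > 0" and c4: "2 * \<rho> * \<Phi>2 + \<Phi>11 - 2 * (n - 1) * (z * \<Phi>12\<^sup>2 / Y) \<ge> 0"
      using 1 unfolding Y_def by blast+
    have e: "(n + 1 - d) / (n - d) = 1 + 1 / (n - d)" using nd by (simp add: field_simps)
    \<comment> \<open>The first part places \<open>n\<close> outside the interval from 1 to
      \<open>d\<close>. The second makes the coefficient of \<open>q\<close> in the final estimate
      nonnegative; for \<open>d = 1\<close> this is replaced by \<open>q = 0\<close>.\<close>
    have sign: "(n - 1) * (n - d) > 0 \<and> (d \<noteq> 1 \<longrightarrow> \<Phi>2 + z * \<Phi>22 \<ge> 0)"
    proof (cases "d = 1")
      case True
      then show ?thesis using nd by (auto simp: zero_less_mult_iff)
    next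
      case False
      with d have d: "d \<ge> 2" by simp
      show ?thesis
      proof (cases "n > d")
        case True
        have "n * \<Phi>2 \<le> 2 * (n - 1) * \<Phi>2"
          using True d \<Phi>2 by (intro mult_right_mono) auto
        then have "2 * (n - 1) * (\<Phi>2 + z * \<Phi>22) \<ge> Y"
          unfolding Y_def by (simp add: algebra_simps)
        moreover have "Y > 0" using Y True by (simp add: zero_less_mult_iff)
        ultimately have "2 * (n - 1) * (\<Phi>2 + z * \<Phi>22) > 0" by linarith
        then show ?thesis using True d by (simp add: zero_less_mult_iff)
      next
        case False
        with nd have n: "n < d" by simp
        \<comment> \<open>For n < d the second inequality of condition (i) contains a negative
          correction, so \<open>\<Phi>2 + 2 * z * \<Phi>22\<close> alone is positive. As
          \<open>Y\<close> is n - 1 times this quantity plus \<open>\<Phi>2\<close>, a negative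
          \<open>Y\<close> forces n < 1.\<close>
        have "\<Phi>2 * (1 / (n - d)) < 0" using n \<Phi>2 by (simp add: divide_less_0_iff)
        then have c2': "\<Phi>2 + 2 * z * \<Phi>22 > 0" using c2 unfolding e by (simp add: algebra_simps)
        have "Y < 0" using Y n by (simp add: zero_less_mult_iff)
        moreover have "Y = (n - 1) * (\<Phi>2 + 2 * z * \<Phi>22) + \<Phi>2"
          unfolding Y_def by (simp add: algebra_simps)
        ultimately have "(n - 1) * (\<Phi>2 + 2 * z * \<Phi>22) < 0" using \<Phi>2 by linarith
        then have "n < 1" using c2' by (simp add: mult_less_0_iff)
        then show ?thesis using n c2' \<Phi>2 by (simp add: zero_less_mult_iff)
      qed
    qed
    then have n1: "n \<noteq> 1" by auto
    have K: "m + \<tau>\<^sup>2 / (n - d) \<ge> 2 * q + t\<^sup>2 * (n / (n - 1))"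
    proof -
      have tn: "t\<^sup>2 * (n / (n - 1)) = t\<^sup>2 + t\<^sup>2 / (n - 1)" using n1 by (simp add: field_simps)
      show ?thesis
      proof (cases "d = 1")
        case True
        \<comment> \<open>For d = 1 the term in \<open>b\<^sup>2\<close> drops out of
          \<open>comp\<close> and leaves a bound on \<open>m\<close> that is affine in
          \<open>b\<close>; it holds for every \<open>b\<close> only if the slope vanishes. The
          witness makes the linear term equal to \<open>m - t\<^sup>2 + 1\<close>, one more than
          \<open>m\<close> allows.\<close>
        have "\<tau> = t"
        proof (rule ccontr)
          assume ne: "\<tau> \<noteq> t"
          have this0: "m \<ge> t\<^sup>2 + 2 * b * (\<tau> - t)" for b using comp[of b] True q by simp
          have "2 * ((m - t\<^sup>2 + 1) / (2 * e)) * e = m - t\<^sup>2 + 1" if "e \<noteq> 0" for e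
            using that by simp
          from this[of "\<tau> - t"] this0[of "(m - t\<^sup>2 + 1) / (2 * (\<tau> - t))"] ne show False by linarith
        qed
        then show ?thesis using comp[of 0] True tn by simp
      next
        case False
        with d have d: "d \<ge> 2" by simp
        \<comment> \<open>The best \<open>b\<close> is the mean eigenvalue of the complementary
          block, which has trace \<open>\<tau> - t\<close> and size d - 1.\<close>
        have "2 * q + t\<^sup>2 + (\<tau> - t)\<^sup>2 / (d - 1)
            = 2 * q + t\<^sup>2 - ((\<tau> - t) / (d - 1))\<^sup>2 * (d - 1) + 2 * ((\<tau> - t) / (d - 1)) * (\<tau> - t)"
          using d by (simp add: power2_eq_square)
        with comp[of "(\<tau> - t) / (d - 1)"] have c: "m \<ge> 2 * q + t\<^sup>2 + (\<tau> - t)\<^sup>2 / (d - 1)" by linarith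
        \<comment> \<open>Minimisation over \<open>\<tau>\<close> as a completed square, with
          minimum at \<open>\<tau> = (n - d) * t / (n - 1)\<close>; the denominator is positive by
          the first part of \<open>sign\<close>.\<close>
        have "(\<tau> - t)\<^sup>2 / (d - 1) + \<tau>\<^sup>2 / (n - d) - t\<^sup>2 / (n - 1)
            = ((n - 1) * \<tau> - (n - d) * t)\<^sup>2 / ((d - 1) * ((n - 1) * (n - d)))"
        proof -
          have "(\<tau> - t)\<^sup>2 * ((n - d) * (n - 1)) + \<tau>\<^sup>2 * ((d - 1) * (n - 1)) - t\<^sup>2 * ((d - 1) * (n - d))
            = ((n - 1) * \<tau> - (n - d) * t)\<^sup>2"
            by algebra
          then show ?thesis
            using d nd n1 by (simp add: divide_simps) (simp add: algebra_simps)
        qed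
        also have "\<dots> \<ge> 0" using sign d by simp
        finally show ?thesis using c tn by linarith
      qed
    qed
    \<comment> \<open>\<open>a\<close> is the total coefficient of \<open>t\<^sup>2\<close>, namely
      \<open>2 * \<Phi>2 * n / (n - 1) + 4 * z * \<Phi>22\<close>. It is positive because both (n -
      1)(n - d) and (n - d) Y are, and the last inequality of condition (i) is the discriminant
      condition for the polynomial with this leading coefficient.\<close>
    define a where "a = 2 * Y / (n - 1)"
    have a: "a > 0"
    proof -
      have "((n - 1) * (n - d)) * ((n - d) * Y) > 0" using sign Y by simp
      then have "(n - d)\<^sup>2 * ((n - 1) * Y) > 0" by (simp add: power2_eq_square algebra_simps)
      then have "(n - 1) * Y > 0" using nd by (simp add: zero_less_mult_iff)
      then show ?thesis unfolding a_def by (auto simp: zero_less_mult_iff zero_less_divide_iff)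
    qed
    have Y0: "Y \<noteq> 0" using Y by auto
    have aY: "2 * (n - 1) * (z * \<Phi>12\<^sup>2 / Y) = 4 * z * \<Phi>12\<^sup>2 / a"
      unfolding a_def using n1 Y0 by (simp add: field_simps)
    have "(2 * \<Phi>12 * z)\<^sup>2 \<le> a * (z * (2 * \<rho> * \<Phi>2 + \<Phi>11))"
    proof -
      have "4 * z * \<Phi>12\<^sup>2 \<le> a * (2 * \<rho> * \<Phi>2 + \<Phi>11)"
        using c4 a unfolding aY by (simp add: pos_divide_le_eq mult.commute)
      then have "z * (4 * z * \<Phi>12\<^sup>2) \<le> z * (a * (2 * \<rho> * \<Phi>2 + \<Phi>11))"
        using z by (intro mult_left_mono) auto
      then show ?thesis by (simp add: power2_eq_square algebra_simps)
    qed
    from quadratic_nonneg[OF a this, of t]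
    have "0 \<le> a * t\<^sup>2 + 4 * \<Phi>12 * z * t + z * (2 * \<rho> * \<Phi>2 + \<Phi>11)" by (simp add: algebra_simps)
    moreover have "0 \<le> 4 * q * (\<Phi>2 + z * \<Phi>22)"
      using sign q q1 by (cases "d = 1") auto
    moreover have "a * t\<^sup>2 = 2 * \<Phi>2 * (t\<^sup>2 * (n / (n - 1))) + 4 * \<Phi>22 * z * t\<^sup>2"
      unfolding a_def Y_def using n1 by (simp add: field_simps)
    moreover have "2 * \<Phi>2 * (m + r) \<ge> 2 * \<Phi>2 * (2 * q + t\<^sup>2 * (n / (n - 1)) + \<rho> * z)"
      using K r \<Phi>2 by (intro mult_left_mono) auto
    ultimately show ?thesis
      unfolding P Q by (simp add: algebra_simps)
  next
    case 2
    then show ?thesis using z by (auto simp: zero_le_mult_iff)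
  next
    case 3
    then have "\<Phi>22 > 0" using z by (simp add: zero_less_mult_iff)
    have "\<Phi>12\<^sup>2 \<le> \<Phi>22 * \<Phi>11" using 3 by (simp add: mult.commute)
    \<comment> \<open>With \<open>\<Phi>2 = 0\<close> the curvature drops out; divided by
      \<open>z\<close>, the expression is a quadratic polynomial in \<open>2 * t\<close> plus
      \<open>4 * \<Phi>22 * q\<close>, and condition (iii) controls the discriminant.\<close>
    from quadratic_nonneg[OF \<open>\<Phi>22 > 0\<close> this, of "2 * t"]
    have "0 \<le> z * (\<Phi>22 * (2 * t)\<^sup>2 + 2 * \<Phi>12 * (2 * t) + \<Phi>11)"
      using z by simp
    moreover have "0 \<le> 4 * \<Phi>22 * z * q"
      using z \<open>\<Phi>22 > 0\<close> q by simp
    ultimately show ?thesis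
      using 3 unfolding P Q by (simp add: power2_eq_square algebra_simps)
  qed
qed

subsection \<open>Bochner's formula in a chart\<close>

lemma sum_rotate3:
  fixes f :: "'a::finite \<Rightarrow> 'b::finite \<Rightarrow> 'c::finite \<Rightarrow> real"
  shows "(\<Sum>i\<in>UNIV. \<Sum>j\<in>UNIV. \<Sum>k\<in>UNIV. f i j k) = (\<Sum>k\<in>UNIV. \<Sum>i\<in>UNIV. \<Sum>j\<in>UNIV. f i j k)"
proof -
  have "(\<Sum>i\<in>UNIV. \<Sum>j\<in>UNIV. \<Sum>k\<in>UNIV. f i j k) = (\<Sum>i\<in>UNIV. \<Sum>k\<in>UNIV. \<Sum>j\<in>UNIV. f i j k)"
    by (intro sum.cong refl sum.swap)
  also have "\<dots> = (\<Sum>k\<in>UNIV. \<Sum>i\<in>UNIV. \<Sum>j\<in>UNIV. f i j k)"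
    by (rule sum.swap)
  finally show ?thesis .
qed

lemma sum_rotate4:
  fixes f :: "'a::finite \<Rightarrow> 'b::finite \<Rightarrow> 'c::finite \<Rightarrow> 'd::finite \<Rightarrow> real"
  shows "(\<Sum>i\<in>UNIV. \<Sum>j\<in>UNIV. \<Sum>k\<in>UNIV. \<Sum>l\<in>UNIV. f i j k l)
    = (\<Sum>l\<in>UNIV. \<Sum>i\<in>UNIV. \<Sum>j\<in>UNIV. \<Sum>k\<in>UNIV. f i j k l)"
proof -
  have "(\<Sum>i\<in>UNIV. \<Sum>j\<in>UNIV. \<Sum>k\<in>UNIV. \<Sum>l\<in>UNIV. f i j k l)
      = (\<Sum>i\<in>UNIV. \<Sum>l\<in>UNIV. \<Sum>j\<in>UNIV. \<Sum>k\<in>UNIV. f i j k l)"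
    by (intro sum.cong refl sum_rotate3)
  also have "\<dots> = (\<Sum>l\<in>UNIV. \<Sum>i\<in>UNIV. \<Sum>j\<in>UNIV. \<Sum>k\<in>UNIV. f i j k l)"
    by (rule sum.swap)
  finally show ?thesis .
qed

text \<open>
  The contracted Ricci identity as an identity between the values of \<open>V\<close>, \<open>\<partial>V\<close>, \<open>\<partial>\<partial>V\<close>,
  the Christoffel symbols and their first derivatives at one point.
\<close>

lemma ricci_identity_sum:
  fixes v :: "'n::finite \<Rightarrow> real" and D :: "'n \<Rightarrow> 'n \<Rightarrow> real" and DD C :: "'n \<Rightarrow> 'n \<Rightarrow> 'n \<Rightarrow> real"
    and DC :: "'n \<Rightarrow> 'n \<Rightarrow> 'n \<Rightarrow> 'n \<Rightarrow> real"
  assumes DD: "\<And>i j k. DD i j k = DD j i k" and C: "\<And>a i j. C a i j = C a j i"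
  defines "N \<equiv> \<lambda>k i. D k i + (\<Sum>j\<in>UNIV. C i k j * v j)"
  shows "(\<Sum>i\<in>UNIV. (\<Sum>k\<in>UNIV. v k * (DD i k i + (\<Sum>j\<in>UNIV. C i k j * D i j + DC i i k j * v j)) + D i k * N k i)
      + (\<Sum>l\<in>UNIV. C i i l * (\<Sum>k\<in>UNIV. v k * N k l)))
    = (\<Sum>i\<in>UNIV. \<Sum>j\<in>UNIV. N i j * N j i)
      + (\<Sum>j\<in>UNIV. \<Sum>k\<in>UNIV. (\<Sum>i\<in>UNIV. DC i i j k - DC j i i k
          + (\<Sum>m\<in>UNIV. C i i m * C m j k) - (\<Sum>m\<in>UNIV. C i j m * C m i k)) * v j * v k)
      + (\<Sum>j\<in>UNIV. v j * (\<Sum>i\<in>UNIV. DD j i i + (\<Sum>k\<in>UNIV. C i i k * D j k + DC j i i k * v k)))"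
    (is "?L = ?R")
proof -
  \<comment> \<open>\<open>D i k\<close> stands for the derivative of component \<open>k\<close> of
    the field in direction \<open>i\<close>, \<open>DC i a j k\<close> for the derivative of
    \<open>C a j k\<close> in direction \<open>i\<close>, and \<open>N k i\<close> for component
    \<open>i\<close> of the covariant derivative in direction \<open>k\<close>. Both sides are
    expanded into monomials, matched by \<open>a1\<close> to \<open>a7\<close>; the sum of
    \<open>D i k * N k i\<close> occurs on both sides and stays unexpanded. Second derivatives are
    commuted in \<open>a7\<close>; \<open>a1\<close> and \<open>a4\<close> use the symmetry of
    \<open>C\<close>.\<close>
  have a1: "(\<Sum>i\<in>UNIV. \<Sum>k\<in>UNIV. \<Sum>j\<in>UNIV. v k * (C i k j * D i j))
      = (\<Sum>i\<in>UNIV. \<Sum>j\<in>UNIV. \<Sum>a\<in>UNIV. C j i a * v a * D j i)"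
  proof -
    have "(\<Sum>i\<in>UNIV. \<Sum>j\<in>UNIV. \<Sum>a\<in>UNIV. C j i a * v a * D j i)
        = (\<Sum>j\<in>UNIV. \<Sum>i\<in>UNIV. \<Sum>a\<in>UNIV. C j i a * v a * D j i)"
      by (rule sum.swap)
    also have "\<dots> = (\<Sum>j\<in>UNIV. \<Sum>a\<in>UNIV. \<Sum>i\<in>UNIV. C j i a * v a * D j i)"
      by (intro sum.cong refl sum.swap)
    also have "\<dots> = (\<Sum>i\<in>UNIV. \<Sum>k\<in>UNIV. \<Sum>j\<in>UNIV. v k * (C i k j * D i j))"
      by (intro sum.cong refl) (use C in \<open>simp add: ac_simps\<close>)
    finally show ?thesis by simp
  qed
  have a2: "(\<Sum>i\<in>UNIV. \<Sum>l\<in>UNIV. \<Sum>k\<in>UNIV. C i i l * (v k * D k l))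
      = (\<Sum>j\<in>UNIV. \<Sum>i\<in>UNIV. \<Sum>k\<in>UNIV. v j * (C i i k * D j k))"
    unfolding sum_rotate3[of "\<lambda>i l k. C i i l * (v k * D k l)"]
    by (simp add: ac_simps)
  have a3: "(\<Sum>i\<in>UNIV. \<Sum>l\<in>UNIV. \<Sum>k\<in>UNIV. \<Sum>j\<in>UNIV. C i i l * (v k * (C l k j * v j)))
      = (\<Sum>j\<in>UNIV. \<Sum>k\<in>UNIV. \<Sum>i\<in>UNIV. \<Sum>m\<in>UNIV. C i i m * C m j k * v j * v k)"
  proof -
    have "(\<Sum>i\<in>UNIV. \<Sum>l\<in>UNIV. \<Sum>k\<in>UNIV. \<Sum>j\<in>UNIV. C i i l * (v k * (C l k j * v j)))
       = (\<Sum>k\<in>UNIV. \<Sum>j\<in>UNIV. \<Sum>i\<in>UNIV. \<Sum>l\<in>UNIV. C i i l * (v k * (C l k j * v j)))"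
      by (subst sum_rotate4, subst sum_rotate4) (rule refl)
    then show ?thesis by (simp add: ac_simps)
  qed
  have a4: "(\<Sum>i\<in>UNIV. \<Sum>j\<in>UNIV. \<Sum>a\<in>UNIV. \<Sum>b\<in>UNIV. (C j i a * v a) * (C i j b * v b))
      = (\<Sum>j\<in>UNIV. \<Sum>k\<in>UNIV. \<Sum>i\<in>UNIV. \<Sum>m\<in>UNIV. C i j m * C m i k * v j * v k)"
  proof -
    have "(\<Sum>i\<in>UNIV. \<Sum>j\<in>UNIV. \<Sum>a\<in>UNIV. \<Sum>b\<in>UNIV. (C j i a * v a) * (C i j b * v b))
       = (\<Sum>a\<in>UNIV. \<Sum>b\<in>UNIV. \<Sum>i\<in>UNIV. \<Sum>j\<in>UNIV. (C j i a * v a) * (C i j b * v b))"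
      by (subst sum_rotate4, subst sum_rotate4) (rule refl)
    also have "\<dots> = (\<Sum>b\<in>UNIV. \<Sum>a\<in>UNIV. \<Sum>i\<in>UNIV. \<Sum>j\<in>UNIV. (C j i a * v a) * (C i j b * v b))"
      by (rule sum.swap)
    also have "\<dots> = (\<Sum>j\<in>UNIV. \<Sum>k\<in>UNIV. \<Sum>i\<in>UNIV. \<Sum>m\<in>UNIV. C i j m * C m i k * v j * v k)"
      by (intro sum.cong refl) (simp add: C[of _ j] C ac_simps)
    finally show ?thesis .
  qed
  have a5: "(\<Sum>i\<in>UNIV. \<Sum>k\<in>UNIV. \<Sum>j\<in>UNIV. v k * (DC i i k j * v j))
      = (\<Sum>j\<in>UNIV. \<Sum>k\<in>UNIV. \<Sum>i\<in>UNIV. DC i i j k * v j * v k)"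
    unfolding sum_rotate3[of "\<lambda>j k i. DC i i j k * v j * v k"] by (simp add: ac_simps)
  have a6: "(\<Sum>j\<in>UNIV. \<Sum>i\<in>UNIV. \<Sum>k\<in>UNIV. v j * (DC j i i k * v k))
      = (\<Sum>j\<in>UNIV. \<Sum>k\<in>UNIV. \<Sum>i\<in>UNIV. DC j i i k * v j * v k)"
    by (rule sum.cong[OF refl], subst sum.swap) (simp add: ac_simps)
  have a7: "(\<Sum>i\<in>UNIV. \<Sum>k\<in>UNIV. v k * DD i k i) = (\<Sum>j\<in>UNIV. \<Sum>i\<in>UNIV. v j * DD j i i)"
    by (subst sum.swap) (simp add: DD)
  have L: "?L = (\<Sum>i\<in>UNIV. \<Sum>k\<in>UNIV. v k * DD i k i)
      + (\<Sum>i\<in>UNIV. \<Sum>k\<in>UNIV. \<Sum>j\<in>UNIV. v k * (C i k j * D i j))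
      + (\<Sum>i\<in>UNIV. \<Sum>k\<in>UNIV. \<Sum>j\<in>UNIV. v k * (DC i i k j * v j))
      + (\<Sum>i\<in>UNIV. \<Sum>k\<in>UNIV. D i k * N k i)
      + (\<Sum>i\<in>UNIV. \<Sum>l\<in>UNIV. \<Sum>k\<in>UNIV. C i i l * (v k * D k l))
      + (\<Sum>i\<in>UNIV. \<Sum>l\<in>UNIV. \<Sum>k\<in>UNIV. \<Sum>j\<in>UNIV. C i i l * (v k * (C l k j * v j)))"
    unfolding N_def by (simp add: distrib_left sum.distrib sum_distrib_left)
  have NN: "(\<Sum>i\<in>UNIV. \<Sum>j\<in>UNIV. N i j * N j i) = (\<Sum>i\<in>UNIV. \<Sum>k\<in>UNIV. D i k * N k i)
      + (\<Sum>i\<in>UNIV. \<Sum>j\<in>UNIV. \<Sum>a\<in>UNIV. C j i a * v a * D j i)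
      + (\<Sum>i\<in>UNIV. \<Sum>j\<in>UNIV. \<Sum>a\<in>UNIV. \<Sum>b\<in>UNIV. (C j i a * v a) * (C i j b * v b))"
  proof -
    have "(\<Sum>i\<in>UNIV. \<Sum>j\<in>UNIV. N i j * N j i)
      = (\<Sum>i\<in>UNIV. \<Sum>j\<in>UNIV. D i j * N j i + (\<Sum>a\<in>UNIV. C j i a * v a) * D j i
          + (\<Sum>a\<in>UNIV. C j i a * v a) * (\<Sum>b\<in>UNIV. C i j b * v b))"
      unfolding N_def by (intro sum.cong refl) (simp add: algebra_simps)
    also have "\<dots> = (\<Sum>i\<in>UNIV. \<Sum>j\<in>UNIV. D i j * N j i) + (\<Sum>i\<in>UNIV. \<Sum>j\<in>UNIV. (\<Sum>a\<in>UNIV. C j i a * v a) * D j i)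
        + (\<Sum>i\<in>UNIV. \<Sum>j\<in>UNIV. (\<Sum>a\<in>UNIV. C j i a * v a) * (\<Sum>b\<in>UNIV. C i j b * v b))"
      by (simp only: sum.distrib)
    finally show ?thesis unfolding sum_product unfolding sum_distrib_right .
  qed
  have Ric: "(\<Sum>j\<in>UNIV. \<Sum>k\<in>UNIV. (\<Sum>i\<in>UNIV. DC i i j k - DC j i i k
          + (\<Sum>m\<in>UNIV. C i i m * C m j k) - (\<Sum>m\<in>UNIV. C i j m * C m i k)) * v j * v k)
    = (\<Sum>j\<in>UNIV. \<Sum>k\<in>UNIV. \<Sum>i\<in>UNIV. DC i i j k * v j * v k)
      - (\<Sum>j\<in>UNIV. \<Sum>k\<in>UNIV. \<Sum>i\<in>UNIV. DC j i i k * v j * v k)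
      + (\<Sum>j\<in>UNIV. \<Sum>k\<in>UNIV. \<Sum>i\<in>UNIV. \<Sum>m\<in>UNIV. C i i m * C m j k * v j * v k)
      - (\<Sum>j\<in>UNIV. \<Sum>k\<in>UNIV. \<Sum>i\<in>UNIV. \<Sum>m\<in>UNIV. C i j m * C m i k * v j * v k)"
    by (simp add: sum.distrib sum_subtractf sum_distrib_right distrib_right left_diff_distrib)
  have Z: "(\<Sum>j\<in>UNIV. v j * (\<Sum>i\<in>UNIV. DD j i i + (\<Sum>k\<in>UNIV. C i i k * D j k + DC j i i k * v k)))
    = (\<Sum>j\<in>UNIV. \<Sum>i\<in>UNIV. v j * DD j i i)
      + (\<Sum>j\<in>UNIV. \<Sum>i\<in>UNIV. \<Sum>k\<in>UNIV. v j * (C i i k * D j k))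
      + (\<Sum>j\<in>UNIV. \<Sum>i\<in>UNIV. \<Sum>k\<in>UNIV. v j * (DC j i i k * v k))"
    by (simp add: sum.distrib sum_distrib_left distrib_left)
  show ?thesis
    unfolding L NN Ric Z a1 a2 a3 a4 a5 a6 a7 by simp
qed

text \<open>The coordinate calculus rests only on a smooth, symmetric, positive definite matrix
  function on an open set. Separating it from the manifold keeps tangent vectors and the choice of
  charts out of the computations up to Bochner's formula.\<close>

locale riemannian_chart =
  fixes c :: "('m, 'n::finite) chart" and g :: "'m metric"
  assumes open_image: "open (chart_image c)"
    and smooth_metric: "\<And>i j. smooth_on (chart_image c) (\<lambda>x. metric_matrix c g x $ i $ j)"
    and sym_metric: "\<And>x. x \<in> chart_image c \<Longrightarrow> transpose (metric_matrix c g x) = metric_matrix c g x"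
    and pos_metric: "\<And>x v. x \<in> chart_image c \<Longrightarrow> v \<noteq> 0 \<Longrightarrow> v \<bullet> (metric_matrix c g x *v v) > 0"
begin

abbreviation "U \<equiv> chart_image c"
abbreviation "G x i j \<equiv> metric_matrix c g x $ i $ j"
abbreviation "B x i j \<equiv> matrix_inv (metric_matrix c g x) $ i $ j"
abbreviation "C k i j x \<equiv> christoffel c g k i j x"

definition grad :: "(real^'n \<Rightarrow> real) \<Rightarrow> 'n \<Rightarrow> real^'n \<Rightarrow> real" where
  "grad h k x = (\<Sum>l\<in>UNIV. B x k l * pderivative l h x)"

definition hess :: "(real^'n \<Rightarrow> real) \<Rightarrow> 'n \<Rightarrow> 'n \<Rightarrow> real^'n \<Rightarrow> real" where
  "hess h i j x = pderivative i (pderivative j h) x - (\<Sum>k\<in>UNIV. C k i j x * pderivative k h x)"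

text \<open>The first index is the direction of differentiation, the second the component of the
  covariant derivative.\<close>

definition nabla :: "('n \<Rightarrow> real^'n \<Rightarrow> real) \<Rightarrow> 'n \<Rightarrow> 'n \<Rightarrow> real^'n \<Rightarrow> real" where
  "nabla V i a x = pderivative i (V a) x + (\<Sum>k\<in>UNIV. C a i k x * V k x)"

definition lap :: "(real^'n \<Rightarrow> real) \<Rightarrow> real^'n \<Rightarrow> real" where
  "lap h x = (\<Sum>i\<in>UNIV. \<Sum>j\<in>UNIV. B x i j * hess h i j x)"

definition gam :: "(real^'n \<Rightarrow> real) \<Rightarrow> real^'n \<Rightarrow> real" where
  "gam h x = (\<Sum>k\<in>UNIV. pderivative k h x * grad h k x)"

lemma G_sym: "x \<in> U \<Longrightarrow> G x i j = G x j i"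
  using arg_cong[OF sym_metric, of x "\<lambda>A. A $ j $ i"] by (simp add: transpose_def)

lemma G_invertible: "x \<in> U \<Longrightarrow> invertible (metric_matrix c g x)"
  using pos_metric posdef_invertible by blast

lemma B_sym: "x \<in> U \<Longrightarrow> B x i j = B x j i"
  using arg_cong[OF matrix_inv_sym[OF G_invertible sym_metric], of x "\<lambda>A. A $ j $ i"]
  by (simp add: transpose_def)

lemma GB: "x \<in> U \<Longrightarrow> (\<Sum>l\<in>UNIV. G x i l * B x l j) = (if i = j then 1 else 0)"
  using matrix_inv_right_left(1)[OF G_invertible]
  by (simp add: matrix_matrix_mult_def mat_def vec_eq_iff)

lemma BG: "x \<in> U \<Longrightarrow> (\<Sum>l\<in>UNIV. B x i l * G x l j) = (if i = j then 1 else 0)"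
  using matrix_inv_right_left(2)[OF G_invertible]
  by (simp add: matrix_matrix_mult_def mat_def vec_eq_iff)

lemma G_B_apply: "x \<in> U \<Longrightarrow> (\<Sum>k\<in>UNIV. G x i k * (\<Sum>l\<in>UNIV. B x k l * w l)) = w i"
proof -
  assume x: "x \<in> U"
  have "(\<Sum>k\<in>UNIV. G x i k * (\<Sum>l\<in>UNIV. B x k l * w l)) = (\<Sum>l\<in>UNIV. (\<Sum>k\<in>UNIV. G x i k * B x k l) * w l)"
    unfolding sum_distrib_left sum_distrib_right by (subst sum.swap) (simp add: ac_simps)
  then show ?thesis by (simp add: GB[OF x] if_distrib[of "\<lambda>a. a * _"] cong: if_cong)
qed

lemma B_G_apply: "x \<in> U \<Longrightarrow> (\<Sum>k\<in>UNIV. B x i k * (\<Sum>l\<in>UNIV. G x k l * w l)) = w i"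
proof -
  assume x: "x \<in> U"
  have "(\<Sum>k\<in>UNIV. B x i k * (\<Sum>l\<in>UNIV. G x k l * w l)) = (\<Sum>l\<in>UNIV. (\<Sum>k\<in>UNIV. B x i k * G x k l) * w l)"
    unfolding sum_distrib_left sum_distrib_right by (subst sum.swap) (simp add: ac_simps)
  then show ?thesis by (simp add: BG[OF x] if_distrib[of "\<lambda>a. a * _"] cong: if_cong)
qed

lemma smooth_B: "smooth_on U (\<lambda>x. B x i j)"
  using smooth_on_matrix_inv[OF open_image smooth_metric G_invertible] .

lemma smooth_C: "smooth_on U (C k i j)"
proof -
  have "smooth_on U (\<lambda>x. (\<Sum>l\<in>UNIV. B x k l *
        (pderivative i (\<lambda>y. G y j l) x + pderivative j (\<lambda>y. G y i l) x - pderivative l (\<lambda>y. G y i j) x)) * (1 / 2))"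
    by (intro smooth_on_mult smooth_on_sum smooth_on_diff smooth_on_add smooth_on_const
        smooth_on_pderivative smooth_B smooth_metric open_image)
  then show ?thesis unfolding christoffel_def[abs_def] by simp
qed

lemma smooth_grad: "smooth_on U h \<Longrightarrow> smooth_on U (grad h k)"
  unfolding grad_def[abs_def]
  by (intro smooth_on_sum smooth_on_mult smooth_B smooth_on_pderivative open_image)

lemma smooth_gam: "smooth_on U h \<Longrightarrow> smooth_on U (gam h)"
  unfolding gam_def[abs_def]
  by (intro smooth_on_sum smooth_on_mult smooth_grad smooth_on_pderivative open_image)

lemma smooth_nabla: "(\<And>k. smooth_on U (V k)) \<Longrightarrow> smooth_on U (nabla V i a)"
  unfolding nabla_def[abs_def]
  by (intro smooth_on_add smooth_on_sum smooth_on_mult smooth_C smooth_on_pderivative open_image)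

lemma differentiable_smooth: "smooth_on U f \<Longrightarrow> x \<in> U \<Longrightarrow> f differentiable (at x)"
  using smooth_on_differentiable[OF open_image] .

lemma pderivative_smooth_mult:
  "smooth_on U f \<Longrightarrow> smooth_on U h \<Longrightarrow> x \<in> U \<Longrightarrow>
    pderivative i (\<lambda>x. f x * h x) x = f x * pderivative i h x + pderivative i f x * h x"
  by (intro pderivative_mult differentiable_smooth)

lemma pderivative_smooth_add:
  "smooth_on U f \<Longrightarrow> smooth_on U h \<Longrightarrow> x \<in> U \<Longrightarrow>
    pderivative i (\<lambda>x. f x + h x) x = pderivative i f x + pderivative i h x"
  by (intro pderivative_add differentiable_smooth)

lemma pderivative_smooth_sum:
  "(\<And>k. smooth_on U (f k)) \<Longrightarrow> x \<in> U \<Longrightarrow>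
    pderivative i (\<lambda>x. \<Sum>k\<in>K. f k x) x = (\<Sum>k\<in>K. pderivative i (f k) x)"
  by (intro pderivative_sum differentiable_smooth)

lemma pderivative_smooth_sum_mult:
  fixes p q :: "'n \<Rightarrow> real^'n \<Rightarrow> real"
  assumes "\<And>k. smooth_on U (p k)" "\<And>k. smooth_on U (q k)" "x \<in> U"
  shows "pderivative i (\<lambda>x. \<Sum>k\<in>UNIV. p k x * q k x) x
    = (\<Sum>k\<in>UNIV. p k x * pderivative i (q k) x + pderivative i (p k) x * q k x)"
  using assms
  by (subst pderivative_smooth_sum) (auto intro!: smooth_on_mult open_image simp: pderivative_smooth_mult)

lemma pderivative_cong_on:
  assumes "x \<in> U" "\<And>y. y \<in> U \<Longrightarrow> f y = h y"
  shows "pderivative i f x = pderivative i h x"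
  by (rule pderivative_cong[OF open_image assms])

text \<open>These are the Christoffel symbols of the first kind, free of the inverse metric.\<close>

lemma christoffel_lower:
  assumes x: "x \<in> U"
  shows "(\<Sum>k\<in>UNIV. G x m k * C k i j x)
    = (pderivative i (\<lambda>y. G y j m) x + pderivative j (\<lambda>y. G y i m) x - pderivative m (\<lambda>y. G y i j) x) / 2"
proof -
  have "(\<Sum>k\<in>UNIV. G x m k * C k i j x) = (\<Sum>k\<in>UNIV. G x m k * (\<Sum>l\<in>UNIV. B x k l *
      ((pderivative i (\<lambda>y. G y j l) x + pderivative j (\<lambda>y. G y i l) x - pderivative l (\<lambda>y. G y i j) x) / 2)))"
    unfolding christoffel_def by (simp add: sum_divide_distrib)
  then show ?thesis unfolding G_B_apply[OF x] .
qed

lemma C_sym: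
  assumes x: "x \<in> U"
  shows "C k i j x = C k j i x"
proof -
  have "pderivative l (\<lambda>y. G y i j) x = pderivative l (\<lambda>y. G y j i) x" for l
    by (rule pderivative_cong_on[OF x G_sym])
  then show ?thesis unfolding christoffel_def by (simp add: add.commute)
qed

text \<open>The metric is parallel: in the sum of two symbols of the first kind four of the six
  derivatives cancel, and the other two agree by the symmetry of the metric.\<close>

lemma metric_compatible:
  assumes x: "x \<in> U"
  shows "pderivative i (\<lambda>y. G y j k) x = (\<Sum>m\<in>UNIV. G x k m * C m i j x) + (\<Sum>m\<in>UNIV. G x j m * C m i k x)"
proof -
  have s: "pderivative l (\<lambda>y. G y i j) x = pderivative l (\<lambda>y. G y j i) x" for l i j
    by (rule pderivative_cong_on[OF x G_sym])
  show ?thesis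
    unfolding christoffel_lower[OF x] using s[of i j k] s[of j i k] s[of k i j] by (simp add: field_simps)
qed

lemma lower_grad: "x \<in> U \<Longrightarrow> (\<Sum>k\<in>UNIV. G x m k * grad h k x) = pderivative m h x"
  unfolding grad_def by (rule G_B_apply)

text \<open>Obtained by differentiating \<open>lower_grad\<close>: as the metric is parallel,
  lowering an index commutes with covariant differentiation.\<close>

lemma hess_eq_nabla:
  assumes h: "smooth_on U h" and x: "x \<in> U"
  shows "hess h i m x = (\<Sum>a\<in>UNIV. G x m a * nabla (grad h) i a x)"
proof -
  have "pderivative i (pderivative m h) x = pderivative i (\<lambda>y. \<Sum>k\<in>UNIV. G y m k * grad h k y) x"
    by (rule pderivative_cong_on[OF x lower_grad[symmetric]])
  also have "\<dots> = (\<Sum>k\<in>UNIV. G x m k * pderivative i (grad h k) x + pderivative i (\<lambda>y. G y m k) x * grad h k x)"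
    using x h by (intro pderivative_smooth_sum_mult smooth_metric smooth_grad)
  also have "\<dots> = (\<Sum>k\<in>UNIV. G x m k * pderivative i (grad h k) x)
      + (\<Sum>k\<in>UNIV. (\<Sum>a\<in>UNIV. G x k a * C a i m x) * grad h k x)
      + (\<Sum>k\<in>UNIV. (\<Sum>a\<in>UNIV. G x m a * C a i k x) * grad h k x)"
    unfolding metric_compatible[OF x] by (simp add: distrib_right sum.distrib)
  also have "(\<Sum>k\<in>UNIV. (\<Sum>a\<in>UNIV. G x k a * C a i m x) * grad h k x)
      = (\<Sum>a\<in>UNIV. C a i m x * (\<Sum>k\<in>UNIV. G x a k * grad h k x))"
    unfolding sum_distrib_left sum_distrib_right
    by (subst sum.swap) (simp add: G_sym[OF x] ac_simps)
  also have "\<dots> = (\<Sum>a\<in>UNIV. C a i m x * pderivative a h x)"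
    by (simp add: lower_grad[OF x])
  also have "(\<Sum>k\<in>UNIV. (\<Sum>a\<in>UNIV. G x m a * C a i k x) * grad h k x)
      = (\<Sum>a\<in>UNIV. G x m a * (\<Sum>k\<in>UNIV. C a i k x * grad h k x))"
    unfolding sum_distrib_left sum_distrib_right
    by (subst sum.swap) (simp add: ac_simps)
  finally show ?thesis
    unfolding hess_def nabla_def by (simp add: distrib_left sum.distrib)
qed

lemma nabla_eq_hess:
  assumes h: "smooth_on U h" and x: "x \<in> U"
  shows "nabla (grad h) i a x = (\<Sum>m\<in>UNIV. B x a m * hess h i m x)"
  unfolding hess_eq_nabla[OF assms] using B_G_apply[OF x] by simp

lemma hess_sym:
  assumes h: "smooth_on U h" and x: "x \<in> U"
  shows "hess h i j x = hess h j i x"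
  unfolding hess_def pderivative_commute[OF open_image x h, of i j] by (simp add: C_sym[OF x])

lemma lap_eq_div:
  assumes h: "smooth_on U h" and x: "x \<in> U"
  shows "lap h x = (\<Sum>i\<in>UNIV. nabla (grad h) i i x)"
  unfolding lap_def nabla_eq_hess[OF assms] ..

lemma pderivative_gam:
  assumes h: "smooth_on U h" and x: "x \<in> U"
  shows "pderivative i (gam h) x = 2 * (\<Sum>k\<in>UNIV. hess h i k x * grad h k x)"
proof -
  have "pderivative i (gam h) x = (\<Sum>k\<in>UNIV. pderivative k h x * pderivative i (grad h k) x
      + pderivative i (pderivative k h) x * grad h k x)"
    unfolding gam_def[abs_def] using x h
    by (intro pderivative_smooth_sum_mult smooth_on_pderivative smooth_grad open_image)
  also have "\<dots> = (\<Sum>k\<in>UNIV. pderivative k h x * (nabla (grad h) i k x - (\<Sum>j\<in>UNIV. C k i j x * grad h j x)))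
      + (\<Sum>k\<in>UNIV. (hess h i k x + (\<Sum>a\<in>UNIV. C a i k x * pderivative a h x)) * grad h k x)"
    unfolding nabla_def hess_def by (simp add: sum.distrib)
  also have "\<dots> = (\<Sum>k\<in>UNIV. pderivative k h x * nabla (grad h) i k x) + (\<Sum>k\<in>UNIV. hess h i k x * grad h k x)
      + ((\<Sum>k\<in>UNIV. (\<Sum>a\<in>UNIV. C a i k x * pderivative a h x) * grad h k x)
        - (\<Sum>k\<in>UNIV. pderivative k h x * (\<Sum>j\<in>UNIV. C k i j x * grad h j x)))"
    by (simp add: distrib_right right_diff_distrib sum.distrib sum_subtractf)
  also have "(\<Sum>k\<in>UNIV. (\<Sum>a\<in>UNIV. C a i k x * pderivative a h x) * grad h k x)
        = (\<Sum>k\<in>UNIV. pderivative k h x * (\<Sum>j\<in>UNIV. C k i j x * grad h j x))"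
    unfolding sum_distrib_left sum_distrib_right by (subst sum.swap) (simp add: ac_simps)
  also have "(\<Sum>k\<in>UNIV. pderivative k h x * nabla (grad h) i k x) = (\<Sum>k\<in>UNIV. hess h i k x * grad h k x)"
    unfolding hess_eq_nabla[OF assms] lower_grad[OF x, symmetric] sum_distrib_left sum_distrib_right
    by (subst sum.swap) (simp add: ac_simps G_sym[OF x])
  finally show ?thesis by simp
qed

text \<open>Raising the index in \<open>pderivative_gam\<close> and using the symmetry of the
  Hessian yields the derivative of the gradient along itself, the field whose divergence
  \<open>div_nabla\<close> computes.\<close>

lemma grad_gam:
  assumes h: "smooth_on U h" and x: "x \<in> U"
  shows "grad (gam h) i x = 2 * (\<Sum>k\<in>UNIV. grad h k x * nabla (grad h) k i x)"
proof -
  have "grad (gam h) i x = 2 * (\<Sum>l\<in>UNIV. \<Sum>k\<in>UNIV. B x i l * (hess h l k x * grad h k x))"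
    unfolding grad_def[of "gam h"] pderivative_gam[OF assms]
    by (simp add: sum_distrib_left ac_simps)
  also have "\<dots> = 2 * (\<Sum>k\<in>UNIV. grad h k x * nabla (grad h) k i x)"
    unfolding nabla_eq_hess[OF assms] sum_distrib_left hess_sym[OF assms]
    by (subst sum.swap) (simp add: ac_simps hess_sym[OF assms])
  finally show ?thesis .
qed

text \<open>Commuting two covariant derivatives inside the divergence of the derivative of
  \<open>V\<close> along itself produces the curvature; contracted, the terms are the trace of the
  squared derivative, Ric(V, V) and the derivative of div V along \<open>V\<close>.\<close>

lemma div_nabla:
  assumes V: "\<And>k. smooth_on U (V k)" and x: "x \<in> U"
  shows "(\<Sum>i\<in>UNIV. nabla (\<lambda>i y. \<Sum>k\<in>UNIV. V k y * nabla V k i y) i i x)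
    = (\<Sum>i\<in>UNIV. \<Sum>j\<in>UNIV. nabla V i j x * nabla V j i x)
      + (\<Sum>j\<in>UNIV. \<Sum>k\<in>UNIV. (\<Sum>i\<in>UNIV. riemann_curvature c g i k i j x) * V j x * V k x)
      + (\<Sum>j\<in>UNIV. V j x * pderivative j (\<lambda>y. \<Sum>i\<in>UNIV. nabla V i i y) x)"
proof -
  have pn: "pderivative i (nabla V k a) x = pderivative i (pderivative k (V a)) x
      + (\<Sum>j\<in>UNIV. C a k j x * pderivative i (V j) x + pderivative i (C a k j) x * V j x)" for i k a
    unfolding nabla_def[abs_def] using V x
    by (simp add: pderivative_smooth_add pderivative_smooth_sum_mult smooth_C smooth_on_sum
        smooth_on_mult smooth_on_pderivative open_image)
  have pw: "pderivative i (\<lambda>y. \<Sum>k\<in>UNIV. V k y * nabla V k i y) x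
      = (\<Sum>k\<in>UNIV. V k x * pderivative i (nabla V k i) x + pderivative i (V k) x * nabla V k i x)" for i
    using V x by (intro pderivative_smooth_sum_mult smooth_nabla)
  have pd: "pderivative j (\<lambda>y. \<Sum>i\<in>UNIV. nabla V i i y) x = (\<Sum>i\<in>UNIV. pderivative j (nabla V i i) x)" for j
    using V x by (intro pderivative_smooth_sum smooth_nabla)
  have n: "nabla V = (\<lambda>i a y. pderivative i (V a) y + (\<Sum>k\<in>UNIV. C a i k y * V k y))"
    by (intro ext) (simp add: nabla_def)
  have nx: "nabla V i a x = pderivative i (V a) x + (\<Sum>k\<in>UNIV. C a i k x * V k x)" for i a
    by (simp add: nabla_def)
  note id = ricci_identity_sum[where v="\<lambda>k. V k x" and D="\<lambda>i k. pderivative i (V k) x"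
      and DD="\<lambda>i j k. pderivative i (pderivative j (V k)) x" and C="\<lambda>a i j. C a i j x"
      and DC="\<lambda>i a j k. pderivative i (C a j k) x",
      OF pderivative_commute[OF open_image x V] C_sym[OF x]]
  show ?thesis
    unfolding nabla_def[of "\<lambda>i y. \<Sum>k\<in>UNIV. V k y * nabla V k i y"] pw pd pn riemann_curvature_def
    using id unfolding nx .
qed

lemma bochner:
  assumes h: "smooth_on U h" and x: "x \<in> U"
  shows "lap (gam h) x = 2 * ((\<Sum>i\<in>UNIV. \<Sum>j\<in>UNIV. nabla (grad h) i j x * nabla (grad h) j i x)
      + (\<Sum>j\<in>UNIV. \<Sum>k\<in>UNIV. (\<Sum>i\<in>UNIV. riemann_curvature c g i k i j x) * grad h j x * grad h k x)
      + (\<Sum>j\<in>UNIV. grad h j x * pderivative j (lap h) x))"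
proof -
  let ?W = "\<lambda>i y. \<Sum>k\<in>UNIV. grad h k y * nabla (grad h) k i y"
  have W: "smooth_on U (?W i)" for i
    using h by (intro smooth_on_sum smooth_on_mult smooth_grad smooth_nabla open_image)
  have "nabla (grad (gam h)) i i x = 2 * nabla ?W i i x" for i
  proof -
    have "pderivative i (grad (gam h) i) x = pderivative i (\<lambda>y. 2 * ?W i y) x"
      by (rule pderivative_cong_on[OF x grad_gam[OF h]])
    also have "\<dots> = 2 * pderivative i (?W i) x"
      using pderivative_smooth_mult[OF smooth_on_const[OF open_image, of 2] W x] by (simp add: pderivative_const)
    finally show ?thesis
      unfolding nabla_def[of "grad (gam h)"] nabla_def[of ?W] grad_gam[OF assms]
      by (simp add: sum_distrib_left algebra_simps)
  qed
  then have "lap (gam h) x = 2 * (\<Sum>i\<in>UNIV. nabla ?W i i x)"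
    unfolding lap_eq_div[OF smooth_gam[OF h] x] by (simp add: sum_distrib_left)
  moreover have "pderivative j (\<lambda>y. \<Sum>i\<in>UNIV. nabla (grad h) i i y) x = pderivative j (lap h) x" for j
    by (rule pderivative_cong_on[OF x lap_eq_div[OF h, symmetric]])
  ultimately show ?thesis
    using div_nabla[of "grad h", OF smooth_grad[OF h] x] by simp
qed

text \<open>Since the equation holds on all of \<open>U\<close>, the derivative of
  \<open>lap h\<close> in Bochner's formula can be computed from minus the drift of
  \<open>h\<close>. Its Hessian part cancels the drift of \<open>gam h\<close>, and its part with
  \<open>nabla X\<close> turns the Ricci tensor into that of the diffusion operator.\<close>

lemma bochner_drift:
  fixes X :: "'n \<Rightarrow> real^'n \<Rightarrow> real"
  assumes h: "smooth_on U h" and X: "\<And>k. smooth_on U (X k)" and x: "x \<in> U"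
    and Lh: "\<And>y. y \<in> U \<Longrightarrow> lap h y + (\<Sum>k\<in>UNIV. X k y * pderivative k h y) = 0"
  shows "lap (gam h) x + (\<Sum>k\<in>UNIV. X k x * pderivative k (gam h) x)
    = 2 * ((\<Sum>i\<in>UNIV. \<Sum>j\<in>UNIV. nabla (grad h) i j x * nabla (grad h) j i x)
      + (\<Sum>j\<in>UNIV. \<Sum>k\<in>UNIV. (\<Sum>i\<in>UNIV. riemann_curvature c g i k i j x) * grad h j x * grad h k x)
      - (\<Sum>k\<in>UNIV. pderivative k h x * (\<Sum>j\<in>UNIV. grad h j x * nabla X j k x)))"
proof -
  have p1: "pderivative j (lap h) x = pderivative j (\<lambda>y. \<Sum>k\<in>UNIV. (- X k y) * pderivative k h y) x" for j
  proof (rule pderivative_cong_on[OF x, symmetric])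
    show "(\<Sum>k\<in>UNIV. (- X k y) * pderivative k h y) = lap h y" if "y \<in> U" for y
      using Lh[OF that] by (simp add: sum_negf)
  qed
  have p2: "pderivative j (\<lambda>y. \<Sum>k\<in>UNIV. (- X k y) * pderivative k h y) x
      = (\<Sum>k\<in>UNIV. (- X k x) * pderivative j (pderivative k h) x + pderivative j (\<lambda>y. - X k y) x * pderivative k h x)"
    for j
    using smooth_on_diff[OF open_image smooth_on_const[OF open_image, of 0] X] h x
    by (intro pderivative_smooth_sum_mult smooth_on_pderivative open_image) simp_all
  have p3: "pderivative j (\<lambda>y. - X k y) x = - pderivative j (X k) x" for j k
    by (rule pderivative_minus[OF differentiable_smooth[OF X x]])
  have pl: "pderivative j (lap h) x
      = - (\<Sum>k\<in>UNIV. X k x * pderivative j (pderivative k h) x + pderivative j (X k) x * pderivative k h x)" for j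
    unfolding p1 p2 p3 by (simp add: sum_subtractf sum.distrib sum_negf)
  have hs: "(\<Sum>k\<in>UNIV. X k x * pderivative j (pderivative k h) x)
      = (\<Sum>k\<in>UNIV. X k x * hess h j k x) + (\<Sum>k\<in>UNIV. pderivative k h x * (\<Sum>i\<in>UNIV. C k j i x * X i x))" for j
  proof -
    have "(\<Sum>k\<in>UNIV. X k x * pderivative j (pderivative k h) x)
      = (\<Sum>k\<in>UNIV. X k x * hess h j k x) + (\<Sum>k\<in>UNIV. X k x * (\<Sum>a\<in>UNIV. C a j k x * pderivative a h x))"
      unfolding hess_def by (simp add: right_diff_distrib sum_subtractf)
    also have "(\<Sum>k\<in>UNIV. X k x * (\<Sum>a\<in>UNIV. C a j k x * pderivative a h x))
      = (\<Sum>k\<in>UNIV. pderivative k h x * (\<Sum>i\<in>UNIV. C k j i x * X i x))"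
      unfolding sum_distrib_left by (subst sum.swap) (simp add: ac_simps)
    finally show ?thesis .
  qed
  have pl2: "pderivative j (lap h) x
      = - (\<Sum>k\<in>UNIV. X k x * hess h j k x) - (\<Sum>k\<in>UNIV. pderivative k h x * nabla X j k x)" for j
    unfolding pl sum.distrib hs nabla_def by (simp add: distrib_left sum.distrib ac_simps)
  have "(\<Sum>j\<in>UNIV. grad h j x * pderivative j (lap h) x)
      = - (\<Sum>j\<in>UNIV. \<Sum>k\<in>UNIV. grad h j x * (X k x * hess h j k x))
        - (\<Sum>j\<in>UNIV. \<Sum>k\<in>UNIV. grad h j x * (pderivative k h x * nabla X j k x))"
    unfolding pl2 by (simp add: right_diff_distrib sum_subtractf sum_negf sum_distrib_left)
  moreover have "(\<Sum>j\<in>UNIV. \<Sum>k\<in>UNIV. grad h j x * (pderivative k h x * nabla X j k x))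
      = (\<Sum>k\<in>UNIV. pderivative k h x * (\<Sum>j\<in>UNIV. grad h j x * nabla X j k x))"
    unfolding sum_distrib_left by (subst sum.swap) (simp add: ac_simps)
  moreover have "(\<Sum>k\<in>UNIV. X k x * pderivative k (gam h) x)
      = 2 * (\<Sum>j\<in>UNIV. \<Sum>k\<in>UNIV. grad h j x * (X k x * hess h j k x))"
    unfolding pderivative_gam[OF h x] sum_distrib_left
    by (subst sum.swap) (simp add: ac_simps hess_sym[OF h x])
  ultimately show ?thesis
    unfolding bochner[OF h x] by (simp add: algebra_simps)
qed

end

subsection \<open>Change of charts\<close>

lemma frechet_derivative_component:
  assumes "T differentiable (at x)"
  shows "frechet_derivative (\<lambda>y. T y $ i) (at x) v = frechet_derivative T (at x) v $ i"
proof -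
  have "((\<lambda>y. T y $ i) has_derivative (\<lambda>v. frechet_derivative T (at x) v $ i)) (at x)"
    by (rule bounded_linear.has_derivative[OF bounded_linear_vec_nth differentiable_has_derivative[OF assms]])
  then show ?thesis using frechet_derivative_at by metis
qed

lemma pderivative_compose:
  fixes T :: "real^'n \<Rightarrow> real^'m" and f :: "real^'m \<Rightarrow> real"
  assumes T: "T differentiable (at x)" and f: "f differentiable (at (T x))"
  shows "(\<lambda>y. f (T y)) differentiable (at x)"
    and "pderivative a (\<lambda>y. f (T y)) x = (\<Sum>i\<in>UNIV. pderivative a (\<lambda>y. T y $ i) x * pderivative i f (T x))"
proof -
  have D: "((\<lambda>y. f (T y)) has_derivative
      (\<lambda>v. frechet_derivative f (at (T x)) (frechet_derivative T (at x) v))) (at x)"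
    using diff_chain_at[OF differentiable_has_derivative[OF T] differentiable_has_derivative[OF f]]
    by (simp add: o_def)
  then show "(\<lambda>y. f (T y)) differentiable (at x)"
    using differentiable_def by blast
  show "pderivative a (\<lambda>y. f (T y)) x = (\<Sum>i\<in>UNIV. pderivative a (\<lambda>y. T y $ i) x * pderivative i f (T x))"
    unfolding pderivative_eqI[OF D] frechet_derivative_pderivative[OF f]
    by (simp add: pderivative_def[of a] frechet_derivative_component[OF T])
qed

text \<open>The product of \<open>matrix_inv G\<close>, \<open>transpose J\<close> and
  \<open>G'\<close> is a left inverse of the square matrix \<open>J\<close>, hence also a right
  inverse; regrouping exhibits a left inverse of \<open>G'\<close>.\<close>

lemma congruent_matrix_inv:
  fixes G G' J :: "real^'n^'n"
  assumes "invertible G" "G = transpose J ** G' ** J"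
  shows "J ** matrix_inv G ** transpose J = matrix_inv G'"
proof -
  have "(matrix_inv G ** transpose J ** G') ** J = mat 1"
    using matrix_inv_right_left(2)[OF assms(1)] assms(2) by (metis matrix_mul_assoc)
  then have "J ** (matrix_inv G ** transpose J ** G') = mat 1"
    using matrix_left_right_inverse by blast
  then have "(J ** matrix_inv G ** transpose J) ** G' = mat 1"
    by (simp add: matrix_mul_assoc)
  then show ?thesis using matrix_inv_unique by metis
qed

locale chart_change =
  c: riemannian_chart c g + c': riemannian_chart c' g
  for c c' :: "('m, 'n::finite) chart" and g :: "'m metric" +
  fixes W :: "(real^'n) set" and T :: "real^'n \<Rightarrow> real^'n"
  assumes open_W: "open W" and W_sub: "W \<subseteq> chart_image c"
    and T_image: "\<And>x. x \<in> W \<Longrightarrow> T x \<in> chart_image c'"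
    and smooth_T: "smooth_on W T"
    and metric_pullback: "\<And>x a b. x \<in> W \<Longrightarrow> metric_matrix c g x $ a $ b =
      (\<Sum>i\<in>UNIV. \<Sum>j\<in>UNIV. pderivative a (\<lambda>y. T y $ i) x * pderivative b (\<lambda>y. T y $ j) x
        * metric_matrix c' g (T x) $ i $ j)"
begin

definition J :: "'n \<Rightarrow> 'n \<Rightarrow> real^'n \<Rightarrow> real" where
  "J i a = pderivative a (\<lambda>y. T y $ i)"

lemma smooth_J: "smooth_on W (J i a)"
  unfolding J_def by (intro smooth_on_pderivative smooth_on_component open_W smooth_T)

lemma differentiable_J: "x \<in> W \<Longrightarrow> J i a differentiable (at x)"
  using smooth_on_differentiable[OF open_W smooth_J] .

lemma differentiable_T: "x \<in> W \<Longrightarrow> T differentiable (at x)"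
  using smooth_on_differentiable[OF open_W smooth_T] .

lemma pderivative_J_commute: "x \<in> W \<Longrightarrow> pderivative b (J i a) x = pderivative a (J i b) x"
  unfolding J_def by (rule pderivative_commute[OF open_W _ smooth_on_component[OF open_W smooth_T]])

lemma pderivative_pullback:
  assumes "smooth_on (chart_image c') f" "x \<in> W"
  shows "pderivative a (\<lambda>y. f (T y)) x = (\<Sum>i\<in>UNIV. J i a x * pderivative i f (T x))"
    and "(\<lambda>y. f (T y)) differentiable (at x)"
  unfolding J_def
  using pderivative_compose[OF differentiable_T c'.differentiable_smooth[OF _ T_image]] assms by blast+

lemma metric_J:
  "x \<in> W \<Longrightarrow> c.G x a b = (\<Sum>i\<in>UNIV. \<Sum>j\<in>UNIV. J i a x * J j b x * c'.G (T x) i j)"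
  unfolding J_def by (rule metric_pullback)

lemma J_B_J:
  assumes x: "x \<in> W"
  shows "(\<Sum>a\<in>UNIV. \<Sum>b\<in>UNIV. J i a x * c.B x a b * J j b x) = c'.B (T x) i j"
proof -
  define K :: "real^'n^'n" where "K = (\<chi> i a. J i a x)"
  have "(transpose K ** metric_matrix c' g (T x) ** K) $ a $ b = c.G x a b" for a b
    unfolding metric_J[OF x] matrix_matrix_mult_def transpose_def K_def
    by (simp add: sum_distrib_right, subst sum.swap, simp add: ac_simps)
  then have "metric_matrix c g x = transpose K ** metric_matrix c' g (T x) ** K"
    by (simp add: vec_eq_iff)
  then have "K ** matrix_inv (metric_matrix c g x) ** transpose K = matrix_inv (metric_matrix c' g (T x))"
    using congruent_matrix_inv c.G_invertible x W_sub by blast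
  then have "c'.B (T x) i j = (K ** matrix_inv (metric_matrix c g x) ** transpose K) $ i $ j" by simp
  also have "\<dots> = (\<Sum>b\<in>UNIV. \<Sum>a\<in>UNIV. J i a x * c.B x a b * J j b x)"
    unfolding matrix_matrix_mult_def transpose_def K_def by (simp add: sum_distrib_right)
  finally show ?thesis by (subst sum.swap) simp
qed

text \<open>The last two sums carry the second derivatives of \<open>T\<close>. The third is written
  with \<open>a\<close> and \<open>b\<close> exchanged, so that both are values of one expression,
  called \<open>E\<close> in \<open>hess_pullback\<close>.\<close>

lemma pderivative_metric:
  assumes x: "x \<in> W"
  shows "pderivative e (\<lambda>y. c.G y a b) x
    = (\<Sum>i\<in>UNIV. \<Sum>j\<in>UNIV. \<Sum>k\<in>UNIV. pderivative k (\<lambda>y. c'.G y i j) (T x) * J k e x * J i a x * J j b x)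
      + (\<Sum>i\<in>UNIV. \<Sum>j\<in>UNIV. pderivative e (J i a) x * J j b x * c'.G (T x) i j)
      + (\<Sum>i\<in>UNIV. \<Sum>j\<in>UNIV. pderivative e (J i b) x * J j a x * c'.G (T x) i j)"
proof -
  have dG: "(\<lambda>y. c'.G (T y) i j) differentiable (at x)" for i j
    by (rule pderivative_pullback(2)[OF c'.smooth_metric x])
  have dJJ: "(\<lambda>y. J i a y * J j b y) differentiable (at x)" for i j
    by (intro differentiable_mult differentiable_J x)
  have "pderivative e (\<lambda>y. c.G y a b) x
    = pderivative e (\<lambda>y. \<Sum>i\<in>UNIV. \<Sum>j\<in>UNIV. J i a y * J j b y * c'.G (T y) i j) x"
    by (rule pderivative_cong[OF open_W x metric_J])
  also have "\<dots> = (\<Sum>i\<in>UNIV. \<Sum>j\<in>UNIV. pderivative e (\<lambda>y. J i a y * J j b y * c'.G (T y) i j) x)"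
    by (subst pderivative_sum, intro differentiable_sum differentiable_mult dG differentiable_J x ballI)
      (simp_all add: pderivative_sum differentiable_mult dG differentiable_J x)
  also have "\<dots> = (\<Sum>i\<in>UNIV. \<Sum>j\<in>UNIV.
        J i a x * J j b x * (\<Sum>k\<in>UNIV. J k e x * pderivative k (\<lambda>y. c'.G y i j) (T x))
      + pderivative e (J i a) x * J j b x * c'.G (T x) i j
      + J i a x * pderivative e (J j b) x * c'.G (T x) i j)"
    unfolding pderivative_mult[OF dJJ dG] pderivative_mult[OF differentiable_J[OF x] differentiable_J[OF x]]
      pderivative_pullback(1)[OF c'.smooth_metric x]
    by (simp add: algebra_simps)
  also have "\<dots> = (\<Sum>i\<in>UNIV. \<Sum>j\<in>UNIV. \<Sum>k\<in>UNIV. pderivative k (\<lambda>y. c'.G y i j) (T x) * J k e x * J i a x * J j b x)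
      + (\<Sum>i\<in>UNIV. \<Sum>j\<in>UNIV. pderivative e (J i a) x * J j b x * c'.G (T x) i j)
      + (\<Sum>i\<in>UNIV. \<Sum>j\<in>UNIV. J i a x * pderivative e (J j b) x * c'.G (T x) i j)"
    by (simp add: sum.distrib sum_distrib_left ac_simps)
  also have "(\<Sum>i\<in>UNIV. \<Sum>j\<in>UNIV. J i a x * pderivative e (J j b) x * c'.G (T x) i j)
      = (\<Sum>i\<in>UNIV. \<Sum>j\<in>UNIV. pderivative e (J i b) x * J j a x * c'.G (T x) i j)"
    by (subst sum.swap) (simp add: c'.G_sym[OF T_image[OF x]] ac_simps)
  finally show ?thesis .
qed

end

text \<open>Moving the inverse metric from the Christoffel symbol to the gradient leaves first
  derivatives of the metric, whose transformation law is \<open>pderivative_metric\<close>.\<close>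

lemma (in riemannian_chart) christoffel_apply:
  assumes x: "x \<in> U"
  shows "(\<Sum>k\<in>UNIV. C k i j x * pderivative k h x)
    = (\<Sum>l\<in>UNIV. grad h l x * ((pderivative i (\<lambda>y. G y j l) x + pderivative j (\<lambda>y. G y i l) x
        - pderivative l (\<lambda>y. G y i j) x) / 2))"
proof -
  have "(\<Sum>k\<in>UNIV. C k i j x * pderivative k h x) = (\<Sum>l\<in>UNIV. grad h l x * (\<Sum>k\<in>UNIV. G x l k * C k i j x))"
    unfolding lower_grad[OF x, symmetric] sum_distrib_left
    by (subst sum.swap) (simp add: G_sym[OF x] ac_simps)
  then show ?thesis unfolding christoffel_lower[OF x] .
qed

context chart_change
begin

text \<open>
  The second derivatives of \<open>T\<close> enter both the second derivatives of \<open>h\<close> and the Christoffel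
  symbols, and cancel.
\<close>

lemma hess_pullback:
  assumes h': "smooth_on (chart_image c') h'" and h: "smooth_on (chart_image c) h"
    and hT: "\<And>y. y \<in> W \<Longrightarrow> h y = h' (T y)" and x: "x \<in> W"
  shows "c.hess h a b x = (\<Sum>i\<in>UNIV. \<Sum>j\<in>UNIV. J i a x * J j b x * c'.hess h' i j (T x))"
proof -
  have xU: "x \<in> chart_image c" using x W_sub by blast
  let ?g = "\<lambda>i j k. pderivative k (\<lambda>y. c'.G y i j) (T x)"
  let ?V' = "\<lambda>m. c'.grad h' m (T x)"
  have ph: "pderivative b h y = (\<Sum>i\<in>UNIV. J i b y * pderivative i h' (T y))" if "y \<in> W" for y b
  proof -
    have "pderivative b h y = pderivative b (\<lambda>y. h' (T y)) y"
      using that hT by (intro pderivative_cong[OF open_W])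
    then show ?thesis using pderivative_pullback(1)[OF h' that] by simp
  qed
  have sp: "smooth_on (chart_image c') (pderivative i h')" for i
    by (rule smooth_on_pderivative[OF c'.open_image h'])
  have pph: "pderivative a (pderivative b h) x = (\<Sum>i\<in>UNIV. pderivative a (J i b) x * pderivative i h' (T x))
      + (\<Sum>i\<in>UNIV. \<Sum>j\<in>UNIV. J i a x * J j b x * pderivative i (pderivative j h') (T x))"
  proof -
    have "pderivative a (pderivative b h) x = pderivative a (\<lambda>y. \<Sum>i\<in>UNIV. J i b y * pderivative i h' (T y)) x"
      by (rule pderivative_cong[OF open_W x ph])
    also have "\<dots> = (\<Sum>i\<in>UNIV. pderivative a (\<lambda>y. J i b y * pderivative i h' (T y)) x)"
      by (intro pderivative_sum differentiable_mult differentiable_J x pderivative_pullback(2)[OF sp])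
    also have "\<dots> = (\<Sum>i\<in>UNIV. J i b x * (\<Sum>k\<in>UNIV. J k a x * pderivative k (pderivative i h') (T x))
        + pderivative a (J i b) x * pderivative i h' (T x))"
      unfolding pderivative_mult[OF differentiable_J[OF x] pderivative_pullback(2)[OF sp x]]
        pderivative_pullback(1)[OF sp x] ..
    also have "\<dots> = (\<Sum>i\<in>UNIV. pderivative a (J i b) x * pderivative i h' (T x))
      + (\<Sum>j\<in>UNIV. \<Sum>i\<in>UNIV. J i a x * J j b x * pderivative i (pderivative j h') (T x))"
      by (simp add: sum.distrib sum_distrib_left ac_simps)
    finally show ?thesis by (subst sum.swap)
  qed
  have JV: "(\<Sum>l\<in>UNIV. c.grad h l x * J m l x) = ?V' m" for m
  proof -
    have "(\<Sum>l\<in>UNIV. c.grad h l x * J m l x)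
        = (\<Sum>l\<in>UNIV. \<Sum>b\<in>UNIV. \<Sum>i\<in>UNIV. J m l x * c.B x l b * J i b x * pderivative i h' (T x))"
      unfolding c.grad_def ph[OF x] by (simp add: sum_distrib_left sum_distrib_right ac_simps)
    also have "\<dots> = (\<Sum>i\<in>UNIV. \<Sum>l\<in>UNIV. \<Sum>b\<in>UNIV. J m l x * c.B x l b * J i b x * pderivative i h' (T x))"
      by (rule sum_rotate3)
    also have "\<dots> = ?V' m"
      unfolding c'.grad_def J_B_J[OF x, symmetric] by (simp add: sum_distrib_right)
    finally show ?thesis .
  qed
  define A where "A e a b = (\<Sum>i\<in>UNIV. \<Sum>j\<in>UNIV. \<Sum>k\<in>UNIV. ?g i j k * J k e x * J i a x * J j b x)" for e a b
  define E where "E e a b = (\<Sum>i\<in>UNIV. \<Sum>j\<in>UNIV. pderivative e (J i a) x * J j b x * c'.G (T x) i j)" for e a b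
  have AE: "pderivative e (\<lambda>y. c.G y a b) x = A e a b + E e a b + E e b a" for e a b
    unfolding A_def E_def by (rule pderivative_metric[OF x])
  \<comment> \<open>Second derivatives of \<open>T\<close> commute, so of the six \<open>E\<close>
    terms in the Christoffel combination four cancel and the two others add up to twice
    \<open>E a b l\<close>.\<close>
  have Esym: "E e a b = E a e b" for e a b
    unfolding E_def pderivative_J_commute[OF x, of e] ..
  have low: "(pderivative a (\<lambda>y. c.G y b l) x + pderivative b (\<lambda>y. c.G y a l) x - pderivative l (\<lambda>y. c.G y a b) x) / 2
      = (A a b l + A b a l - A l a b) / 2 + E a b l" for l
    unfolding AE using Esym[of b a l] Esym[of l a b] Esym[of l b a] by (simp add: field_simps)
  let ?v = "\<lambda>l. c.grad h l x"
  \<comment> \<open>Contracted with the gradient, this leftover is exactly the term with second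
    derivatives of \<open>T\<close> in \<open>pph\<close>.\<close>
  have VE: "(\<Sum>l\<in>UNIV. ?v l * E a b l) = (\<Sum>i\<in>UNIV. pderivative a (J i b) x * pderivative i h' (T x))"
  proof -
    have "(\<Sum>l\<in>UNIV. ?v l * E a b l)
      = (\<Sum>l\<in>UNIV. \<Sum>i\<in>UNIV. \<Sum>j\<in>UNIV. pderivative a (J i b) x * (c'.G (T x) i j * (?v l * J j l x)))"
      unfolding E_def by (simp add: sum_distrib_left ac_simps)
    also have "\<dots> = (\<Sum>i\<in>UNIV. \<Sum>j\<in>UNIV. \<Sum>l\<in>UNIV. pderivative a (J i b) x * (c'.G (T x) i j * (?v l * J j l x)))"
      by (rule sum_rotate3[symmetric])
    also have "\<dots> = (\<Sum>i\<in>UNIV. pderivative a (J i b) x * (\<Sum>j\<in>UNIV. c'.G (T x) i j * ?V' j))"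
      by (simp add: JV[symmetric] sum_distrib_left)
    finally show ?thesis unfolding c'.lower_grad[OF T_image[OF x]] .
  qed
  have VA1: "(\<Sum>l\<in>UNIV. ?v l * A a b l)
      = (\<Sum>i\<in>UNIV. \<Sum>j\<in>UNIV. \<Sum>l\<in>UNIV. J i a x * J j b x * (?V' l * ?g j l i))" for a b
  proof -
    have "(\<Sum>l\<in>UNIV. ?v l * A a b l)
      = (\<Sum>l\<in>UNIV. \<Sum>i\<in>UNIV. \<Sum>j\<in>UNIV. \<Sum>k\<in>UNIV. J k a x * J i b x * (?v l * J j l x * ?g i j k))"
      unfolding A_def by (simp add: sum_distrib_left ac_simps)
    also have "\<dots> = (\<Sum>i\<in>UNIV. \<Sum>j\<in>UNIV. \<Sum>k\<in>UNIV. \<Sum>l\<in>UNIV. J k a x * J i b x * (?v l * J j l x * ?g i j k))"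
      by (rule sum_rotate4[symmetric])
    also have "\<dots> = (\<Sum>i\<in>UNIV. \<Sum>j\<in>UNIV. \<Sum>k\<in>UNIV. J k a x * J i b x * (?V' j * ?g i j k))"
      unfolding JV[symmetric] by (simp add: sum_distrib_left sum_distrib_right)
    also have "\<dots> = (\<Sum>k\<in>UNIV. \<Sum>i\<in>UNIV. \<Sum>j\<in>UNIV. J k a x * J i b x * (?V' j * ?g i j k))"
      by (rule sum_rotate3)
    finally show ?thesis .
  qed
  have VA2: "(\<Sum>l\<in>UNIV. ?v l * A b a l)
      = (\<Sum>i\<in>UNIV. \<Sum>j\<in>UNIV. \<Sum>l\<in>UNIV. J i a x * J j b x * (?V' l * ?g i l j))"
    unfolding VA1 by (subst sum.swap) (simp add: ac_simps)
  have VA3: "(\<Sum>l\<in>UNIV. ?v l * A l a b)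
      = (\<Sum>i\<in>UNIV. \<Sum>j\<in>UNIV. \<Sum>l\<in>UNIV. J i a x * J j b x * (?V' l * ?g i j l))"
  proof -
    have "(\<Sum>l\<in>UNIV. ?v l * A l a b)
      = (\<Sum>l\<in>UNIV. \<Sum>i\<in>UNIV. \<Sum>j\<in>UNIV. \<Sum>k\<in>UNIV. J i a x * J j b x * (?v l * J k l x * ?g i j k))"
      unfolding A_def by (simp add: sum_distrib_left ac_simps)
    also have "\<dots> = (\<Sum>i\<in>UNIV. \<Sum>j\<in>UNIV. \<Sum>k\<in>UNIV. \<Sum>l\<in>UNIV. J i a x * J j b x * (?v l * J k l x * ?g i j k))"
      by (rule sum_rotate4[symmetric])
    also have "\<dots> = (\<Sum>i\<in>UNIV. \<Sum>j\<in>UNIV. \<Sum>k\<in>UNIV. J i a x * J j b x * (?V' k * ?g i j k))"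
      unfolding JV[symmetric] by (simp add: sum_distrib_left sum_distrib_right)
    finally show ?thesis .
  qed
  have "(\<Sum>k\<in>UNIV. c.C k a b x * pderivative k h x)
      = ((\<Sum>l\<in>UNIV. ?v l * A a b l) + (\<Sum>l\<in>UNIV. ?v l * A b a l) - (\<Sum>l\<in>UNIV. ?v l * A l a b)) / 2
        + (\<Sum>l\<in>UNIV. ?v l * E a b l)"
    unfolding c.christoffel_apply[OF xU] low
    by (simp add: distrib_left right_diff_distrib sum.distrib sum_subtractf
        sum_divide_distrib add_divide_distrib diff_divide_distrib)
  also have "\<dots> = (\<Sum>i\<in>UNIV. \<Sum>j\<in>UNIV. \<Sum>l\<in>UNIV. J i a x * J j b x * (?V' l * ((?g j l i + ?g i l j - ?g i j l) / 2)))
        + (\<Sum>i\<in>UNIV. pderivative a (J i b) x * pderivative i h' (T x))"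
    unfolding VA1[of a b] VA2 VA3 VE
    by (simp add: distrib_left right_diff_distrib sum.distrib sum_subtractf
        sum_divide_distrib add_divide_distrib diff_divide_distrib)
  also have "(\<Sum>i\<in>UNIV. \<Sum>j\<in>UNIV. \<Sum>l\<in>UNIV. J i a x * J j b x * (?V' l * ((?g j l i + ?g i l j - ?g i j l) / 2)))
      = (\<Sum>i\<in>UNIV. \<Sum>j\<in>UNIV. J i a x * J j b x * (\<Sum>k\<in>UNIV. c'.C k i j (T x) * pderivative k h' (T x)))"
    unfolding c'.christoffel_apply[OF T_image[OF x]] by (simp only: sum_distrib_left)
  finally show ?thesis
    unfolding c.hess_def c'.hess_def pph by (simp add: right_diff_distrib sum_subtractf)
qed

lemma lap_pullback:
  assumes "smooth_on (chart_image c') h'" "smooth_on (chart_image c) h"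
    and "\<And>y. y \<in> W \<Longrightarrow> h y = h' (T y)" and x: "x \<in> W"
  shows "c.lap h x = c'.lap h' (T x)"
proof -
  have hp: "c.hess h a b x = (\<Sum>i\<in>UNIV. \<Sum>j\<in>UNIV. J i a x * J j b x * c'.hess h' i j (T x))" for a b
    by (rule hess_pullback) (use assms in auto)
  have "c.lap h x = (\<Sum>a\<in>UNIV. \<Sum>b\<in>UNIV. \<Sum>i\<in>UNIV. \<Sum>j\<in>UNIV. J i a x * c.B x a b * J j b x * c'.hess h' i j (T x))"
    unfolding c.lap_def hp by (simp add: sum_distrib_left ac_simps)
  also have "\<dots> = (\<Sum>i\<in>UNIV. \<Sum>j\<in>UNIV. \<Sum>a\<in>UNIV. \<Sum>b\<in>UNIV. J i a x * c.B x a b * J j b x * c'.hess h' i j (T x))"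
    by (subst sum_rotate4, subst sum_rotate4) (rule refl)
  also have "\<dots> = c'.lap h' (T x)"
    unfolding c'.lap_def J_B_J[OF x, symmetric] by (simp add: sum_distrib_right)
  finally show ?thesis .
qed

end

subsection \<open>Globalisation\<close>

locale riemannian_atlas =
  fixes M :: "'m topology" and A :: "('m, 'n::finite) chart set" and g :: "'m metric"
  assumes manifold: "riemannian_manifold M A g"
begin

lemma smooth_mfd: "smooth_manifold M A" and metric: "riemannian_metric M A g"
  using manifold by (simp_all add: riemannian_manifold_def)

lemma chart_openin: "c \<in> A \<Longrightarrow> openin M (fst c)"
  and chart_open_image: "c \<in> A \<Longrightarrow> open (chart_image c)"
  and chart_homeo: "c \<in> A \<Longrightarrow> homeomorphic_map (subtopology M (fst c)) (top_of_set (chart_image c)) (snd c)"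
  and transition: "c \<in> A \<Longrightarrow> c' \<in> A \<Longrightarrow> smooth_on (snd c ` (fst c \<inter> fst c')) (snd c' \<circ> chart_inv c)"
  and charts_cover: "topspace M = (\<Union>c\<in>A. fst c)"
  using smooth_mfd unfolding smooth_manifold_def by blast+

lemma chart_at: "p \<in> topspace M \<Longrightarrow> chart_at A p \<in> A \<and> p \<in> fst (chart_at A p)"
  unfolding chart_at_def by (rule someI_ex) (use charts_cover in blast)

lemma chart_topspace: "c \<in> A \<Longrightarrow> p \<in> fst c \<Longrightarrow> p \<in> topspace M"
  using charts_cover by blast

lemma chart_inj: "c \<in> A \<Longrightarrow> inj_on (snd c) (fst c)"
proof -
  assume c: "c \<in> A"
  have "topspace (subtopology M (fst c)) = fst c"
    using openin_subset[OF chart_openin[OF c]] by auto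
  then show ?thesis
    using homeomorphic_imp_injective_map[OF chart_homeo[OF c]] by simp
qed

lemma chart_inv_left: "c \<in> A \<Longrightarrow> p \<in> fst c \<Longrightarrow> chart_inv c (snd c p) = p"
  unfolding chart_inv_def by (simp add: chart_inj)

lemma chart_inv_right: "x \<in> chart_image c \<Longrightarrow> snd c (chart_inv c x) = x"
  unfolding chart_inv_def chart_image_def by (simp add: f_inv_into_f)

lemma chart_inv_in: "x \<in> chart_image c \<Longrightarrow> chart_inv c x \<in> fst c"
  unfolding chart_inv_def chart_image_def by (simp add: inv_into_into)

lemma chart_image_in: "p \<in> fst c \<Longrightarrow> snd c p \<in> chart_image c"
  unfolding chart_image_def by simp

lemma overlap_open: "c \<in> A \<Longrightarrow> c' \<in> A \<Longrightarrow> open (snd c ` (fst c \<inter> fst c'))"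
proof -
  assume c: "c \<in> A" and c': "c' \<in> A"
  have "openin (subtopology M (fst c)) (fst c \<inter> fst c')"
    using chart_openin[OF c'] by (metis inf_commute openin_subtopology_Int)
  then have "openin (top_of_set (chart_image c)) (snd c ` (fst c \<inter> fst c'))"
    using homeomorphic_imp_open_map[OF chart_homeo[OF c]] by (simp add: open_map_def)
  then show ?thesis
    using openin_open_trans chart_open_image[OF c] by blast
qed

text \<open>For functions differentiable at \<open>p\<close> this is the chain rule. For all others
  both sides take the default value 0, provided that differentiability at \<open>p\<close> does not
  depend on the chart.\<close>

lemma coord_vector_change:
  assumes c: "c \<in> A" "c' \<in> A" and p: "p \<in> fst c" "p \<in> fst c'"
  shows "coord_vector c p w
    = coord_vector c' p (frechet_derivative (snd c' \<circ> chart_inv c) (at (snd c p)) w)"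
proof
  fix f :: "'m \<Rightarrow> real"
  \<comment> \<open>Stated for arbitrary charts, because it is applied in both directions: once for
    the derivative, once to carry non-differentiability over.\<close>
  have *: "(f \<circ> chart_inv c) differentiable (at (snd c p)) \<and>
      frechet_derivative (f \<circ> chart_inv c) (at (snd c p))
        = frechet_derivative (f \<circ> chart_inv c') (at (snd c' p))
          \<circ> frechet_derivative (snd c' \<circ> chart_inv c) (at (snd c p))"
    if c: "c \<in> A" "c' \<in> A" and p: "p \<in> fst c" "p \<in> fst c'"
      and d: "(f \<circ> chart_inv c') differentiable (at (snd c' p))" for c c'
  proof -
    let ?W = "snd c ` (fst c \<inter> fst c')" and ?T = "snd c' \<circ> chart_inv c"
    have x: "snd c p \<in> ?W" using p by blast
    have T: "?T differentiable (at (snd c p))"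
      using smooth_on_differentiable[OF overlap_open transition x] c by blast
    have Tx: "?T (snd c p) = snd c' p" using chart_inv_left[OF c(1) p(1)] by simp
    have d': "(f \<circ> chart_inv c') differentiable (at (?T (snd c p)))" unfolding Tx by (rule d)
    have eq: "(f \<circ> chart_inv c' \<circ> ?T) y = (f \<circ> chart_inv c) y" if "y \<in> ?W" for y
      using that by (auto simp: chart_inv_left[OF c(1)] chart_inv_left[OF c(2)])
    have D: "(f \<circ> chart_inv c' \<circ> ?T) differentiable (at (snd c p))"
      by (rule differentiable_chain_at[OF T d'])
    have "frechet_derivative (f \<circ> chart_inv c' \<circ> ?T) (at (snd c p)) = frechet_derivative (f \<circ> chart_inv c) (at (snd c p))"
      by (rule frechet_derivative_transform_within_open[OF D overlap_open[OF c] x eq])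
    moreover have "(f \<circ> chart_inv c) differentiable (at (snd c p))"
      using has_derivative_transform_within_open[OF differentiable_has_derivative[OF D] overlap_open[OF c] x eq]
        differentiable_def by blast
    ultimately show ?thesis
      using frechet_derivative_compose[OF T d', unfolded Tx] by metis
  qed
  show "coord_vector c p w f
    = coord_vector c' p (frechet_derivative (snd c' \<circ> chart_inv c) (at (snd c p)) w) f"
  proof (cases "(f \<circ> chart_inv c') differentiable (at (snd c' p))")
    case True
    show ?thesis
      unfolding coord_vector_def using *[OF c p True] True by (metis comp_apply)
  next
    case False
    then have "\<not> (f \<circ> chart_inv c) differentiable (at (snd c p))"
      using *[OF c(2,1) p(2,1)] by blast
    with False show ?thesis unfolding coord_vector_def by presburger
  qed
qed

lemma components_coord_vector:
  assumes c: "c \<in> A" and p: "p \<in> fst c"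
  shows "components c (coord_vector c p w) = w"
proof -
  have "((\<lambda>q. snd c q $ k) \<circ> chart_inv c has_derivative (\<lambda>v. v $ k)) (at (snd c p))" for k
  proof (rule has_derivative_transform_within_open[OF _ chart_open_image[OF c] chart_image_in[OF p]])
    show "((\<lambda>y. y $ k) has_derivative (\<lambda>v. v $ k)) (at (snd c p))"
      by (rule bounded_linear_imp_has_derivative[OF bounded_linear_vec_nth])
    show "y $ k = ((\<lambda>q. snd c q $ k) \<circ> chart_inv c) y" if "y \<in> chart_image c" for y
      using chart_inv_right[OF that] by simp
  qed
  then have "coord_vector c p w (\<lambda>q. snd c q $ k) = w $ k" for k
    unfolding coord_vector_def using frechet_derivative_at differentiable_def by metis
  then show ?thesis by (simp add: components_def vec_eq_iff)
qed

lemma tangent_space_coord: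
  assumes c: "c \<in> A" and p: "p \<in> fst c" and v: "v \<in> tangent_space A p"
  shows "v = coord_vector c p (components c v)"
proof -
  obtain c' w where "v = coord_vector c' p w" "c' \<in> A" "p \<in> fst c'"
    using v unfolding tangent_space_def by blast
  then have "\<exists>u. v = coord_vector c p u" using coord_vector_change c p by blast
  then show ?thesis using components_coord_vector[OF c p] by auto
qed

lemma coord_vector_tangent: "c \<in> A \<Longrightarrow> p \<in> fst c \<Longrightarrow> coord_vector c p w \<in> tangent_space A p"
  unfolding tangent_space_def by blast

lemma metric_coord:
  assumes c: "c \<in> A" and p: "p \<in> fst c"
  shows "g p (coord_vector c p u) (coord_vector c p v)
    = (\<Sum>i\<in>UNIV. \<Sum>j\<in>UNIV. u $ i * v $ j * metric_matrix c g (snd c p) $ i $ j)"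
proof -
  let ?b = "\<lambda>u v. g p (coord_vector c p u) (coord_vector c p v)"
  have b: "bilinear ?b"
    using metric c p unfolding riemannian_metric_def by blast
  have "?b u v = (\<Sum>i\<in>UNIV. u $ i * ?b (axis i 1) v)"
    using b linear_sum_axis[of "\<lambda>u. ?b u v"] unfolding bilinear_def by blast
  also have "\<dots> = (\<Sum>i\<in>UNIV. u $ i * (\<Sum>j\<in>UNIV. v $ j * ?b (axis i 1) (axis j 1)))"
    using b linear_sum_axis[of "\<lambda>v. ?b (axis _ 1) v" v] unfolding bilinear_def
    by (intro sum.cong refl arg_cong2[where f="(*)"]) blast
  finally show ?thesis
    unfolding metric_matrix_def by (simp add: chart_inv_left[OF c p] sum_distrib_left ac_simps)
qed

lemma metric_coord_inner:
  assumes "c \<in> A" "p \<in> fst c"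
  shows "g p (coord_vector c p u) (coord_vector c p v) = u \<bullet> (metric_matrix c g (snd c p) *v v)"
  unfolding metric_coord[OF assms]
  by (simp add: inner_vec_def matrix_vector_mult_def sum_distrib_left ac_simps)

lemma riemannian_chart: 
  assumes c: "c \<in> A"
  shows "riemannian_chart c g"
proof
  show "open (chart_image c)" by (rule chart_open_image[OF c])
  show "smooth_on (chart_image c) (\<lambda>x. metric_matrix c g x $ i $ j)" for i j
    using metric c unfolding riemannian_metric_def metric_matrix_def by simp
  fix x assume x: "x \<in> chart_image c"
  note p = chart_inv_in[OF x] and r = chart_inv_right[OF x]
  have "metric_matrix c g x $ j $ i = metric_matrix c g x $ i $ j" for i j
    using metric coord_vector_tangent[OF c p] chart_topspace[OF c p]
    unfolding riemannian_metric_def metric_matrix_def by simp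
  then show "transpose (metric_matrix c g x) = metric_matrix c g x"
    by (simp add: transpose_def vec_eq_iff)
  show "v \<bullet> (metric_matrix c g x *v v) > 0" if "v \<noteq> 0" for v
    using metric c p that metric_coord_inner[OF c p, of v v]
    unfolding riemannian_metric_def r by metis
qed

lemma chart_change:
  assumes c: "c \<in> A" "c' \<in> A"
  shows "chart_change c c' g (snd c ` (fst c \<inter> fst c')) (snd c' \<circ> chart_inv c)"
proof -
  let ?W = "snd c ` (fst c \<inter> fst c')" and ?T = "snd c' \<circ> chart_inv c"
  interpret c: riemannian_chart c g by (rule riemannian_chart[OF c(1)])
  interpret c': riemannian_chart c' g by (rule riemannian_chart[OF c(2)])
  have W: "open ?W" "smooth_on ?W ?T" using overlap_open transition c by blast+
  show ?thesis
  proof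
    show "open ?W" "smooth_on ?W ?T" by fact+
    show "?W \<subseteq> chart_image c" unfolding chart_image_def by blast
    fix x assume x: "x \<in> ?W"
    then obtain p where p: "p \<in> fst c" "p \<in> fst c'" and xp: "x = snd c p" by blast
    have Tx: "?T x = snd c' p" using chart_inv_left[OF c(1) p(1)] xp by simp
    show "?T x \<in> chart_image c'" unfolding Tx by (rule chart_image_in[OF p(2)])
    have T: "?T differentiable (at x)" by (rule smooth_on_differentiable[OF W x])
    have comp: "frechet_derivative ?T (at x) (axis a 1) $ i = pderivative a (\<lambda>y. ?T y $ i) x" for a i
      unfolding pderivative_def frechet_derivative_component[OF T] ..
    show "metric_matrix c g x $ a $ b = (\<Sum>i\<in>UNIV. \<Sum>j\<in>UNIV. pderivative a (\<lambda>y. ?T y $ i) x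
        * pderivative b (\<lambda>y. ?T y $ j) x * metric_matrix c' g (?T x) $ i $ j)" for a b
    proof -
      have "metric_matrix c g x $ a $ b = g p (coord_vector c p (axis a 1)) (coord_vector c p (axis b 1))"
        unfolding metric_matrix_def xp by (simp add: chart_inv_left[OF c(1) p(1)])
      also have "\<dots> = (\<Sum>i\<in>UNIV. \<Sum>j\<in>UNIV. frechet_derivative ?T (at x) (axis a 1) $ i
          * frechet_derivative ?T (at x) (axis b 1) $ j * metric_matrix c' g (snd c' p) $ i $ j)"
        unfolding coord_vector_change[OF c p] metric_coord[OF c(2) p(2)] xp ..
      finally show ?thesis unfolding comp Tx .
    qed
  qed
qed

lemma smooth_fun_chart: "smooth_fun A f \<Longrightarrow> c \<in> A \<Longrightarrow> smooth_on (chart_image c) (f \<circ> chart_inv c)"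
  by (simp add: smooth_fun_def)

lemma smooth_fun_mult: "smooth_fun A f \<Longrightarrow> smooth_fun A h \<Longrightarrow> smooth_fun A (\<lambda>q. f q * h q)"
  unfolding smooth_fun_def o_def using smooth_on_mult chart_open_image by blast

text \<open>In the chosen chart this is the definition and holds for arbitrary \<open>f\<close>; it
  is applied to the composite with \<open>\<Phi>\<close>, while
  \<open>laplace_beltrami_chart\<close> serves smooth functions in every chart.\<close>

lemma laplace_beltrami_chart_at:
  assumes "p \<in> topspace M"
  shows "laplace_beltrami A g f p
    = riemannian_chart.lap (chart_at A p) g (f \<circ> chart_inv (chart_at A p)) (snd (chart_at A p) p)"
proof -
  interpret riemannian_chart "chart_at A p" g using riemannian_chart chart_at[OF assms] by blast
  show ?thesis unfolding laplace_beltrami_def lap_def hess_def by (simp add: Let_def)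
qed

lemma laplace_beltrami_chart:
  assumes f: "smooth_fun A f" and c: "c \<in> A" and p: "p \<in> fst c"
  shows "laplace_beltrami A g f p = riemannian_chart.lap c g (f \<circ> chart_inv c) (snd c p)"
proof -
  let ?c = "chart_at A p"
  have p': "p \<in> topspace M" by (rule chart_topspace[OF c p])
  note c' = chart_at[OF p']
  interpret chart_change ?c c g "snd ?c ` (fst ?c \<inter> fst c)" "snd c \<circ> chart_inv ?c"
    using chart_change c c' by blast
  have "c.lap (f \<circ> chart_inv ?c) (snd ?c p) = c'.lap (f \<circ> chart_inv c) ((snd c \<circ> chart_inv ?c) (snd ?c p))"
  proof (rule lap_pullback)
    show "smooth_on (chart_image c) (f \<circ> chart_inv c)" "smooth_on (chart_image ?c) (f \<circ> chart_inv ?c)"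
      using f c c' by (auto intro: smooth_fun_chart)
    show "(f \<circ> chart_inv ?c) y = (f \<circ> chart_inv c) ((snd c \<circ> chart_inv ?c) y)"
      if "y \<in> snd ?c ` (fst ?c \<inter> fst c)" for y
      using that by (auto simp: chart_inv_left[OF c] chart_inv_left[OF conjunct1[OF c']])
    show "snd ?c p \<in> snd ?c ` (fst ?c \<inter> fst c)" using p c' by blast
  qed
  then show ?thesis
    unfolding laplace_beltrami_chart_at[OF p'] using chart_inv_left c' by simp
qed

lemma vector_apply:
  assumes c: "c \<in> A" and p: "p \<in> fst c" and v: "v \<in> tangent_space A p"
    and f: "(f \<circ> chart_inv c) differentiable (at (snd c p))"
  shows "v f = (\<Sum>k\<in>UNIV. components c v $ k * pderivative k (f \<circ> chart_inv c) (snd c p))"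
  by (subst tangent_space_coord[OF c p v]) (simp add: coord_vector_def f frechet_derivative_pderivative[OF f])

end

section \<open>Second-order product and chain rules in a chart\<close>

context riemannian_chart
begin

lemma grad_contract:
  assumes x: "x \<in> U"
  shows "(\<Sum>i\<in>UNIV. \<Sum>j\<in>UNIV. B x i j * (pderivative i h x * w j)) = (\<Sum>j\<in>UNIV. grad h j x * w j)"
  unfolding grad_def sum_distrib_right by (subst sum.swap) (simp add: B_sym[OF x] ac_simps)

lemma gam_eq:
  assumes x: "x \<in> U"
  shows "gam h x = (\<Sum>i\<in>UNIV. \<Sum>j\<in>UNIV. B x i j * (pderivative i h x * pderivative j h x))"
  unfolding grad_contract[OF x] gam_def by (simp add: mult.commute)

lemma lap_square:
  assumes h: "smooth_on U h" and x: "x \<in> U"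
  shows "lap (\<lambda>y. h y * h y) x = 2 * h x * lap h x + 2 * gam h x"
proof -
  have p1: "pderivative j (\<lambda>y. h y * h y) y = 2 * h y * pderivative j h y" if "y \<in> U" for j y
    using pderivative_smooth_mult[OF h h that] by simp
  have "pderivative i (pderivative j (\<lambda>y. h y * h y)) x = pderivative i (\<lambda>y. 2 * h y * pderivative j h y) x" for i j
    by (rule pderivative_cong_on[OF x p1])
  moreover have "pderivative i (\<lambda>y. 2 * h y * pderivative j h y) x
      = 2 * h x * pderivative i (pderivative j h) x + 2 * (pderivative i h x * pderivative j h x)" for i j
    using h x by (simp add: pderivative_smooth_mult smooth_on_mult smooth_on_const smooth_on_pderivative
        open_image pderivative_const)
  ultimately have "hess (\<lambda>y. h y * h y) i j x = 2 * h x * hess h i j x + 2 * (pderivative i h x * pderivative j h x)" for i j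
    unfolding hess_def p1[OF x] by (simp add: right_diff_distrib sum_distrib_left ac_simps)
  then show ?thesis
    unfolding lap_def gam_eq[OF x] by (simp add: distrib_left sum.distrib sum_distrib_left ac_simps)
qed

text \<open>As the pair maps the open set \<open>U\<close> into \<open>S\<close>, a derivative
  within \<open>S\<close> is enough for an ordinary derivative of the composite, even where the
  image point lies on the boundary of \<open>S\<close>. The partials appear by linearity of that
  derivative.\<close>

lemma pderivative_pair:
  fixes \<Psi> :: "real \<times> real \<Rightarrow> real"
  assumes S: "(\<lambda>y. (h y, w y)) ` U \<subseteq> S" and \<Psi>: "\<Psi> differentiable_on S"
    and h: "smooth_on U h" and w: "smooth_on U w" and x: "x \<in> U"
  shows "(\<lambda>y. \<Psi> (h y, w y)) differentiable (at x)"
    and "pderivative j (\<lambda>y. \<Psi> (h y, w y)) x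
      = partial1 S \<Psi> (h x, w x) * pderivative j h x + partial2 S \<Psi> (h x, w x) * pderivative j w x"
proof -
  let ?D = "frechet_derivative \<Psi> (at (h x, w x) within S)"
  have D: "(\<Psi> has_derivative ?D) (at (h x, w x) within S)"
    using \<Psi> S x by (auto simp: differentiable_on_def frechet_derivative_works)
  have hw: "((\<lambda>y. (h y, w y)) has_derivative
      (\<lambda>v. (frechet_derivative h (at x) v, frechet_derivative w (at x) v))) (at x within U)"
    by (rule has_derivative_at_withinI[OF has_derivative_Pair[OF
          smooth_on_has_derivative[OF open_image h x] smooth_on_has_derivative[OF open_image w x]]])
  have "((\<lambda>y. \<Psi> (h y, w y)) has_derivative
      (\<lambda>v. ?D (frechet_derivative h (at x) v, frechet_derivative w (at x) v))) (at x within U)"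
    by (rule has_derivative_in_compose[OF hw has_derivative_subset[OF D S]])
  then have T: "((\<lambda>y. \<Psi> (h y, w y)) has_derivative
      (\<lambda>v. ?D (frechet_derivative h (at x) v, frechet_derivative w (at x) v))) (at x)"
    by (simp only: at_within_open[OF x open_image])
  then show "(\<lambda>y. \<Psi> (h y, w y)) differentiable (at x)"
    using differentiable_def by blast
  have lin: "?D (a, b) = ?D (1, 0) * a + ?D (0, 1) * b" for a b
  proof -
    have l: "linear ?D" by (rule has_derivative_linear[OF D])
    have "?D (a *\<^sub>R (1, 0) + b *\<^sub>R (0, 1)) = a *\<^sub>R ?D (1, 0) + b *\<^sub>R ?D (0, 1)"
      by (simp only: linear_add[OF l] linear_cmul[OF l])
    then show ?thesis by (simp add: mult.commute)
  qed
  show "pderivative j (\<lambda>y. \<Psi> (h y, w y)) x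
      = partial1 S \<Psi> (h x, w x) * pderivative j h x + partial2 S \<Psi> (h x, w x) * pderivative j w x"
    unfolding pderivative_eqI[OF T] partial1_def partial2_def
    using lin[of "frechet_derivative h (at x) (axis j 1)" "frechet_derivative w (at x) (axis j 1)"]
    by (simp add: pderivative_def)
qed

text \<open>The two mixed partials stay separate, since their equality is only available at interior
  points of \<open>S\<close>. Differentiability of \<open>N\<close> is recorded because tangent
  vectors are set to 0 on non-differentiable functions.\<close>

lemma lap_compose:
  fixes \<Phi> :: "real \<times> real \<Rightarrow> real" and X :: "'n \<Rightarrow> real^'n \<Rightarrow> real"
  assumes S: "(\<lambda>y. (h y, w y)) ` U \<subseteq> S" and \<Phi>: "smooth_on S \<Phi>"
    and h: "smooth_on U h" and w: "smooth_on U w" and x: "x \<in> U"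
  defines "N \<equiv> \<lambda>y. \<Phi> (h y, w y)" and "u \<equiv> (h x, w x)"
  shows "N differentiable (at x)"
    and "lap N x + (\<Sum>k\<in>UNIV. X k x * pderivative k N x)
    = partial1 S \<Phi> u * (lap h x + (\<Sum>k\<in>UNIV. X k x * pderivative k h x))
      + partial2 S \<Phi> u * (lap w x + (\<Sum>k\<in>UNIV. X k x * pderivative k w x))
      + partial1 S (partial1 S \<Phi>) u * gam h x
      + (partial2 S (partial1 S \<Phi>) u + partial1 S (partial2 S \<Phi>) u) * (\<Sum>j\<in>UNIV. grad h j x * pderivative j w x)
      + partial2 S (partial2 S \<Phi>) u * gam w x"
proof -
  have d0: "\<Phi> differentiable_on S" and d1: "partial1 S \<Phi> differentiable_on S" and d2: "partial2 S \<Phi> differentiable_on S"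
  proof -
    have "Ck_on (Suc (Suc 0)) S \<Phi>" using \<Phi> unfolding smooth_on_def by blast
    then show "\<Phi> differentiable_on S" "partial1 S \<Phi> differentiable_on S" "partial2 S \<Phi> differentiable_on S"
      unfolding partial1_def[abs_def] partial2_def[abs_def] by simp_all
  qed
  note pp = pderivative_pair[OF S _ h w]
  show dN: "N differentiable (at x)" unfolding N_def by (rule pp(1)[OF d0 x])
  have pN: "pderivative j N y = partial1 S \<Phi> (h y, w y) * pderivative j h y + partial2 S \<Phi> (h y, w y) * pderivative j w y"
    if "y \<in> U" for j y
    unfolding N_def by (rule pp(2)[OF d0 that])
  define P1 P2 where "P1 y = partial1 S \<Phi> (h y, w y)" and "P2 y = partial2 S \<Phi> (h y, w y)" for y
  have dP: "P1 differentiable (at x)" "P2 differentiable (at x)"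
    unfolding P1_def P2_def using pp(1)[OF d1 x] pp(1)[OF d2 x] by blast+
  have dh: "pderivative j h differentiable (at x)" and dw: "pderivative j w differentiable (at x)" for j
    using h w x by (auto intro!: differentiable_smooth smooth_on_pderivative open_image)
  have pp1: "pderivative i P1 x = partial1 S (partial1 S \<Phi>) u * pderivative i h x + partial2 S (partial1 S \<Phi>) u * pderivative i w x"
    and pp2: "pderivative i P2 x = partial1 S (partial2 S \<Phi>) u * pderivative i h x + partial2 S (partial2 S \<Phi>) u * pderivative i w x" for i
    unfolding P1_def P2_def u_def using pp(2)[OF d1 x] pp(2)[OF d2 x] by blast+
  have ppN: "pderivative i (pderivative j N) x = P1 x * pderivative i (pderivative j h) x + pderivative i P1 x * pderivative j h x
      + (P2 x * pderivative i (pderivative j w) x + pderivative i P2 x * pderivative j w x)" for i j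
  proof -
    have "pderivative i (\<lambda>y. P1 y * pderivative j h y + P2 y * pderivative j w y) x = pderivative i (pderivative j N) x"
      by (rule pderivative_cong[OF open_image x]) (simp add: pN[folded P1_def P2_def])
    then show ?thesis
      using dP dh dw by (simp add: pderivative_add pderivative_mult differentiable_mult)
  qed
  have hN: "hess N i j x = P1 x * hess h i j x + P2 x * hess w i j x
      + partial1 S (partial1 S \<Phi>) u * (pderivative i h x * pderivative j h x)
      + partial2 S (partial1 S \<Phi>) u * (pderivative j h x * pderivative i w x)
      + partial1 S (partial2 S \<Phi>) u * (pderivative i h x * pderivative j w x)
      + partial2 S (partial2 S \<Phi>) u * (pderivative i w x * pderivative j w x)" for i j
    unfolding hess_def ppN pp1 pp2 pN[OF x] P1_def[symmetric] P2_def[symmetric]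
    by (simp add: algebra_simps sum.distrib sum_distrib_left)
  have sw: "(\<Sum>i\<in>UNIV. \<Sum>j\<in>UNIV. B x i j * (pderivative j h x * pderivative i w x))
      = (\<Sum>j\<in>UNIV. grad h j x * pderivative j w x)"
    unfolding grad_contract[OF x, symmetric] by (subst sum.swap) (simp add: B_sym[OF x])
  have pull: "(\<Sum>i\<in>UNIV. \<Sum>j\<in>UNIV. B x i j * (k * q i j)) = k * (\<Sum>i\<in>UNIV. \<Sum>j\<in>UNIV. B x i j * q i j)" for k q
    by (simp add: sum_distrib_left ac_simps)
  have "lap N x = P1 x * lap h x + P2 x * lap w x + partial1 S (partial1 S \<Phi>) u * gam h x
      + (partial2 S (partial1 S \<Phi>) u + partial1 S (partial2 S \<Phi>) u) * (\<Sum>j\<in>UNIV. grad h j x * pderivative j w x)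
      + partial2 S (partial2 S \<Phi>) u * gam w x"
    unfolding lap_def hN distrib_left[of "B x _ _"] sum.distrib pull sw grad_contract[OF x, of h]
      gam_eq[OF x]
    by (simp add: algebra_simps)
  moreover have "(\<Sum>k\<in>UNIV. X k x * pderivative k N x)
      = P1 x * (\<Sum>k\<in>UNIV. X k x * pderivative k h x) + P2 x * (\<Sum>k\<in>UNIV. X k x * pderivative k w x)"
    unfolding pN[OF x] P1_def[symmetric] P2_def[symmetric] by (simp add: distrib_left sum.distrib sum_distrib_left ac_simps)
  ultimately show "lap N x + (\<Sum>k\<in>UNIV. X k x * pderivative k N x)
    = partial1 S \<Phi> u * (lap h x + (\<Sum>k\<in>UNIV. X k x * pderivative k h x))
      + partial2 S \<Phi> u * (lap w x + (\<Sum>k\<in>UNIV. X k x * pderivative k w x))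
      + partial1 S (partial1 S \<Phi>) u * gam h x
      + (partial2 S (partial1 S \<Phi>) u + partial1 S (partial2 S \<Phi>) u) * (\<Sum>j\<in>UNIV. grad h j x * pderivative j w x)
      + partial2 S (partial2 S \<Phi>) u * gam w x"
    unfolding P1_def P2_def u_def by (simp add: algebra_simps)
qed

end

lemma partial_commute:
  fixes \<Phi> :: "real \<times> real \<Rightarrow> real"
  assumes \<Phi>: "smooth_on S \<Phi>" and T: "open T" "T \<subseteq> S" and u: "u \<in> T"
  shows "partial2 S (partial1 S \<Phi>) u = partial1 S (partial2 S \<Phi>) u"
proof -
  have at: "at x within S = at x" if "x \<in> T" for x
    using that T by (rule at_within_open_subset)
  have sT: "smooth_on T \<Phi>" by (rule smooth_on_subset[OF T \<Phi>])
  have "frechet_derivative (\<lambda>y. frechet_derivative \<Phi> (at y within S) a) (at u within S)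
      = frechet_derivative (\<lambda>y. frechet_derivative \<Phi> (at y) a) (at u)" for a
    unfolding at[OF u]
    by (rule frechet_derivative_local[OF T(1) u]) (simp add: at)
  then show ?thesis
    unfolding partial1_def[abs_def] partial2_def[abs_def]
    using frechet_derivative_commute[OF T(1) u sT] by simp
qed

lemma (in riemannian_chart) lap_local:
  assumes x: "x \<in> U" and eq: "\<And>y. y \<in> U \<Longrightarrow> f y = k y"
  shows "lap f x = lap k x"
proof -
  have "pderivative i f y = pderivative i k y" if "y \<in> U" for i y
    by (rule pderivative_cong[OF open_image that eq])
  then have "hess f i j x = hess k i j x" for i j
    unfolding hess_def using x pderivative_cong[OF open_image x, of "pderivative j f" "pderivative j k" i] by simp
  then show ?thesis unfolding lap_def by simp
qed

section \<open>The diffusion operator, its carre du champ and its Ricci tensor in a chart\<close>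

context riemannian_atlas
begin

lemma diffusion_operator_chart:
  assumes f: "smooth_fun A f" and c: "c \<in> A" and p: "p \<in> fst c" and Xp: "X p \<in> tangent_space A p"
  shows "diffusion_operator A g X f p = riemannian_chart.lap c g (f \<circ> chart_inv c) (snd c p)
    + (\<Sum>k\<in>UNIV. components c (X p) $ k * pderivative k (f \<circ> chart_inv c) (snd c p))"
proof -
  have "(f \<circ> chart_inv c) differentiable (at (snd c p))"
    using smooth_on_differentiable[OF chart_open_image[OF c] smooth_fun_chart[OF f c] chart_image_in[OF p]] .
  then show ?thesis
    unfolding diffusion_operator_def laplace_beltrami_chart[OF f c p] by (simp add: vector_apply[OF c p Xp])
qed

text \<open>The drift is a derivation and cancels; \<open>lap_square\<close> leaves the squared
  gradient. The chart is arbitrary, so one chart describes the carre du champ at all points near a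
  given one.\<close>

lemma carre_du_champ_chart:
  assumes f: "smooth_fun A f" and c: "c \<in> A" and p: "p \<in> fst c" and Xp: "X p \<in> tangent_space A p"
  shows "carre_du_champ (diffusion_operator A g X) f f p = riemannian_chart.gam c g (f \<circ> chart_inv c) (snd c p)"
proof -
  interpret riemannian_chart c g by (rule riemannian_chart[OF c])
  let ?h = "f \<circ> chart_inv c" and ?x = "snd c p"
  have h: "smooth_on U ?h" by (rule smooth_fun_chart[OF f c])
  have x: "?x \<in> U" by (rule chart_image_in[OF p])
  have hp: "?h ?x = f p" using chart_inv_left[OF c p] by simp
  have sq: "(\<lambda>q. f q * f q) \<circ> chart_inv c = (\<lambda>y. ?h y * ?h y)" by (simp add: o_def)
  have "diffusion_operator A g X (\<lambda>q. f q * f q) p = 2 * f p * lap ?h ?x + 2 * gam ?h ?x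
      + 2 * f p * (\<Sum>k\<in>UNIV. components c (X p) $ k * pderivative k ?h ?x)"
    unfolding diffusion_operator_chart[where X=X, OF smooth_fun_mult[OF f f] c p Xp] sq lap_square[OF h x] hp
      pderivative_smooth_mult[OF h h x]
    by (simp add: sum_distrib_left algebra_simps)
  then show ?thesis
    unfolding carre_du_champ_def diffusion_operator_chart[where X=X, OF f c p Xp] by (simp add: algebra_simps)
qed

text \<open>Restricted to the chosen chart at \<open>p\<close>, in which both tensors are defined.
  On the diagonal the symmetrisation disappears by the symmetry of the metric.\<close>

lemma ricci_diffusion_chart:
  assumes p: "p \<in> topspace M" and Xp: "X p \<in> tangent_space A p"
  defines "c \<equiv> chart_at A p"
  defines "x \<equiv> snd c p"
  shows "ricci_diffusion A g X p (coord_vector c p v) (coord_vector c p v)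
    = (\<Sum>j\<in>UNIV. \<Sum>k\<in>UNIV. (\<Sum>i\<in>UNIV. riemann_curvature c g i k i j x) * v $ j * v $ k)
      - (\<Sum>k\<in>UNIV. (metric_matrix c g x *v v) $ k *
          (\<Sum>j\<in>UNIV. v $ j * riemannian_chart.nabla c g (\<lambda>k y. components c (X (chart_inv c y)) $ k) j k x))"
proof -
  have c: "c \<in> A" "p \<in> fst c" using chart_at[OF p] by (auto simp: c_def)
  interpret riemannian_chart c g by (rule riemannian_chart[OF c(1)])
  let ?v = "coord_vector c p v"
  let ?D = "covariant_derivative A g X p ?v"
  have D: "?D = coord_vector c p (\<chi> k. \<Sum>j\<in>UNIV. v $ j * nabla (\<lambda>k y. components c (X (chart_inv c y)) $ k) j k x)"
    unfolding covariant_derivative_def Let_def c_def[symmetric] x_def[symmetric] components_coord_vector[OF c] nabla_def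
    by (simp add: x_def chart_inv_left[OF c])
  have "g p ?v ?D = g p ?D ?v"
    using metric p coord_vector_tangent[OF c] unfolding D riemannian_metric_def by blast
  then have "sym_nabla A g X p ?v ?v = g p ?D ?v"
    unfolding sym_nabla_def by simp
  then show ?thesis
    unfolding ricci_diffusion_def ricci_def Let_def c_def[symmetric] x_def[symmetric] components_coord_vector[OF c]
      D metric_coord_inner[OF c]
    by (simp add: inner_vec_def mult.commute)
qed

end

text \<open>For n < 0 or n > d the factor (n - d) / n is positive, so the \<open>TCD\<close>
  inequality can be solved for the curvature with the same outcome; at n = 0 the separate clause
  gives it after division by -d, and a quasi-model gives equality.\<close>

lemma curvature_lower_bound:
  fixes A :: "('m, 'n::finite) chart set"
  assumes "(TCD M A g X \<rho> n \<and> n \<notin> {0<..real CARD('n)}) \<or> quasi_model M A g X \<rho> n"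
    and "n \<noteq> real CARD('n)" and "p \<in> topspace M" and "v \<in> tangent_space A p"
  shows "ricci_diffusion A g X p v v \<ge> \<rho> * g p v v + (g p (X p) v)\<^sup>2 / (n - real CARD('n))"
proof -
  define d where "d = real CARD('n)"
  have d: "d > 0" unfolding d_def by simp
  have nd: "n \<noteq> d" using assms(2) by (simp add: d_def)
  define R s where "R = ricci_diffusion A g X p v v - \<rho> * g p v v" and "s = (g p (X p) v)\<^sup>2"
  have "R \<ge> s / (n - d)"
    using assms(1)
  proof
    assume "quasi_model M A g X \<rho> n"
    then have "(n - d) * R = s"
      using assms(3,4) unfolding quasi_model_def Let_def d_def R_def s_def by blast
    then have "R = s / (n - d)" using nd by (simp add: nonzero_eq_divide_eq mult.commute)
    then show ?thesis by simp
  next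
    assume T: "TCD M A g X \<rho> n \<and> n \<notin> {0<..real CARD('n)}"
    then have T1: "if n \<noteq> 0 then (n - d) / n * R \<ge> s / n else - d * R \<le> s"
      using assms(3,4) unfolding TCD_def Let_def d_def R_def s_def by blast
    consider "n = 0" | "n < 0" | "n > d" using T by (fastforce simp: d_def)
    then show ?thesis
    proof cases
      case 1
      then show ?thesis using T1 d by (simp add: field_simps)
    next
      case 2
      then have "(n - d) * R \<le> s" using T1 by (simp add: field_simps)
      then show ?thesis using 2 d by (simp add: field_simps)
    next
      case 3
      then have "(n - d) * R \<ge> s" using T1 d by (simp add: field_simps)
      then show ?thesis using 3 by (simp add: field_simps)
    qed
  qed
  then show ?thesis unfolding R_def s_def d_def by linarith
qed

theorem theorem4:
  fixes M :: "'m topology"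
    and A :: "('m, 'n::finite) chart set"
    and g :: "'m metric"
    and X :: "'m \<Rightarrow> 'm tangent_vector"
    and \<rho> n d :: real
    and I :: "real set"
    and \<Phi> :: "real \<times> real \<Rightarrow> real"
  defines "d \<equiv> real CARD('n)"
    and "L \<equiv> diffusion_operator A g X"
  assumes "riemannian_manifold M A g"
    and "connected_space M"
    and "smooth_vector_field M A X"
    and "n \<noteq> d"
    and "(TCD M A g X \<rho> n \<and> n \<notin> {0<..d}) \<or> quasi_model M A g X \<rho> n"
    and "open I" and "is_interval I"
    and "smooth_on (I \<times> {0..}) \<Phi>"
    and "\<forall>y\<in>I. \<forall>z\<ge>0.
      let S = I \<times> {0..};
          \<Phi>2 = partial2 S \<Phi> (y, z);
          \<Phi>11 = partial1 S (partial1 S \<Phi>) (y, z);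
          \<Phi>12 = partial2 S (partial1 S \<Phi>) (y, z);
          \<Phi>22 = partial2 S (partial2 S \<Phi>) (y, z)
      in (\<Phi>2 > 0
          \<and> \<Phi>2 * ((n + 1 - d) / (n - d)) + 2 * z * \<Phi>22 > 0
          \<and> (n - d) * (n * \<Phi>2 + 2 * (n - 1) * z * \<Phi>22) > 0
          \<and> 2 * \<rho> * \<Phi>2 + \<Phi>11
              - 2 * (n - 1) * (z * \<Phi>12\<^sup>2 / (n * \<Phi>2 + 2 * (n - 1) * z * \<Phi>22)) \<ge> 0)
       \<or> (\<Phi>2 = 0 \<and> z * \<Phi>22 = 0 \<and> z * \<Phi>12 = 0 \<and> z * \<Phi>11 \<ge> 0)
       \<or> (\<Phi>2 = 0 \<and> z * \<Phi>22 > 0 \<and> \<Phi>11 * \<Phi>22 - \<Phi>12\<^sup>2 \<ge> 0)"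
  shows "\<forall>F. smooth_fun A F \<longrightarrow> (\<forall>p\<in>topspace M. F p \<in> I) \<longrightarrow>
           (\<forall>p\<in>topspace M. L F p = 0) \<longrightarrow>
           (\<forall>p\<in>topspace M. L (\<lambda>q. \<Phi> (F q, carre_du_champ L F F q)) p \<ge> 0)"
proof (intro allI impI ballI)
  fix F p
  assume F: "smooth_fun A F" and FI: "\<forall>p\<in>topspace M. F p \<in> I" and LF: "\<forall>p\<in>topspace M. L F p = 0"
    and p: "p \<in> topspace M"
  interpret riemannian_atlas M A g by standard fact
  \<comment> \<open>The Laplacian, the Ricci tensor and the covariant derivative at \<open>p\<close>
    are defined in this very chart.\<close>
  define c where "c = chart_at A p"
  have c: "c \<in> A" "p \<in> fst c" using chart_at[OF p] by (auto simp: c_def)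
  interpret riemannian_chart c g by (rule riemannian_chart[OF c(1)])
  define x h where "x = snd c p" and "h = F \<circ> chart_inv c"
  define Xc where "Xc = (\<lambda>k y. components c (X (chart_inv c y)) $ k)"
  let ?S = "I \<times> {0..} :: (real \<times> real) set"
  have X: "X q \<in> tangent_space A q" if "q \<in> topspace M" for q
    using assms(5) that unfolding smooth_vector_field_def by blast
  have sX: "smooth_on U (Xc k)" for k
    unfolding Xc_def using assms(5) c(1) unfolding smooth_vector_field_def
    by (intro smooth_on_component open_image) blast
  have sh: "smooth_on U h" unfolding h_def by (rule smooth_fun_chart[OF F c(1)])
  have xU: "x \<in> U" unfolding x_def by (rule chart_image_in[OF c(2)])
  have inM: "chart_inv c y \<in> topspace M" if "y \<in> U" for y
    using chart_topspace[OF c(1) chart_inv_in[OF that]] .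
  have Lh: "lap h y + (\<Sum>k\<in>UNIV. Xc k y * pderivative k h y) = 0" if y: "y \<in> U" for y
    using LF inM[OF y] diffusion_operator_chart[where X=X, OF F c(1) chart_inv_in[OF y] X[OF inM[OF y]]]
    unfolding L_def chart_inv_right[OF y] h_def[symmetric] Xc_def by metis
  have Gam: "carre_du_champ L F F (chart_inv c y) = gam h y" if y: "y \<in> U" for y
    using carre_du_champ_chart[where X=X, OF F c(1) chart_inv_in[OF y] X[OF inM[OF y]]]
    unfolding L_def chart_inv_right[OF y] h_def[symmetric] .

  \<comment> \<open>\<open>V\<close> is the gradient of \<open>F\<close> in coordinates,
    \<open>S0\<close> the Hessian with lower indices, and \<open>H\<close> the Hessian endomorphism
    in the convention that rows are directions and columns are components. \<open>z\<close>,
    \<open>P\<close>, \<open>Q\<close> and \<open>r\<close> are the quantities of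
    \<open>pointwise_inequality\<close>.\<close>
  define G0 \<phi> V S0 where "G0 = metric_matrix c g x" and "\<phi> = (\<chi> k. pderivative k h x)"
    and "V = matrix_inv G0 *v \<phi>" and "S0 = (\<chi> i j. hess h i j x)"
  define z P Q H where "z = \<phi> \<bullet> V" and "P = V \<bullet> (S0 *v V)"
    and "Q = (S0 *v V) \<bullet> (matrix_inv G0 *v (S0 *v V))" and "H = S0 ** matrix_inv G0"
  define r where "r = ricci_diffusion A g X p (coord_vector c p V) (coord_vector c p V)"
  have Vk: "V $ k = grad h k x" for k
    unfolding V_def \<phi>_def G0_def grad_def by (simp add: matrix_vector_mult_def)
  have GV: "G0 *v V = \<phi>"
    unfolding V_def G0_def by (simp add: matrix_vector_mul_assoc matrix_inv_right_left G_invertible xU)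
  have SV: "(S0 *v V) $ i = (\<Sum>k\<in>UNIV. hess h i k x * grad h k x)" for i
    unfolding S0_def by (simp add: matrix_vector_mult_def Vk)
  have zg: "gam h x = z"
    unfolding z_def gam_def inner_vec_def Vk by (simp add: \<phi>_def)
  have wk: "pderivative k (gam h) x = 2 * (S0 *v V) $ k" for k
    unfolding pderivative_gam[OF sh xU] SV ..
  have Pg: "(\<Sum>j\<in>UNIV. grad h j x * pderivative j (gam h) x) = 2 * P"
    unfolding wk P_def inner_vec_def Vk by (simp add: sum_distrib_left ac_simps)
  have Qg: "gam (gam h) x = 4 * Q"
    unfolding gam_eq[OF xU] wk Q_def inner_vec_def G0_def
    by (simp add: matrix_vector_mult_def[of "matrix_inv _"] sum_distrib_left ac_simps)
  have Hij: "H $ i $ j = nabla (grad h) i j x" for i j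
    unfolding nabla_eq_hess[OF sh xU] H_def S0_def G0_def
    by (simp add: matrix_matrix_mult_def B_sym[OF xU, of j] mult.commute)
  have trHH: "trace (H ** H) = (\<Sum>i\<in>UNIV. \<Sum>j\<in>UNIV. nabla (grad h) i j x * nabla (grad h) j i x)"
    unfolding trace_def by (simp add: matrix_matrix_mult_def Hij)
  have trH: "trace H = - (\<Sum>k\<in>UNIV. Xc k x * pderivative k h x)"
    using Lh[OF xU] unfolding trace_def Hij lap_eq_div[OF sh xU] by linarith
  have r_eq: "r = (\<Sum>j\<in>UNIV. \<Sum>k\<in>UNIV. (\<Sum>i\<in>UNIV. riemann_curvature c g i k i j x) * grad h j x * grad h k x)
      - (\<Sum>k\<in>UNIV. pderivative k h x * (\<Sum>j\<in>UNIV. grad h j x * nabla Xc j k x))"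
    using ricci_diffusion_chart[where X=X, OF p X[OF p], of V]
    unfolding r_def c_def[symmetric] x_def[symmetric] G0_def[symmetric] GV Vk Xc_def[symmetric]
    by (simp add: \<phi>_def)
  have Lgam: "lap (gam h) x + (\<Sum>k\<in>UNIV. Xc k x * pderivative k (gam h) x) = 2 * (trace (H ** H) + r)"
    using bochner_drift[of h Xc x, OF sh sX xU] Lh unfolding trHH r_eq by simp

  have G0: "transpose G0 = G0" "\<forall>v. v \<noteq> 0 \<longrightarrow> v \<bullet> (G0 *v v) > 0" and S0: "transpose S0 = S0"
    unfolding G0_def S0_def using sym_metric[OF xU] pos_metric[OF xU] hess_sym[OF sh xU]
    by (auto simp: transpose_def vec_eq_iff)
  note tc = trace_compression(1,2,4-6)[where \<phi>=\<phi>, OF G0 S0, folded V_def, folded z_def P_def Q_def H_def]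
    and trHH_nonneg = trace_compression(3)[OF G0 S0, folded H_def]
  have r_bound: "r \<ge> \<rho> * z + (trace H)\<^sup>2 / (n - d)"
  proof -
    have Xv: "X p = coord_vector c p (\<chi> k. Xc k x)"
      using tangent_space_coord[OF c X[OF p]] unfolding Xc_def x_def chart_inv_left[OF c] by simp
    have "g p (X p) (coord_vector c p V) = - trace H"
      unfolding Xv metric_coord_inner[OF c] x_def[symmetric] G0_def[symmetric] GV trH
      by (simp add: inner_vec_def \<phi>_def)
    moreover have "g p (coord_vector c p V) (coord_vector c p V) = z"
      unfolding metric_coord_inner[OF c] x_def[symmetric] G0_def[symmetric] GV z_def by (rule inner_commute)
    ultimately show ?thesis
      using curvature_lower_bound[where X=X and g=g and \<rho>=\<rho> and n=n, OF _ _ p coord_vector_tangent[OF c, of V]] assms(6,7)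
      unfolding r_def d_def by simp
  qed
  have Fx: "h x = F p" unfolding h_def x_def using chart_inv_left[OF c] by simp
  have in_S: "(h y, gam h y) \<in> ?S" if y: "y \<in> U" for y
  proof -
    have "gam h y \<ge> 0"
    proof -
      have "gam h y = (\<chi> k. grad h k y) \<bullet> (metric_matrix c g y *v (\<chi> k. grad h k y))"
        unfolding gam_def lower_grad[OF y, symmetric] inner_vec_def
        by (simp add: matrix_vector_mult_def mult.commute)
      then show ?thesis using pos_metric[OF y, of "\<chi> k. grad h k y"]
        by (cases "(\<chi> k. grad h k y) = 0") auto
    qed
    then show ?thesis using FI inM[OF y] by (simp add: h_def)
  qed
  define u where "u = (h x, gam h x)"
  define N where "N = (\<lambda>y. \<Phi> (h y, gam h y))"
  have "(\<lambda>y. (h y, gam h y)) ` U \<subseteq> ?S" using in_S by blast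
  note comp = lap_compose(1)[OF this assms(10) sh smooth_gam[OF sh] xU, folded N_def]
    lap_compose(2)[OF this assms(10) sh smooth_gam[OF sh] xU, where X=Xc, folded N_def u_def]
  let ?N = "\<lambda>q. \<Phi> (F q, carre_du_champ L F F q)"
  have Neq: "(?N \<circ> chart_inv c) y = N y" if "y \<in> U" for y
    unfolding N_def using Gam[OF that] by (simp add: h_def)
  \<comment> \<open>The composite is expanded in the chosen chart at \<open>p\<close> itself, so the
    definition of the Laplacian applies directly; differentiability of \<open>N\<close> rules out
    the default value of \<open>X p\<close>.\<close>
  have LN: "L ?N p = lap N x + (\<Sum>k\<in>UNIV. Xc k x * pderivative k N x)"
  proof -
    have pN: "pderivative k (?N \<circ> chart_inv c) x = pderivative k N x" for k
      by (rule pderivative_cong[OF open_image xU Neq])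
    have "L ?N p = lap (?N \<circ> chart_inv c) x + X p ?N"
      unfolding L_def diffusion_operator_def laplace_beltrami_chart_at[OF p] c_def x_def ..
    also have "lap (?N \<circ> chart_inv c) x = lap N x"
      by (rule lap_local[OF xU Neq])
    also have "X p ?N = (\<Sum>k\<in>UNIV. components c (X p) $ k * pderivative k (?N \<circ> chart_inv c) (snd c p))"
    proof (rule vector_apply[OF c X[OF p]])
      show "(?N \<circ> chart_inv c) differentiable (at (snd c p))"
        using has_derivative_transform_within_open[OF differentiable_has_derivative[OF comp(1)] open_image xU Neq[symmetric]]
          differentiable_def unfolding x_def by blast
    qed
    finally show ?thesis
      unfolding x_def[symmetric] pN by (simp add: Xc_def x_def chart_inv_left[OF c])
  qed
  \<comment> \<open>For z > 0 the point \<open>u\<close> is interior and the mixed partials agree.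
    For z = 0 it lies on the boundary, but both sides vanish together with \<open>V\<close>.\<close>
  have mixed: "(partial2 ?S (partial1 ?S \<Phi>) u + partial1 ?S (partial2 ?S \<Phi>) u) * (2 * P)
      = 4 * partial2 ?S (partial1 ?S \<Phi>) u * P"
  proof (cases "z = 0")
    case True
    then have "V = 0" by (rule tc(2))
    then show ?thesis by (simp add: P_def)
  next
    case False
    have "open (I \<times> {0::real<..})" by (rule open_Times[OF assms(8) open_greaterThan])
    moreover have "I \<times> {0<..} \<subseteq> ?S" "u \<in> I \<times> {0<..}"
      using in_S[OF xU] False zg by (auto simp: u_def)
    ultimately show ?thesis using partial_commute[OF assms(10)] by simp
  qed
  have "0 \<le> 2 * partial2 ?S \<Phi> u * (trace (H ** H) + r) + partial1 ?S (partial1 ?S \<Phi>) u * z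
      + 4 * partial2 ?S (partial1 ?S \<Phi>) u * P + 4 * partial2 ?S (partial2 ?S \<Phi>) u * Q"
  proof (rule pointwise_inequality[where d=d and n=n and \<rho>=\<rho> and \<tau>="trace H"])
    show "z \<ge> 0" "trace (H ** H) \<ge> 0" "P\<^sup>2 \<le> z * Q" using tc(1,3) trHH_nonneg by blast+
    show "P = 0 \<and> Q = 0 \<and> r = 0" if "z = 0"
    proof -
      have V0: "V = 0" using tc(2)[OF that] .
      then have "grad h k x = 0" for k by (metis Vk zero_index)
      then show ?thesis using V0 unfolding r_eq by (simp add: P_def Q_def)
    qed
    show "P\<^sup>2 = z * Q" if "d = 1" using tc(4) that by (simp add: d_def)
    show "0 \<le> trace (H ** H) - 2 * Q / z + (P / z)\<^sup>2 + b\<^sup>2 * (d - 1) - 2 * b * (trace H - P / z)"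
      if "z > 0" for b using tc(5)[OF that, of b] by (simp add: d_def)
    show "r \<ge> \<rho> * z + (trace H)\<^sup>2 / (n - d)" by (rule r_bound)
    have "CARD('n) = 1 \<or> CARD('n) \<ge> 2" using zero_less_card_finite[where 'a='n] by linarith
    then show "d = 1 \<or> d \<ge> 2" unfolding d_def by auto
    show "n \<noteq> d" by fact
    have "fst u \<in> I" "snd u \<ge> 0" "u = (fst u, snd u)" "snd u = z"
      using in_S[OF xU] zg by (auto simp: u_def)
    then show "(partial2 ?S \<Phi> u > 0
          \<and> partial2 ?S \<Phi> u * ((n + 1 - d) / (n - d)) + 2 * z * partial2 ?S (partial2 ?S \<Phi>) u > 0
          \<and> (n - d) * (n * partial2 ?S \<Phi> u + 2 * (n - 1) * z * partial2 ?S (partial2 ?S \<Phi>) u) > 0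
          \<and> 2 * \<rho> * partial2 ?S \<Phi> u + partial1 ?S (partial1 ?S \<Phi>) u
              - 2 * (n - 1) * (z * (partial2 ?S (partial1 ?S \<Phi>) u)\<^sup>2
                / (n * partial2 ?S \<Phi> u + 2 * (n - 1) * z * partial2 ?S (partial2 ?S \<Phi>) u)) \<ge> 0)
       \<or> (partial2 ?S \<Phi> u = 0 \<and> z * partial2 ?S (partial2 ?S \<Phi>) u = 0
          \<and> z * partial2 ?S (partial1 ?S \<Phi>) u = 0 \<and> z * partial1 ?S (partial1 ?S \<Phi>) u \<ge> 0)
       \<or> (partial2 ?S \<Phi> u = 0 \<and> z * partial2 ?S (partial2 ?S \<Phi>) u > 0
          \<and> partial1 ?S (partial1 ?S \<Phi>) u * partial2 ?S (partial2 ?S \<Phi>) u - (partial2 ?S (partial1 ?S \<Phi>) u)\<^sup>2 \<ge> 0)"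
      using assms(11)[unfolded Let_def] by metis
  qed
  then show "L ?N p \<ge> 0"
    unfolding LN comp(2) Lh[OF xU] Lgam Pg Qg zg mixed by (simp add: algebra_simps)
qed

end
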